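(* Let $G$ be a $4$-chordal graph with $n\ge 5$ vertices. Then $G$ has a clique transversal of size at most $\lfloor 2(n-1)/7\rfloor$.
   Context: All graphs are finite and simple. A clique is a complete subgraph (not necessarily maximal); a $k$-clique is a clique on $k$ vertices; a clique is non-trivial if it has at least $2$ vertices, and maximal if it is inclusion-wise maximal among complete subgraphs. A graph is chordal if it contains no induced cycle of length four or more. A chordal graph is $4$-chordal if every edge is contained in a $4$-clique. A clique transversal of $G$ is a set $U$ of vertices such that every non-trivial maximal clique of $G$ contains a vertex of $U$. *)

theory Defs
  imports "Graph_Theory.Graph_Theory"
begin

text \<open>
  A finite simple graph is a \<^locale>\<open>pair_graph\<close>: finite, symmetric and loop-free, with both
  orientations of an edge in \<^const>\<open>parcs\<close>. A clique is represented by its vertex set.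
\<close>

definition k_clique :: "'a pair_pre_digraph \<Rightarrow> nat \<Rightarrow> 'a set \<Rightarrow> bool" where
  "k_clique G k C \<longleftrightarrow> C \<subseteq> pverts G \<and> K\<^bsub>k\<^esub> (with_proj G \<restriction> C)"

definition clique :: "'a pair_pre_digraph \<Rightarrow> 'a set \<Rightarrow> bool" where
  "clique G C \<longleftrightarrow> (\<exists>k. k_clique G k C)"

definition maximal_clique :: "'a pair_pre_digraph \<Rightarrow> 'a set \<Rightarrow> bool" where
  "maximal_clique G C \<longleftrightarrow> clique G C \<and> (\<forall>D. clique G D \<and> C \<subseteq> D \<longrightarrow> D = C)"

definition nontrivial_clique :: "'a pair_pre_digraph \<Rightarrow> 'a set \<Rightarrow> bool" where
  "nontrivial_clique G C \<longleftrightarrow> clique G C \<and> 2 \<le> card C"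

text \<open>
  A cycle is a list of consecutive arcs, so its length is \<^term>\<open>length p\<close> and its vertices are the
  sources of its arcs. It is induced if every edge between its vertices is, in one of the two
  orientations, an edge of the cycle. The library's cycles include \<open>u, v, u\<close>; this
  degenerate case is irrelevant below, where only lengths of at least 4 occur.
\<close>

definition induced_cycle :: "'a pair_pre_digraph \<Rightarrow> ('a \<times> 'a) awalk \<Rightarrow> bool" where
  "induced_cycle G p \<longleftrightarrow>
     pre_digraph.cycle (with_proj G) p \<and>
     arcs (with_proj G \<restriction> (fst ` set p)) = set p \<union> (set p)\<inverse>"

definition chordal :: "'a pair_pre_digraph \<Rightarrow> bool" where
  "chordal G \<longleftrightarrow> \<not> (\<exists>p. induced_cycle G p \<and> 4 \<le> length p)"

definition four_chordal :: "'a pair_pre_digraph \<Rightarrow> bool" where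
  "four_chordal G \<longleftrightarrow>
     chordal G \<and> (\<forall>(u, v) \<in> parcs G. \<exists>C. k_clique G 4 C \<and> u \<in> C \<and> v \<in> C)"

definition clique_transversal :: "'a pair_pre_digraph \<Rightarrow> 'a set \<Rightarrow> bool" where
  "clique_transversal G U \<longleftrightarrow>
     U \<subseteq> pverts G \<and>
     (\<forall>C. nontrivial_clique G C \<and> maximal_clique G C \<longrightarrow> C \<inter> U \<noteq> {})"

lemma k_clique_iff:
  assumes "pair_graph G"
  shows "k_clique G k C \<longleftrightarrow>
    C \<subseteq> pverts G \<and> card C = k \<and> (\<forall>u\<in>C. \<forall>v\<in>C. u \<noteq> v \<longrightarrow> (u, v) \<in> parcs G)"
proof -
  interpret pair_graph G by fact
  have ends: "arcs_ends (with_proj G \<restriction> C) = {(u, v). (u, v) \<in> parcs G \<and> u \<in> C \<and> v \<in> C}"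
    by (force simp: arcs_ends_conv)
  have loopfree: "(u, u) \<notin> parcs G" for u
    using pair_no_loops by fastforce
  have "graph (with_proj G \<restriction> C)" if "C \<subseteq> pverts G"
  proof -
    have "finite C" using that pair_finite_verts finite_subset by blast
    moreover have "sym (parcs G)"
      using pair_sym_arcs by (simp add: symmetric_def)
    ultimately show ?thesis
      using pair_finite_arcs loopfree ends
      by unfold_locales (auto simp: arc_to_ends_def symmetric_def sym_def)
  qed
  then show ?thesis
    using loopfree unfolding k_clique_def complete_digraph_def ends by (auto simp: set_eq_iff)
qed

end

theory Submission imports Defs begin

text \<open>
  Along a perfect elimination ordering a chordal graph becomes a system of cliques
  \<open>bag S v\<close>, each consisting of a vertex \<open>v\<close> and its earlier neighbours \<open>S v\<close>.

  Suppose first that the cliques to be met have at least four vertices. The key fact concerns systems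
  that hang on a root clique \<open>K\<close> with at most three vertices, coloured injectively with three colours: there are
  three sets \<open>U i\<close> outside the root, of total size at most \<open>6/7\<close> of the number of non-root vertices, such that
  \<open>U i\<close> together with the root vertex of colour \<open>i\<close> is a transversal. In a minimal counterexample
  every leaf clique is \<open>{x, h, m, l}\<close> with \<open>h < m < l < x\<close>; a vertex that is last in one leaf is last in all of
  its leaves; and a greedy colouring of the remaining vertices, in which \<open>h\<close> and \<open>m\<close> get different colours
  and all larger required cliques are rainbow, yields transversals that are cheap enough: the vertex \<open>l\<close> is
  bought only for the colour that \<open>h\<close> and \<open>m\<close> miss.

  The constant \<open>-2/7\<close> comes from a minimal counterexample of the unrooted problem. Its last branching
  either admits a deletion of four vertices at the cost of one, or one deletes a few vertices near it, re-roots the rest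
  at a clique whose vertices are coloured, two of them alike, and averages over three transversals.

  Finally, maximal triangles must be met as well. The graph falls apart at such a triangle into three parts; if the triangle
  cannot be met for free, then buying one of its vertices does not make any part cheaper, and the bound for
  each part with one vertex joined to the triangle bounds the total.
\<close>

section \<open>Systems of earlier neighbours\<close>

text \<open>The factor 6/7 is an extremal ratio. In the final colouring every non-leaf that is never
  last is bought for one colour, and each leaf causes at most one further purchase. With N such
  vertices, M leaves and R last vertices the cost is at most N + M, out of N + M + R vertices. A
  vertex lies in at most two leaf cliques, so M \<le> 2 R, and each of the N vertices is the first
  or middle vertex of a leaf, so N \<le> 2 M; the worst case 4 : 2 : 1 costs 6 for 7. Local
  reductions obey the same exchange rate: a vertex bought for all three colours pays for four
  deleted vertices, two such vertices pay for seven, and a root vertex, being free for its own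
  colour, pays for smaller deletions. Roots are there because cutting below a clique of at most
  three vertices must leave an instance of the same kind. Three colours fit: a required clique on
  three root vertices is then met for free in every colour. Averaging gives 2/7 per transversal, and
  the constant costs one more vertex: eight vertices are traded for two purchases, as 7 * 2 + 2 = 2
  * 8.\<close>

definition bag :: "(nat \<Rightarrow> nat set) \<Rightarrow> nat \<Rightarrow> nat set" where
  "bag S v = insert v (S v)"

definition transv :: "(nat \<Rightarrow> nat set) \<Rightarrow> nat set \<Rightarrow> nat set \<Rightarrow> bool" where
  "transv S I D \<longleftrightarrow> (\<forall>v\<in>I. bag S v \<inter> D \<noteq> {})"

definition root_colour :: "(nat \<Rightarrow> nat) \<Rightarrow> nat set \<Rightarrow> nat \<Rightarrow> nat set" where
  "root_colour c K i = {k \<in> K. c k = i}"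

definition good :: "nat set \<Rightarrow> (nat \<Rightarrow> nat) \<Rightarrow> nat set \<Rightarrow> (nat \<Rightarrow> nat set) \<Rightarrow> nat set \<Rightarrow> bool" where
  "good K c W S I \<longleftrightarrow> (\<exists>U. (\<forall>i<3. U i \<subseteq> W \<and> transv S I (U i \<union> root_colour c K i)) \<and>
     7 * (\<Sum>i<3. card (U i)) \<le> 6 * card W)"

definition leaf :: "nat set \<Rightarrow> (nat \<Rightarrow> nat set) \<Rightarrow> nat \<Rightarrow> bool" where
  "leaf W S x \<longleftrightarrow> x \<in> W \<and> (\<forall>j\<in>W. x \<notin> S j)"

text \<open>The strict descendants of \<open>u\<close>, reached by passing repeatedly to a later
  neighbour.\<close>

definition Des :: "nat set \<Rightarrow> (nat \<Rightarrow> nat set) \<Rightarrow> nat \<Rightarrow> nat set" where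
  "Des W S u = {k. (u, k) \<in> {(a, k). k \<in> W \<and> a \<in> S k}\<^sup>+}"

definition leaves_at :: "nat set \<Rightarrow> (nat \<Rightarrow> nat set) \<Rightarrow> nat \<Rightarrow> nat set" where
  "leaves_at W S v = {x. leaf W S x \<and> v \<in> S x}"

lemma sum3: "(\<Sum>i<3. f i) = f 0 + f 1 + f (2::nat)" for f :: "nat \<Rightarrow> nat"
  by (simp add: numeral_3_eq_3 numeral_2_eq_2)

text \<open>Every reduction ends here: a transversal of the smaller instance is repaired for each
  colour separately, and only the sum of the three repair costs \<open>e i\<close> is
  charged.\<close>

lemma good_extend:
  assumes "good K c W' S' I'" "finite W"
    and ext: "\<And>i U'. i < 3 \<Longrightarrow> U' \<subseteq> W' \<Longrightarrow> transv S' I' (U' \<union> root_colour c K i) \<Longrightarrow>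
        \<exists>U\<subseteq>W. transv S I (U \<union> root_colour c K i) \<and> card U \<le> card U' + e i"
    and size: "7 * (\<Sum>i<3. e i) + 6 * card W' \<le> 6 * card W"
  shows "good K c W S I"
proof -
  obtain U' where U': "\<And>i. i < 3 \<Longrightarrow> U' i \<subseteq> W' \<and> transv S' I' (U' i \<union> root_colour c K i)"
    and le: "7 * (\<Sum>i<3. card (U' i)) \<le> 6 * card W'" using assms(1) unfolding good_def by auto
  define U where "U i = (SOME V. V \<subseteq> W \<and> transv S I (V \<union> root_colour c K i) \<and> card V \<le> card (U' i) + e i)" for i
  have U: "U i\<subseteq>W \<and> transv S I (U i \<union> root_colour c K i) \<and> card (U i) \<le> card (U' i) + e i" if "i < 3" for i
    unfolding U_def by (rule someI_ex) (use ext[OF that] U'[OF that] in auto)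
  have "(\<Sum>i<3. card (U i)) \<le> (\<Sum>i<3. card (U' i) + e i)"
    by (intro sum_mono) (use U in auto)
  then have "7 * (\<Sum>i<3. card (U i)) \<le> 6 * card W"
    using le size by (simp add: sum.distrib)
  then show ?thesis unfolding good_def using U by (intro exI[of _ U]) auto
qed

text \<open>The vertices of \<open>W\<close> are ordered as natural numbers, after the root \<open>K\<close>; edges inside the root
  are not recorded. Only the cliques \<open>bag S v\<close> with \<open>v \<in> I\<close> have to be met.\<close>

locale peo_sys =
  fixes K W :: "nat set" and S :: "nat \<Rightarrow> nat set" and I :: "nat set"
  assumes finK: "finite K" and finW: "finite W"
    and KW: "k \<in> K \<Longrightarrow> w \<in> W \<Longrightarrow> k < w"
    and Ssub: "v \<in> W \<Longrightarrow> S v \<subseteq> K \<union> W"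
    and Sless: "v \<in> W \<Longrightarrow> u \<in> S v \<Longrightarrow> u < v"
    and peo: "v \<in> W \<Longrightarrow> a \<in> S v \<Longrightarrow> b \<in> S v \<Longrightarrow> b \<in> W \<Longrightarrow> a < b \<Longrightarrow> a \<in> S b"
    and IW: "I \<subseteq> W" and Icard: "v \<in> I \<Longrightarrow> 3 \<le> card (S v)"
begin

lemma finS: "v \<in> W \<Longrightarrow> finite (S v)"
  using Ssub finK finW by (meson finite_Un finite_subset)

lemma above_in_W: "v \<in> W \<Longrightarrow> u \<in> S v \<Longrightarrow> w \<in> W \<Longrightarrow> w \<le> u \<Longrightarrow> u \<in> W"
  using KW Ssub by (meson UnE leD subsetD)

lemma Des_base: "k \<in> W \<Longrightarrow> u \<in> S k \<Longrightarrow> k \<in> Des W S u"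
  unfolding Des_def by auto

lemma Des_step: "j \<in> Des W S u \<Longrightarrow> k \<in> W \<Longrightarrow> j \<in> S k \<Longrightarrow> k \<in> Des W S u"
  unfolding Des_def by (auto intro: trancl_into_trancl)

lemma Des_trans: "j \<in> Des W S u \<Longrightarrow> k \<in> Des W S j \<Longrightarrow> k \<in> Des W S u"
  unfolding Des_def by auto

lemma Des_induct [consumes 1, case_names base step]:
  assumes "k \<in> Des W S u" and "\<And>k. k \<in> W \<Longrightarrow> u \<in> S k \<Longrightarrow> P k"
    and "\<And>j k. j \<in> Des W S u \<Longrightarrow> P j \<Longrightarrow> k \<in> W \<Longrightarrow> j \<in> S k \<Longrightarrow> P k"
  shows "P k"
proof -
  have "(u, k) \<in> {(a, k). k \<in> W \<and> a \<in> S k}\<^sup>+" using assms(1) by (simp add: Des_def)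
  then show ?thesis
    by (induction rule: trancl_induct) (use assms(2,3) in \<open>auto simp: Des_def\<close>)
qed

lemma Des_sub: "Des W S u \<subseteq> W"
proof
  fix k assume "k \<in> Des W S u" then show "k \<in> W" by (induction rule: Des_induct) auto
qed

lemma Des_gt: "k \<in> Des W S u \<Longrightarrow> u < k"
proof (induction rule: Des_induct)
  case (base k) then show ?case by (simp add: Sless)
next
  case (step j k) then show ?case using Sless[of k j] by simp
qed

text \<open>An earlier neighbour of a descendant is handed back along the chain by
  \<open>peo\<close> until it lies beyond \<open>u\<close>, is \<open>u\<close>, or is an earlier
  neighbour of \<open>u\<close>. So \<open>bag S u\<close> separates the descendants of
  \<open>u\<close> from everything else.\<close>

lemma Des_path:
  assumes "u \<in> W" "k \<in> Des W S u"
  shows "s \<in> S k \<Longrightarrow> s \<in> Des W S u \<or> s = u \<or> s \<in> S u"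
  using assms(2)
proof (induction arbitrary: s rule: Des_induct)
  case (base k)
  consider "s = u" | "s < u" | "u < s" by linarith
  then show ?case
  proof cases
    case 2 then show ?thesis using base peo assms(1) by blast
  next
    case 3
    then have "s \<in> W" using above_in_W base assms(1) by (meson less_imp_le)
    then show ?thesis using 3 base peo Des_base by blast
  qed auto
next
  case (step j k)
  have jW: "j \<in> W" using step Des_sub by blast
  consider "s = j" | "s < j" | "j < s" by linarith
  then show ?case
  proof cases
    case 2 then show ?thesis using step peo jW by blast
  next
    case 3
    then have "s \<in> W" using above_in_W step jW by (meson less_imp_le)
    then show ?thesis using 3 step peo Des_step by blast
  qed (use step in auto)
qed

lemma Des_path_less: "u \<in> W \<Longrightarrow> k \<in> Des W S u \<Longrightarrow> s \<in> S k \<Longrightarrow> s < u \<Longrightarrow> s \<in> S u"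
  using Des_path Des_gt by (metis less_asym less_irrefl)

lemma Des_path_gt: "u \<in> W \<Longrightarrow> k \<in> Des W S u \<Longrightarrow> s \<in> S k \<Longrightarrow> u < s \<Longrightarrow> s \<in> Des W S u"
  using Des_path Sless by (metis less_asym less_irrefl)

text \<open>Descent behaves like a tree: walking back from the common descendant \<open>k\<close> to
  \<open>v'\<close> never leaves the descendants of \<open>v\<close>.\<close>

lemma Des_tree:
  assumes "v \<in> W" "v' \<in> W" "v < v'" "k \<in> Des W S v'"
  shows "k \<in> Des W S v \<Longrightarrow> v' \<in> Des W S v"
  using assms(4)
proof (induction rule: Des_induct)
  case (base k) then show ?case using Des_path_gt assms by blast
next
  case (step j k)
  then have "v < j" using Des_gt assms(3) by (meson less_trans)
  then show ?case using step Des_path_gt assms by blast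
qed

lemma leafD: "leaf W S x \<Longrightarrow> x \<in> W" "leaf W S x \<Longrightarrow> j \<in> W \<Longrightarrow> x \<notin> S j"
  unfolding leaf_def by auto

lemma leaf_bag: "leaf W S x \<Longrightarrow> i \<in> W \<Longrightarrow> x \<in> bag S i \<Longrightarrow> i = x"
  unfolding leaf_def bag_def by auto

text \<open>The least vertex with \<open>u\<close> among its earlier neighbours works: an
  \<open>s > u\<close> in its set would by \<open>peo\<close> be a smaller vertex of this
  kind.\<close>

lemma child_exists:
  assumes "u \<in> W" "\<not> leaf W S u"
  shows "\<exists>d\<in>W. u \<in> S d \<and> (\<forall>s\<in>S d. s \<le> u)"
proof -
  define d where "d = (LEAST j. j \<in> W \<and> u \<in> S j)"
  have ex: "\<exists>j. j \<in> W \<and> u \<in> S j" using assms unfolding leaf_def by blast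
  have d: "d \<in> W" "u \<in> S d" unfolding d_def using LeastI_ex[OF ex] by auto
  have "s \<le> u" if s: "s \<in> S d" for s
  proof (rule ccontr)
    assume "\<not> s \<le> u"
    then have us: "u < s" by simp
    then have "s \<in> W" using above_in_W d s assms(1) by (meson less_imp_le)
    then have "u \<in> S s" using peo d s us by blast
    then have "d \<le> s" unfolding d_def using \<open>s \<in> W\<close> by (intro Least_le) auto
    then show False using Sless d s by (meson leD)
  qed
  then show ?thesis using d by blast
qed

end


section \<open>Minimal rooted counterexamples\<close>

text \<open>Lexicographic in the numbers of vertices, of edges (those inside the root not counted)
  and of required cliques. This allows three ways of shrinking: deleting vertices, deleting an edge,
  dropping a requirement.\<close>

definition smaller :: "nat set \<Rightarrow> (nat \<Rightarrow> nat set) \<Rightarrow> nat set \<Rightarrow> nat set \<Rightarrow> (nat \<Rightarrow> nat set) \<Rightarrow> nat set \<Rightarrow> bool" where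
  "smaller W' S' I' W S I \<longleftrightarrow> card W' < card W \<or> card W' = card W \<and>
     ((\<Sum>v\<in>W'. card (S' v)) < (\<Sum>v\<in>W. card (S v)) \<or>
      (\<Sum>v\<in>W'. card (S' v)) = (\<Sum>v\<in>W. card (S v)) \<and> card I' < card I)"

definition tri :: "nat set \<Rightarrow> (nat \<Rightarrow> nat set) \<Rightarrow> nat \<Rightarrow> nat \<Rightarrow> nat \<Rightarrow> nat \<Rightarrow> bool" where
  "tri W S x h m l \<longleftrightarrow> leaf W S x \<and> S x = {h, m, l} \<and> h < m \<and> m < l"

lemma extend_inj_colouring:
  fixes c :: "nat \<Rightarrow> nat"
  assumes "finite T" "card T \<le> 3" "T0 \<subseteq> T" "inj_on c T0" "c ` T0 \<subseteq> {..<3}"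
  shows "\<exists>c'. inj_on c' T \<and> c' ` T \<subseteq> {..<3} \<and> (\<forall>t\<in>T0. c' t = c t)"
proof -
  have "card (T - T0) = card T - card T0" using assms by (simp add: card_Diff_subset finite_subset)
  moreover have "card ({..<3} - c ` T0) = 3 - card T0"
    using assms by (simp add: card_Diff_subset card_image finite_subset)
  ultimately have "card (T - T0) \<le> card ({..<3} - c ` T0)" using assms(2) by simp
  then obtain f where f: "inj_on f (T - T0)" "f ` (T - T0) \<subseteq> {..<3} - c ` T0"
    using card_le_inj[of "T - T0" "{..<3} - c ` T0"] assms(1) by auto
  define c' where "c' t = (if t \<in> T0 then c t else f t)" for t
  have "inj_on c' T"
  proof (rule inj_onI)
    fix a b assume ab: "a \<in> T" "b \<in> T" "c' a = c' b"
    show "a = b"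
    proof (cases "a \<in> T0"; cases "b \<in> T0")
      assume "a \<in> T0" "b \<in> T0" then show ?thesis using ab assms(4) by (auto simp: c'_def inj_on_def)
    next
      assume "a \<notin> T0" "b \<notin> T0" then show ?thesis using ab f(1) by (auto simp: c'_def inj_on_def)
    next
      assume "a \<in> T0" "b \<notin> T0" then show ?thesis using ab f(2) by (auto simp: c'_def)
    next
      assume "a \<notin> T0" "b \<in> T0"
      then have "f a = c b" "f a \<notin> c ` T0" using ab f(2) by (auto simp: c'_def)
      then show ?thesis using \<open>b \<in> T0\<close> by auto
    qed
  qed
  moreover have "c' ` T \<subseteq> {..<3}" using f(2) assms(5) by (auto simp: c'_def)
  ultimately show ?thesis by (intro exI[of _ c']) (auto simp: c'_def)
qed

lemma goodD:
  "good K c W S I \<Longrightarrow> \<exists>U. (\<forall>i<3. U i \<subseteq> W \<and> transv S I (U i \<union> root_colour c K i)) \<and>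
     7 * (\<Sum>i<3. card (U i)) \<le> 6 * card W"
  unfolding good_def .

section \<open>Regions hanging below a small clique\<close>

context peo_sys begin

lemma child_bag:
  assumes "u \<in> W" "d \<in> W" "u \<in> S d" "\<forall>s\<in>S d. s \<le> u" shows "S d \<subseteq> bag S u"
proof
  fix s assume s: "s \<in> S d"
  show "s \<in> bag S u"
  proof (cases "s = u")
    case False
    then have "s < u" using assms(4) s by force
    then have "s \<in> S u" by (rule peo[OF assms(2) s assms(3) assms(1)])
    then show ?thesis by (simp add: bag_def)
  qed (simp add: bag_def)
qed

lemma region_closed: "w \<in> insert d (Des W S d) \<Longrightarrow> w \<in> bag S v \<Longrightarrow> v \<in> W \<Longrightarrow> v \<in> insert d (Des W S d)"
  using Des_base Des_step unfolding bag_def by blast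

lemma region_sub: "d \<in> W \<Longrightarrow> v \<in> insert d (Des W S d) \<Longrightarrow> bag S v \<subseteq> S d \<union> insert d (Des W S d)"
  using Des_path unfolding bag_def by blast

text \<open>The separating clique \<open>S d\<close> becomes the root of everything from
  \<open>d\<close> downwards; this is the reason for carrying roots through the whole
  induction.\<close>

lemma region_sys: "d \<in> W \<Longrightarrow> peo_sys (S d) (insert d (Des W S d)) S (I \<inter> insert d (Des W S d))"
proof
  assume d: "d \<in> W"
  let ?O = "insert d (Des W S d)"
  have OW: "?O \<subseteq> W" using d Des_sub by blast
  show "finite (S d)" using finS d by blast
  show "finite ?O" using OW finW by (auto intro: finite_subset)
  show "k < w" if "k \<in> S d" "w \<in> ?O" for k w
    using that Sless[OF d] Des_gt by (metis insertE less_trans)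
  show "S v \<subseteq> S d \<union> ?O" if "v \<in> ?O" for v
    using region_sub[OF d that] by (auto simp: bag_def)
  show "u < v" if "v \<in> ?O" "u \<in> S v" for u v using that OW Sless by blast
  show "a \<in> S b" if "v \<in> ?O" "a \<in> S v" "b \<in> S v" "b \<in> ?O" "a < b" for v a b
    using that OW peo by blast
  show "I \<inter> ?O \<subseteq> ?O" by blast
  show "3 \<le> card (S v)" if "v \<in> I \<inter> ?O" for v using that Icard by blast
qed

text \<open>Either a vertex of \<open>S d\<close> that lowers the cost below \<open>d\<close> can be bought whenever the bag of
  \<open>u\<close> is missed, so that this bag is redundant, or the region below \<open>d\<close> can be paid for
  independently of the rest.\<close>

lemma region_redundant_or_paid:
  fixes c :: "nat \<Rightarrow> nat"
  assumes u: "u \<in> I" and d: "d \<in> W" "u \<in> S d" "\<forall>s\<in>S d. s \<le> u" and c3: "card (S d) \<le> 3"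
    and cK: "inj_on c K" "c ` K \<subseteq> {..<3}"
    and O: "O' = insert d (Des W S d)"
    and R: "\<And>c'. inj_on c' (S d) \<Longrightarrow> c' ` S d \<subseteq> {..<3} \<Longrightarrow> good (S d) c' O' S (I \<inter> O')"
  shows "(\<forall>i U. i < 3 \<longrightarrow> U \<subseteq> W \<longrightarrow> transv S (I - {u}) (U \<union> root_colour c K i) \<longrightarrow>
             (\<exists>U2\<subseteq>W. transv S I (U2 \<union> root_colour c K i) \<and> card U2 \<le> card U)) \<or>
         (\<exists>A. (\<forall>i<3. A i \<subseteq> O' \<and> (\<forall>v\<in>I \<inter> O'. bag S v \<inter> (A i \<union> root_colour c K i) \<noteq> {})) \<and>
             7 * (\<Sum>i<3. card (A i)) \<le> 6 * card O')"
proof -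
  have uW: "u \<in> W" using u IW by blast
  have OW: "O' \<subseteq> W" using d Des_sub O by blast
  have finO: "finite O'" using OW finW by (auto intro: finite_subset)
  have Sd: "S d \<subseteq> bag S u" using child_bag uW d by blast
  have ud: "u < d" using Sless d by blast
  have uO: "u \<notin> O'" using ud Des_gt O by (metis insertE less_asym less_irrefl)
  have KO: "k \<notin> O'" if "k \<in> K" for k using that OW KW by blast
  have sub: "bag S v \<subseteq> S d \<union> O'" if "v \<in> O'" for v using region_sub d(1) that O by blast
  have closed: "v \<in> O'" if "w \<in> O'" "w \<in> bag S v" "v \<in> W" for v w using region_closed that O by blast
  \<comment> \<open>Vertices of \<open>S d\<close> that belong to the old root keep their colours,
    so that sets found for the region fit the given colouring.\<close>
  have "inj_on c (S d \<inter> K)" "c ` (S d \<inter> K) \<subseteq> {..<3}" using cK by (auto intro: inj_on_subset)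
  then obtain c' where c': "inj_on c' (S d)" "c' ` S d \<subseteq> {..<3}" "\<forall>t\<in>S d \<inter> K. c' t = c t"
    using extend_inj_colouring[of "S d" "S d \<inter> K" c] c3 finS[OF d(1)] by blast
  obtain U where U: "\<And>i. i < 3 \<Longrightarrow> U i \<subseteq> O' \<and> transv S (I \<inter> O') (U i \<union> root_colour c' (S d) i)"
    and Ucard: "7 * (\<Sum>i<3. card (U i)) \<le> 6 * card O'"
    using goodD[OF R[OF c'(1,2)]] by metis
  have rtk: "root_colour c' (S d) (c' k) = {k}" if "k \<in> S d" for k
    using that c'(1) unfolding root_colour_def inj_on_def by blast
  show ?thesis
  \<comment> \<open>The question is whether buying some non-root vertex \<open>k\<close> of
    \<open>S d\<close> saves a purchase in the region, compared with every set that meets the bags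
    there without help from outside.\<close>
  proof (cases "\<exists>k\<in>S d \<inter> W. \<forall>A\<subseteq>O'. (\<forall>v\<in>I \<inter> O'. bag S v \<inter> A \<noteq> {}) \<longrightarrow> card (U (c' k)) < card A")
    case True
    then obtain k where k: "k \<in> S d" "k \<in> W"
      and expensive: "\<And>A. A \<subseteq> O' \<Longrightarrow> (\<forall>v\<in>I \<inter> O'. bag S v \<inter> A \<noteq> {}) \<Longrightarrow> card (U (c' k)) < card A"
      by blast
    have k3: "c' k < 3" using k c'(2) by blast
    have "\<exists>U2\<subseteq>W. transv S I (U2 \<union> root_colour c K i) \<and> card U2 \<le> card V"
      if V: "V \<subseteq> W" "transv S (I - {u}) (V \<union> root_colour c K i)" for i V
    proof (cases "bag S u \<inter> (V \<union> root_colour c K i) = {}")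
      case False
      then have "transv S I (V \<union> root_colour c K i)" using V(2) unfolding transv_def by blast
      then show ?thesis using V(1) by blast
    next
      case True
      \<comment> \<open>The missed \<open>bag S u\<close> contains \<open>S d\<close>, so the
        purchases inside the region meet its bags alone. They cost at least one more than
        \<open>U (c' k)\<close>, and the difference pays for \<open>k\<close>.\<close>
      have "bag S v \<inter> (V \<inter> O') \<noteq> {}" if v: "v \<in> I \<inter> O'" for v
      proof -
        have "v \<noteq> u" using v uO by blast
        then obtain w where w: "w \<in> bag S v" "w \<in> V \<union> root_colour c K i" using V(2) v unfolding transv_def by blast
        have "w \<notin> S d" using w True Sd by blast
        then have "w \<in> O'" using sub v w(1) by blast
        moreover have "w \<notin> root_colour c K i" using KO calculation unfolding root_colour_def by blast
        ultimately show ?thesis using w by blast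
      qed
      then have less: "card (U (c' k)) < card (V \<inter> O')" using expensive[of "V \<inter> O'"] by blast
      define U2 where "U2 = (V - O') \<union> insert k (U (c' k))"
      have finV: "finite V" using V(1) finW by (auto intro: finite_subset)
      have finU: "finite (U (c' k))" using U[OF k3] finO by (auto intro: finite_subset)
      have "card U2 \<le> card (V - O') + card (insert k (U (c' k)))" unfolding U2_def by (rule card_Un_le)
      also have "\<dots> \<le> card (V - O') + Suc (card (U (c' k)))"
        using card_insert_le_m1 finU by (simp add: card_insert_if)
      also have "\<dots> \<le> card (V - O') + card (V \<inter> O')" using less by simp
      also have "\<dots> = card V" using finV by (metis add.commute card_Int_Diff)
      finally have "card U2 \<le> card V" .
      moreover have "U2 \<subseteq> W" using V(1) U[OF k3] OW k(2) unfolding U2_def by blast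
      moreover have "transv S I (U2 \<union> root_colour c K i)" unfolding transv_def
      proof
        fix v assume v: "v \<in> I"
        show "bag S v \<inter> (U2 \<union> root_colour c K i) \<noteq> {}"
        proof (cases "v \<in> O'")
          case True
          then have "bag S v \<inter> (U (c' k) \<union> {k}) \<noteq> {}"
            using U[OF k3] v rtk[OF k(1)] unfolding transv_def by auto
          then show ?thesis unfolding U2_def by blast
        next
          case False
          show ?thesis
          proof (cases "v = u")
            case True then show ?thesis using Sd k(1) unfolding U2_def by blast
          next
            case neq: False
            then obtain w where w: "w \<in> bag S v" "w \<in> V \<union> root_colour c K i"
              using V(2) v unfolding transv_def by blast
            have "w \<notin> O'" using closed[OF _ w(1)] v IW False by blast
            then show ?thesis using w unfolding U2_def by blast
          qed
        qed
      qed
      ultimately show ?thesis by blast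
    qed
    then show ?thesis by blast
  next
    case False
    then have cheap: "\<exists>A\<subseteq>O'. (\<forall>v\<in>I \<inter> O'. bag S v \<inter> A \<noteq> {}) \<and> card A \<le> card (U (c' k))"
      if "k \<in> S d \<inter> W" for k using that by (meson not_less)
    have "\<exists>A\<subseteq>O'. (\<forall>v\<in>I \<inter> O'. bag S v \<inter> (A \<union> root_colour c K i) \<noteq> {}) \<and> card A \<le> card (U i)"
      if i: "i < 3" for i
    \<comment> \<open>If colour \<open>i\<close> sits on a non-root vertex of \<open>S d\<close>, a
      set without that vertex is no dearer. Otherwise it sits at most on vertices of the old root,
      which are available for colour \<open>i\<close> anyway.\<close>
    proof (cases "\<exists>k\<in>S d \<inter> W. c' k = i")
      case True
      then obtain k where k: "k \<in> S d \<inter> W" "c' k = i" by blast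
      obtain A where A: "A \<subseteq> O'" "\<And>v. v \<in> I \<inter> O' \<Longrightarrow> bag S v \<inter> A \<noteq> {}" "card A \<le> card (U (c' k))"
        using cheap[OF k(1)] by metis
      have "bag S v \<inter> (A \<union> root_colour c K i) \<noteq> {}" if "v \<in> I \<inter> O'" for v using A(2)[OF that] by blast
      then show ?thesis using A(1,3) k(2) by (intro exI[of _ A]) simp
    next
      case False
      have "root_colour c' (S d) i \<subseteq> root_colour c K i"
      proof
        fix k assume "k \<in> root_colour c' (S d) i"
        then have k: "k \<in> S d" "c' k = i" unfolding root_colour_def by auto
        then have "k \<in> K" using False Ssub[OF d(1)] by blast
        then show "k \<in> root_colour c K i" using k c'(3) unfolding root_colour_def by auto
      qed
      then have "\<forall>v\<in>I \<inter> O'. bag S v \<inter> (U i \<union> root_colour c K i) \<noteq> {}"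
        using U[OF i] unfolding transv_def by blast
      then show ?thesis using U[OF i] by blast
    qed
    note ex = this
    define A where "A i = (SOME A. A \<subseteq> O' \<and> (\<forall>v\<in>I \<inter> O'. bag S v \<inter> (A \<union> root_colour c K i) \<noteq> {}) \<and>
        card A \<le> card (U i))" for i
    have A: "A i \<subseteq> O' \<and> (\<forall>v\<in>I \<inter> O'. bag S v \<inter> (A i \<union> root_colour c K i) \<noteq> {}) \<and>
        card (A i) \<le> card (U i)" if "i < 3" for i
      unfolding A_def by (rule someI_ex) (rule ex[OF that])
    have "(\<Sum>i<3. card (A i)) \<le> (\<Sum>i<3. card (U i))" by (intro sum_mono) (use A in auto)
    then have "7 * (\<Sum>i<3. card (A i)) \<le> 6 * card O'" using Ucard by simp
    then show ?thesis using A by (intro disjI2 exI[of _ A]) simp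
  qed
qed

end

text \<open>\<open>IH\<close> ranges over other roots and colourings too, since a region cut out of
  the system has a root of its own.\<close>

locale rooted_critical = peo_sys +
  fixes c :: "nat \<Rightarrow> nat"
  assumes inj: "inj_on c K" and rng: "c ` K \<subseteq> {..<3}"
    and notgood: "\<not> good K c W S I"
    and IH: "peo_sys K' W' S' I' \<Longrightarrow> inj_on c' K' \<Longrightarrow> c' ` K' \<subseteq> {..<3} \<Longrightarrow>
      smaller W' S' I' W S I \<Longrightarrow> good K' c' W' S' I'"
begin

abbreviation "lf x \<equiv> leaf W S x"

text \<open>Bags that touch \<open>X\<close> are met by \<open>A i\<close> or by the root, and all
  other required bags survive unchanged. This is the workhorse for excluding local
  configurations.\<close>

lemma no_del:
  assumes X: "X \<subseteq> W" "X \<noteq> {}" and A: "\<And>i. i < 3 \<Longrightarrow> A i \<subseteq> W"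
    and hit: "\<And>v i. v \<in> I \<Longrightarrow> bag S v \<inter> X \<noteq> {} \<Longrightarrow> i < 3 \<Longrightarrow> bag S v \<inter> (A i \<union> root_colour c K i) \<noteq> {}"
    and size: "7 * (\<Sum>i<3. card (A i)) \<le> 6 * card X"
  shows False
proof -
  define S' where "S' v = S v - X" for v
  define I' where "I' = {v \<in> I. bag S v \<inter> X = {}}"
  have finX: "finite X" using X finW by (auto intro: finite_subset)
  have eq: "S' v = S v" if "v \<in> I'" for v using that unfolding S'_def I'_def bag_def by blast
  have cW: "card (W - X) + card X = card W"
    using X finW finX by (simp add: card_Diff_subset card_mono)
  have "peo_sys K (W - X) S' I'"
  proof
    show "finite K" "finite (W - X)" using finK finW by auto
    show "k < w" if "k \<in> K" "w \<in> W - X" for k w using that KW by blast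
    show "S' v \<subseteq> K \<union> (W - X)" if "v \<in> W - X" for v using that Ssub unfolding S'_def by blast
    show "u < v" if "v \<in> W - X" "u \<in> S' v" for u v using that Sless unfolding S'_def by blast
    show "a \<in> S' b" if "v \<in> W - X" "a \<in> S' v" "b \<in> S' v" "b \<in> W - X" "a < b" for v a b
      using that peo unfolding S'_def by blast
    show "I' \<subseteq> W - X" using IW unfolding I'_def bag_def by blast
    show "3 \<le> card (S' v)" if "v \<in> I'" for v using that eq Icard unfolding I'_def by simp
  qed
  moreover have "card X > 0" using X(2) finX by (simp add: card_gt_0_iff)
  then have "smaller (W - X) S' I' W S I" using cW unfolding smaller_def by simp
  ultimately have g: "good K c (W - X) S' I'" using IH inj rng by blast
  have "good K c W S I"
  proof (rule good_extend[OF g finW, where e = "\<lambda>i. card (A i)"])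
    fix i U' assume i: "i < 3" and U': "U' \<subseteq> W - X" "transv S' I' (U' \<union> root_colour c K i)"
    have "transv S I ((U' \<union> A i) \<union> root_colour c K i)" unfolding transv_def
    proof
      fix v assume v: "v \<in> I"
      show "bag S v \<inter> ((U' \<union> A i) \<union> root_colour c K i) \<noteq> {}"
      proof (cases "bag S v \<inter> X = {}")
        case True
        then have "v \<in> I'" using v I'_def by blast
        then show ?thesis using U'(2) eq unfolding transv_def bag_def by fastforce
      next
        case False then show ?thesis using hit[OF v False i] by blast
      qed
    qed
    moreover have "card (U' \<union> A i) \<le> card U' + card (A i)" by (rule card_Un_le)
    moreover have "U' \<union> A i \<subseteq> W" using U'(1) A[OF i] by blast
    ultimately show "\<exists>U\<subseteq>W. transv S I (U \<union> root_colour c K i) \<and> card U \<le> card U' + card (A i)" by blast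
  next
    show "7 * (\<Sum>i<3. card (A i)) + 6 * card (W - X) \<le> 6 * card W" using size cW by simp
  qed
  then show False using notgood by blast
qed

lemma no_drop:
  assumes v: "v \<in> I"
    and ext: "\<And>i U. i < 3 \<Longrightarrow> U \<subseteq> W \<Longrightarrow> transv S (I - {v}) (U \<union> root_colour c K i) \<Longrightarrow>
       \<exists>U2\<subseteq>W. transv S I (U2 \<union> root_colour c K i) \<and> card U2 \<le> card U"
  shows False
proof -
  have finI: "finite I" using IW finW by (auto intro: finite_subset)
  have "peo_sys K W S (I - {v})"
  proof
    show "finite K" "finite W" using finK finW by auto
    show "k < w" if "k \<in> K" "w \<in> W" for k w using that KW by blast
    show "S v \<subseteq> K \<union> W" if "v \<in> W" for v using that Ssub by blast
    show "u < v" if "v \<in> W" "u \<in> S v" for u v using that Sless by blast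
    show "a \<in> S b" if "v \<in> W" "a \<in> S v" "b \<in> S v" "b \<in> W" "a < b" for v a b using that peo by blast
    show "I - {v} \<subseteq> W" using IW by blast
    show "3 \<le> card (S w)" if "w \<in> I - {v}" for w using that Icard by blast
  qed
  moreover have "smaller W S (I - {v}) W S I"
    using card_Diff1_less[OF finI v] unfolding smaller_def by simp
  ultimately have g: "good K c W S (I - {v})" using IH inj rng by blast
  have "good K c W S I"
    by (rule good_extend[OF g finW, where e = "\<lambda>i. 0"]) (use ext in auto)
  then show False using notgood by blast
qed

lemma no_modify:
  assumes sys: "peo_sys K W' S' I'" and W': "W' \<subseteq> W" "W' \<noteq> W"
    and ext: "\<And>i U'. i < 3 \<Longrightarrow> U' \<subseteq> W' \<Longrightarrow> transv S' I' (U' \<union> root_colour c K i) \<Longrightarrow>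
        \<exists>U\<subseteq>W. transv S I (U \<union> root_colour c K i) \<and> card U \<le> card U' + e i"
    and size: "7 * (\<Sum>i<3. e i) + 6 * card W' \<le> 6 * card W"
  shows False
proof -
  have "card W' < card W" using W' finW by (simp add: psubset_card_mono psubsetI)
  then have "good K c W' S' I'" using IH sys inj rng unfolding smaller_def by blast
  then have "good K c W S I" by (rule good_extend[OF _ finW]) (use ext size in auto)
  then show False using notgood by blast
qed

text \<open>Only a later common neighbour of \<open>v\<close> and \<open>y\<close> could make
  \<open>peo\<close> need their edge. Without one, \<open>y\<close> can be removed from
  \<open>S v\<close>, and a transversal for the shrunken bags is one for the old bags. The sole
  obstruction is a required bag falling below four vertices.\<close>

lemma unsupported:
  assumes v: "v \<in> W" "y \<in> S v" and uns: "\<And>j. j \<in> W \<Longrightarrow> v \<in> S j \<Longrightarrow> y \<notin> S j"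
  shows "v \<in> I \<and> card (S v) = 3"
proof (rule ccontr)
  assume neg: "\<not> ?thesis"
  define S' where "S' = S(v := S v - {y})"
  have sub: "S' w \<subseteq> S w" for w unfolding S'_def by auto
  have "peo_sys K W S' I"
  proof
    show "finite K" "finite W" using finK finW by auto
    show "k < w" if "k \<in> K" "w \<in> W" for k w using that KW by blast
    show "S' v \<subseteq> K \<union> W" if "v \<in> W" for v using that Ssub sub by blast
    show "u < v" if "v \<in> W" "u \<in> S' v" for u v using that Sless sub by blast
    show "a \<in> S' b" if j: "j \<in> W" "a \<in> S' j" "b \<in> S' j" "b \<in> W" "a < b" for j a b
    proof -
      have "a \<in> S b" using j sub peo by blast
      moreover have "\<not> (b = v \<and> a = y)" using j sub uns by blast
      ultimately show ?thesis unfolding S'_def by auto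
    qed
    show "I \<subseteq> W" by (rule IW)
    show "3 \<le> card (S' w)" if "w \<in> I" for w
    proof (cases "w = v")
      case True
      then have "card (S v) \<ge> 4" using Icard[OF that] neg that by auto
      then show ?thesis using True v finS[OF v(1)] by (simp add: S'_def)
    qed (use Icard[OF that] in \<open>simp add: S'_def\<close>)
  qed
  moreover have "(\<Sum>w\<in>W. card (S' w)) < (\<Sum>w\<in>W. card (S w))"
  proof (rule sum_strict_mono_ex1)
    show "finite W" by (rule finW)
    show "\<forall>x\<in>W. card (S' x) \<le> card (S x)" using sub finS by (meson card_mono)
    show "\<exists>a\<in>W. card (S' a) < card (S a)"
      by (rule bexI[of _ v]) (use v finS[OF v(1)] in \<open>simp_all add: S'_def card_Diff1_less del: card_Diff_insert\<close>)
  qed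
  then have "smaller W S' I W S I" unfolding smaller_def by simp
  ultimately have g: "good K c W S' I" using IH inj rng by blast
  have tr: "transv S I D" if "transv S' I D" for D
    using that sub unfolding transv_def bag_def by fastforce
  have "good K c W S I"
    by (rule good_extend[OF g finW, where e = "\<lambda>i. 0"]) (use tr in auto)
  then show False using notgood by blast
qed

lemma cardK: "card K \<le> 3"
  using card_inj_on_le[OF inj rng] by simp

lemma not_all_rooted: "v \<in> I \<Longrightarrow> \<exists>w\<in>S v. w \<in> W"
proof (rule ccontr)
  assume v: "v \<in> I" and "\<not> (\<exists>w\<in>S v. w \<in> W)"
  then have "S v \<subseteq> K" using Ssub IW by blast
  then have eq: "S v = K" using Icard[OF v] cardK finK by (simp add: card_seteq)
  then have "card (c ` K) = 3" using Icard[OF v] cardK inj by (simp add: card_image)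
  then have im: "c ` K = {..<3}" using rng by (simp add: card_subset_eq)
  have "bag S v \<inter> (U \<union> root_colour c K i) \<noteq> {}" if "i < 3" for U i
  proof -
    have "i \<in> c ` K" using that im by simp
    then show ?thesis using eq by (auto simp: bag_def root_colour_def)
  qed
  note h = this
  show False
  proof (rule no_drop[OF v])
    fix i U assume a: "i < 3" "U \<subseteq> W" "transv S (I - {v}) (U \<union> root_colour c K i)"
    have "transv S I (U \<union> root_colour c K i)" using a(3) h[OF a(1)] unfolding transv_def by blast
    then show "\<exists>U2\<subseteq>W. transv S I (U2 \<union> root_colour c K i) \<and> card U2 \<le> card U" using a(2) by blast
  qed
qed

lemma leaf_in_I: "lf x \<Longrightarrow> x \<in> I"
proof (rule ccontr)
  assume x: "lf x" "x \<notin> I"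
  show False
  proof (rule no_del[of "{x}" "\<lambda>i. {}"])
    show "bag S v \<inter> ({} \<union> root_colour c K i) \<noteq> {}" if "v \<in> I" "bag S v \<inter> {x} \<noteq> {}" for v i
      using leaf_bag[OF x(1), of v] that x(2) IW by auto
  qed (use x in \<open>auto simp: leaf_def\<close>)
qed

lemma leaf_card: "lf x \<Longrightarrow> card (S x) = 3"
proof -
  assume x: "lf x"
  then have "card (S x) \<ge> 3" using leaf_in_I Icard by blast
  then obtain y where "y \<in> S x" by fastforce
  then show ?thesis using unsupported[of x y] x unfolding leaf_def by blast
qed

lemma leaf_nbr_nonleaf: "lf x \<Longrightarrow> w \<in> S x \<Longrightarrow> \<not> lf w"
  unfolding leaf_def by blast

lemma tri_exists: "lf x \<Longrightarrow> \<exists>h m l. tri W S x h m l"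
proof -
  assume x: "lf x"
  then obtain a b d where abd: "S x = {a, b, d}" "a \<noteq> b" "b \<noteq> d" "a \<noteq> d"
    using leaf_card card_3_iff by metis
  consider "a < b \<and> b < d" | "a < d \<and> d < b" | "b < a \<and> a < d" | "b < d \<and> d < a" | "d < a \<and> a < b" | "d < b \<and> b < a"
    using abd by linarith
  then show ?thesis unfolding tri_def using x abd(1) by cases blast+
qed

lemma triD:
  assumes "tri W S x h m l"
  shows "lf x" "S x = {h, m, l}" "h < m" "m < l" "l \<in> W" "h \<in> S m \<or> m \<notin> W" "h \<in> S l" "m \<in> S l" "x \<in> W"
    "l < x" "x \<in> I"
proof -
  show x: "lf x" "S x = {h, m, l}" "h < m" "m < l" using assms unfolding tri_def by auto
  then show xI: "x \<in> I" "x \<in> W" using leaf_in_I IW by blast+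
  obtain w where w: "w \<in> W" "w \<in> S x" using not_all_rooted[OF xI(1)] by blast
  then show l: "l \<in> W" using above_in_W[OF xI(2), of l w] x by auto
  show "h \<in> S m \<or> m \<notin> W" "h \<in> S l" "m \<in> S l" using peo[OF xI(2)] x l by auto
  show "l < x" using Sless[OF xI(2)] x by blast
qed

text \<open>The requirement at \<open>v\<close> would be redundant: a set meeting the leaf clique
  only in \<open>x\<close> can trade \<open>x\<close> for a non-root vertex of \<open>S x\<close>,
  which meets \<open>bag S v\<close> as well.\<close>

lemma no_leaf_in_bag:
  assumes v: "v \<in> I" "\<not> lf v" and x: "lf x" "S x \<subseteq> bag S v"
  shows False
proof -
  obtain s where s: "s \<in> S x" "s \<in> W" using not_all_rooted leaf_in_I x(1) by blast
  have xI: "x \<in> I" using leaf_in_I x(1) by blast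
  have xv: "x \<noteq> v" using v x by blast
  show False
  proof (rule no_drop[OF v(1)])
    fix i U assume U: "U \<subseteq> W" "transv S (I - {v}) (U \<union> root_colour c K i)"
    have hx: "bag S x \<inter> (U \<union> root_colour c K i) \<noteq> {}" using U(2) xI xv unfolding transv_def by blast
    show "\<exists>U2\<subseteq>W. transv S I (U2 \<union> root_colour c K i) \<and> card U2 \<le> card U"
    proof (cases "S x \<inter> (U \<union> root_colour c K i) = {}")
      case False
      then have "transv S I (U \<union> root_colour c K i)" using U(2) x(2) unfolding transv_def by blast
      then show ?thesis using U(1) by blast
    next
      case True
      have "x \<notin> root_colour c K i" using x(1) KW unfolding root_colour_def leaf_def by blast
      then have xU: "x \<in> U" using True hx unfolding bag_def by blast
      define U2 where "U2 = insert s (U - {x})"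
      have finU: "finite U" using U(1) finW by (auto intro: finite_subset)
      have "card U2 \<le> Suc (card (U - {x}))" unfolding U2_def using finU by (simp add: card_insert_if)
      also have "\<dots> = card U" by (rule card_Suc_Diff1[OF finU xU])
      finally have "card U2 \<le> card U" .
      moreover have "U2 \<subseteq> W" using U(1) s(2) unfolding U2_def by blast
      moreover have "transv S I (U2 \<union> root_colour c K i)" unfolding transv_def
      proof
        fix w assume w: "w \<in> I"
        consider "w = v" | "w = x" | "w \<noteq> v" "w \<noteq> x" by blast
        then show "bag S w \<inter> (U2 \<union> root_colour c K i) \<noteq> {}"
        proof cases
          case 1 then show ?thesis using s x(2) unfolding U2_def by blast
        next
          case 2 then show ?thesis using s unfolding U2_def bag_def by blast
        next
          case 3
          then have "x \<notin> bag S w" using leaf_bag[OF x(1)] w IW by blast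
          moreover have "bag S w \<inter> (U \<union> root_colour c K i) \<noteq> {}" using U(2) w 3 unfolding transv_def by blast
          ultimately show ?thesis unfolding U2_def by blast
        qed
      qed
      ultimately show ?thesis by blast
    qed
  qed
qed

text \<open>Buying \<open>v\<close> in all three colours is charged 7 * 3 = 21, while four deleted
  vertices are worth 6 * 4 = 24.\<close>

lemma dominated_card:
  assumes v: "v \<in> W" and X: "X \<subseteq> W" "v \<notin> X"
    and dom: "\<And>w i. w \<in> X \<Longrightarrow> i \<in> I \<Longrightarrow> w \<in> bag S i \<Longrightarrow> v \<in> bag S i"
  shows "card X \<le> 2"
proof (rule ccontr)
  assume "\<not> card X \<le> 2"
  moreover have "finite X" using X finW by (auto intro: finite_subset)
  ultimately have "card (insert v X) \<ge> 4" using X(2) by simp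
  then show False
    by (intro no_del[of "insert v X" "\<lambda>i. {v}"]) (use v X dom in \<open>auto simp: sum3\<close>)
qed

lemma leaves_dominated: "lf x \<Longrightarrow> v \<in> S x \<Longrightarrow> i \<in> I \<Longrightarrow> x \<in> bag S i \<Longrightarrow> v \<in> bag S i"
  using leaf_bag[of x i] IW unfolding bag_def by blast

lemma card_leaves_at: "v \<in> W \<Longrightarrow> card (leaves_at W S v) \<le> 2"
  by (rule dominated_card[of v]) (use leaves_dominated in \<open>auto simp: leaves_at_def leaf_def\<close>)

text \<open>Otherwise \<open>v\<close> is required with exactly three earlier neighbours, and the
  clique \<open>S d\<close> directly below it avoids \<open>y\<close>, so it has at most three
  vertices and can be a root. Then the requirement at \<open>v\<close> is redundant or the region
  below \<open>d\<close> can be deleted at its own expense.\<close>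

lemma supported:
  assumes v: "v \<in> W" "\<not> lf v" "y \<in> S v"
  shows "\<exists>j\<in>W. v \<in> S j \<and> y \<in> S j"
proof (rule ccontr)
  assume neg: "\<not> ?thesis"
  then have vI: "v \<in> I" and c3: "card (S v) = 3" using unsupported[OF v(1,3)] by blast+
  obtain d where d: "d \<in> W" "v \<in> S d" "\<forall>s\<in>S d. s \<le> v" using child_exists v by blast
  define O' where "O' = insert d (Des W S d)"
  have OW: "O' \<subseteq> W" using d Des_sub O'_def by blast
  have vd: "v < d" using Sless d by blast
  have vO: "v \<notin> O'" using vd Des_gt O'_def by (metis insertE less_asym less_irrefl)
  have Sd: "S d \<subseteq> bag S v - {y}" using child_bag[OF v(1) d] neg d by blast
  have "v \<notin> S v" using Sless v by blast
  then have "card (bag S v) = 4" using c3 finS[OF v(1)] by (simp add: bag_def)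
  then have "card (bag S v - {y}) = 3" using v(3) finS[OF v(1)] by (simp add: bag_def)
  then have c3': "card (S d) \<le> 3" using Sd finS[OF v(1)] by (metis card_mono finite_Diff finite_insert bag_def)
  have "card O' < card W" using OW vO v(1) finW by (metis psubset_card_mono psubsetI)
  then have R: "good (S d) c' O' S (I \<inter> O')" if "inj_on c' (S d)" "c' ` S d \<subseteq> {..<3}" for c'
    using IH[OF _ that, of O' S "I \<inter> O'"] region_sys[OF d(1)] unfolding smaller_def O'_def by blast
  have closed: "bag S w \<inter> O' = {}" if "w \<in> I - O'" for w
    using region_closed[of _ d w] that IW unfolding O'_def by blast
  from region_redundant_or_paid[OF vI d c3' inj rng O'_def R] show False
  proof
    assume "\<forall>i U. i < 3 \<longrightarrow> U \<subseteq> W \<longrightarrow> transv S (I - {v}) (U \<union> root_colour c K i) \<longrightarrow>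
             (\<exists>U2\<subseteq>W. transv S I (U2 \<union> root_colour c K i) \<and> card U2 \<le> card U)"
    then show False using no_drop[OF vI] by blast
  next
    assume "\<exists>A. (\<forall>i<3. A i \<subseteq> O' \<and> (\<forall>v\<in>I \<inter> O'. bag S v \<inter> (A i \<union> root_colour c K i) \<noteq> {})) \<and>
             7 * (\<Sum>i<3. card (A i)) \<le> 6 * card O'"
    then obtain A where A: "\<And>i. i < 3 \<Longrightarrow> A i \<subseteq> O' \<and> (\<forall>v\<in>I \<inter> O'. bag S v \<inter> (A i \<union> root_colour c K i) \<noteq> {})"
      "7 * (\<Sum>i<3. card (A i)) \<le> 6 * card O'" by metis
    show False
    proof (rule no_del[of O' A])
      show "bag S w \<inter> (A i \<union> root_colour c K i) \<noteq> {}" if "w \<in> I" "bag S w \<inter> O' \<noteq> {}" "i < 3" for w i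
        using that closed A(1) by blast
    qed (use A OW O'_def in auto)
  qed
qed

text \<open>Iterating \<open>supported\<close> carries \<open>y\<close> from clique to clique
  towards later vertices, and this can stop only at a leaf.\<close>

lemma supporting_leaf:
  "v \<in> W \<Longrightarrow> y \<in> S v \<Longrightarrow> \<exists>x. lf x \<and> y \<in> S x \<and> (x = v \<or> x \<in> Des W S v)"
proof (induction "Max W - v" arbitrary: v rule: less_induct)
  case less
  show ?case
  proof (cases "lf v")
    case False
    then obtain j where j: "j \<in> W" "v \<in> S j" "y \<in> S j" using supported less by blast
    have "v < j" "j \<le> Max W" using Sless j finW by auto
    then obtain x where "lf x" "y \<in> S x" "x = j \<or> x \<in> Des W S j" using less(1)[of j] j by fastforce
    then show ?thesis using j Des_base Des_trans by blast
  qed (use less in blast)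
qed

lemma leaf_below: "v \<in> W \<Longrightarrow> \<not> lf v \<Longrightarrow> y \<in> S v \<Longrightarrow> \<exists>x. lf x \<and> y \<in> S x \<and> x \<in> Des W S v"
  using supporting_leaf by blast

lemma nonleaf_has_leaf: "v \<in> W \<Longrightarrow> \<not> lf v \<Longrightarrow> \<exists>x. lf x \<and> v \<in> S x"
  using supporting_leaf unfolding leaf_def by metis

end


section \<open>Vertices that are last in one leaf but not in another\<close>

lemma sum_if_colour:
  assumes "j < (3::nat)"
  shows "(\<Sum>i<3. card (if j = i then P else Q)) = card P + 2 * card Q"
  using assms by (auto simp: sum3 numeral_3_eq_3 less_Suc_eq)

lemma sum_if_colours:
  assumes "j < (3::nat)" "k < 3" "j \<noteq> k"
  shows "(\<Sum>i<3. card (if j = i \<or> k = i then P else Q)) = 2 * card P + card Q"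
  using assms by (auto simp: sum3 numeral_3_eq_3 less_Suc_eq)

lemma set_card3: "a \<noteq> b \<Longrightarrow> a \<noteq> c \<Longrightarrow> b \<noteq> c \<Longrightarrow> card {a, b, c} = 3"
  by simp

lemma finite_card2_ex:
  assumes "finite A" "a \<in> A" "card A \<le> 2"
  shows "A = {a} \<or> (\<exists>b. b \<noteq> a \<and> A = {a, b})"
proof (cases "A = {a}")
  case False
  then obtain b where b: "b \<in> A" "b \<noteq> a" using assms by blast
  have "{a, b} = A" by (rule card_seteq) (use assms b in auto)
  then show ?thesis using b by blast
qed simp

context peo_sys begin

lemma Des_last: "x \<in> Des W S v \<Longrightarrow> \<exists>w\<in>S x. w = v \<or> w \<in> Des W S v"
  by (induction rule: Des_induct) auto

lemma Des_last_ge: "x \<in> Des W S v \<Longrightarrow> \<exists>w\<in>S x. v \<le> w"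
proof -
  assume "x \<in> Des W S v"
  then obtain w where w: "w \<in> S x" "w = v \<or> w \<in> Des W S v" using Des_last by blast
  then have "v \<le> w" using Des_gt[of w v] by auto
  then show ?thesis using w(1) by blast
qed

end

context rooted_critical begin

text \<open>In the colouring argument last vertices are bought only to repair leaves, whereas first
  and middle vertices are coloured. The counting needs these two roles to exclude each other, which
  is \<open>no_mixed\<close>.\<close>

definition Lrole :: "nat \<Rightarrow> bool" where "Lrole q \<longleftrightarrow> (\<exists>x h m. tri W S x h m q)"

definition nrole :: "nat \<Rightarrow> bool" where
  "nrole q \<longleftrightarrow> (\<exists>x h m l. tri W S x h m l \<and> (q = h \<or> q = m))"

lemma nroleI: "lf x \<Longrightarrow> w \<in> S x \<Longrightarrow> s \<in> S x \<Longrightarrow> w < s \<Longrightarrow> nrole w"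
proof -
  assume a: "lf x" "w \<in> S x" "s \<in> S x" "w < s"
  obtain h m l where t: "tri W S x h m l" using tri_exists a(1) by blast
  note T = triD[OF t]
  have "w \<noteq> l" using a(3,4) T(2,3,4) by auto
  then have "w = h \<or> w = m" using a(2) T(2) by blast
  then show ?thesis using t unfolding nrole_def by blast
qed

lemma LroleI: "lf x \<Longrightarrow> w \<in> S x \<Longrightarrow> (\<And>s. s \<in> S x \<Longrightarrow> s \<le> w) \<Longrightarrow> Lrole w"
proof -
  assume a: "lf x" "w \<in> S x" "\<And>s. s \<in> S x \<Longrightarrow> s \<le> w"
  obtain h m l where t: "tri W S x h m l" using tri_exists a(1) by blast
  note T = triD[OF t]
  have "l \<le> w" using a(3)[of l] T(2) by simp
  then have "w = l" using a(2) T(2,3,4) by auto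
  then show ?thesis using t unfolding Lrole_def by blast
qed

lemma Lrole_nonleaf:
  assumes "Lrole q" shows "\<not> lf q" "q \<in> W"
proof -
  obtain x h m where t: "tri W S x h m q" using assms unfolding Lrole_def by blast
  show "q \<in> W" by (rule triD(5)[OF t])
  show "\<not> lf q" by (rule leaf_nbr_nonleaf[OF triD(1)[OF t]]) (simp add: triD(2)[OF t])
qed

lemma Lrole_not_I: "Lrole q \<Longrightarrow> q \<notin> I"
proof
  assume q: "Lrole q" "q \<in> I"
  then obtain x h m where t: "tri W S x h m q" unfolding Lrole_def by blast
  have "S x \<subseteq> bag S q" using triD(2,7,8)[OF t] by (simp add: bag_def)
  then show False using no_leaf_in_bag[of q x] q Lrole_nonleaf triD(1)[OF t] by blast
qed

lemma finite_leaves_at: "finite (leaves_at W S v)"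
  by (rule finite_subset[OF _ finW]) (auto simp: leaves_at_def leaf_def)

lemma leaves_at_cases:
  assumes "v \<in> W" "lf x" "v \<in> S x"
  obtains "leaves_at W S v = {x}" | z where "z \<noteq> x" "lf z" "v \<in> S z" "leaves_at W S v = {x, z}"
proof -
  have "x \<in> leaves_at W S v" using assms by (simp add: leaves_at_def)
  from finite_card2_ex[OF finite_leaves_at this card_leaves_at[OF assms(1)]] show ?thesis
  proof
    assume "\<exists>b. b \<noteq> x \<and> leaves_at W S v = {x, b}"
    then obtain z where z: "z \<noteq> x" "leaves_at W S v = {x, z}" by blast
    then have "z \<in> leaves_at W S v" by blast
    then show ?thesis using that(2)[of z] z by (simp add: leaves_at_def)
  qed (rule that(1))
qed

lemma leaves_atD: "lf i \<Longrightarrow> v \<in> S i \<Longrightarrow> leaves_at W S v = A \<Longrightarrow> i \<in> A"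
  by (auto simp: leaves_at_def)

text \<open>Below a non-leaf \<open>v\<close> there would be a leaf containing \<open>r\<close>
  together with a vertex not before \<open>v\<close>, so \<open>r\<close> would not be last in that
  leaf.\<close>

lemma pure_in_leaf_only:
  assumes r: "\<not> nrole r" and v: "v \<in> W" "r \<in> S v" shows "lf v"
proof (rule ccontr)
  assume "\<not> lf v"
  then obtain x where x: "lf x" "r \<in> S x" "x \<in> Des W S v" using leaf_below v by blast
  then obtain w where "w \<in> S x" "v \<le> w" using Des_last_ge by blast
  then have "r < w" using Sless v by (meson less_le_trans)
  then show False using nroleI x \<open>w \<in> S x\<close> r by blast
qed

text \<open>In the third case \<open>path_mem\<close> puts every vertex of \<open>S x\<close> before
  \<open>i\<close> into \<open>bag S i\<close>. Knowing the leaves at \<open>w\<close> therefore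
  tells what else a bag with \<open>w\<close> contains.\<close>

lemma bag_cases:
  assumes "i \<in> I" "w \<in> bag S i" "w \<in> W" "\<not> lf w"
  obtains "lf i" "w \<in> S i" | "i = w" | x where "\<not> lf i" "w \<in> S i" "w < i" "lf x" "w \<in> S x" "x \<in> Des W S i"
proof -
  have i: "i \<in> W" using assms IW by blast
  show ?thesis
  proof (cases "i = w")
    case False
    then have w: "w \<in> S i" using assms(2) by (simp add: bag_def)
    then show ?thesis using leaf_below[OF i _ w] that Sless[OF i w] by blast
  qed (rule that(2))
qed

lemma path_mem: "i \<in> W \<Longrightarrow> x \<in> Des W S i \<Longrightarrow> s \<in> S x \<Longrightarrow> s < i \<Longrightarrow> s \<in> bag S i"
  using Des_path_less by (simp add: bag_def)

lemma no_del_const: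
  assumes "X \<subseteq> W" "A \<subseteq> X" "A \<noteq> {}"
    and "\<And>v. v \<in> I \<Longrightarrow> bag S v \<inter> X \<noteq> {} \<Longrightarrow> bag S v \<inter> A \<noteq> {}"
    and "21 * card A \<le> 6 * card X"
  shows False
  by (rule no_del[of X "\<lambda>i. A"]) (use assms in \<open>auto simp: sum3\<close>)

text \<open>The root vertex \<open>k\<close> is free for its own colour, so \<open>A\<close> is
  bought there and \<open>B\<close> for the other two colours.\<close>

lemma no_del_root:
  assumes "X \<subseteq> W" "X \<noteq> {}" "A \<subseteq> W" "B \<subseteq> W" "k \<in> K"
    and A: "\<And>v. v \<in> I \<Longrightarrow> bag S v \<inter> X \<noteq> {} \<Longrightarrow> bag S v \<inter> insert k A \<noteq> {}"
    and B: "\<And>v. v \<in> I \<Longrightarrow> bag S v \<inter> X \<noteq> {} \<Longrightarrow> bag S v \<inter> B \<noteq> {}"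
    and size: "7 * (card A + 2 * card B) \<le> 6 * card X"
  shows False
proof (rule no_del[of X "\<lambda>i. if c k = i then A else B"])
  fix v i assume v: "v \<in> I" "bag S v \<inter> X \<noteq> {}"
  have "c k = i \<Longrightarrow> k \<in> root_colour c K i" using assms(5) by (simp add: root_colour_def)
  then show "bag S v \<inter> ((if c k = i then A else B) \<union> root_colour c K i) \<noteq> {}"
    using A[OF v] B[OF v] by auto
next
  have "c k < 3" using rng assms(5) by blast
  then show "7 * (\<Sum>i<3. card (if c k = i then A else B)) \<le> 6 * card X"
    using size by (simp only: sum_if_colour)
qed (use assms in auto)

lemma no_del_root2:
  assumes "X \<subseteq> W" "X \<noteq> {}" "A \<subseteq> W" "B \<subseteq> W" "k \<in> K" "l \<in> K" "k \<noteq> l"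
    and A: "\<And>v. v \<in> I \<Longrightarrow> bag S v \<inter> X \<noteq> {} \<Longrightarrow> bag S v \<inter> A \<noteq> {} \<or> k \<in> bag S v \<and> l \<in> bag S v"
    and B: "\<And>v. v \<in> I \<Longrightarrow> bag S v \<inter> X \<noteq> {} \<Longrightarrow> bag S v \<inter> B \<noteq> {}"
    and size: "7 * (2 * card A + card B) \<le> 6 * card X"
  shows False
proof (rule no_del[of X "\<lambda>i. if c k = i \<or> c l = i then A else B"])
  fix v i assume v: "v \<in> I" "bag S v \<inter> X \<noteq> {}"
  have "c k = i \<Longrightarrow> k \<in> root_colour c K i" "c l = i \<Longrightarrow> l \<in> root_colour c K i" using assms(5,6) by (simp_all add: root_colour_def)
  then show "bag S v \<inter> ((if c k = i \<or> c l = i then A else B) \<union> root_colour c K i) \<noteq> {}"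
    using A[OF v] B[OF v] by auto
next
  have "c k < 3" "c l < 3" "c k \<noteq> c l" using rng inj assms(5-7) by (auto simp: inj_on_def)
  then show "7 * (\<Sum>i<3. card (if c k = i \<or> c l = i then A else B)) \<le> 6 * card X"
    using size by (simp add: sum_if_colours)
qed (use assms in auto)

end

text \<open>\<open>q\<close> is last in the leaf \<open>x\<close> but not in the leaf
  \<open>y\<close>, whose last vertex is \<open>r\<close>. By \<open>last\<close>, the extremal
  choice of \<open>q\<close>, the vertex \<open>r\<close> is last in all of its leaves.\<close>

locale mixed = rooted_critical +
  fixes q v b x y r e
  assumes qW: "q \<in> W" and x: "leaf W S x" "S x = {v, b, q}" "v < q" "b < q" "v \<noteq> b"
    and y: "leaf W S y" "S y = {r, q, e}" "q < r" "e < r" "e \<noteq> q"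
    and last: "w \<in> W \<Longrightarrow> q < w \<Longrightarrow> Lrole w \<Longrightarrow> \<not> nrole w"
begin

lemma r_notin_x: "r \<notin> S x" using x y by auto

lemma xy: "x \<noteq> y" using r_notin_x y(2) by auto

lemma nl: "\<not> lf q" "\<not> lf r" "\<not> lf v" "\<not> lf b" "\<not> lf e"
  using leaf_nbr_nonleaf[OF x(1)] leaf_nbr_nonleaf[OF y(1)] x(2) y(2) by auto

lemma WI: "x \<in> W" "y \<in> W" "x \<in> I" "y \<in> I"
  using leafD x y leaf_in_I by auto

lemma rW: "r \<in> W" using above_in_W[of y r q] WI y qW by auto

lemma rL: "Lrole r" by (rule LroleI[OF y(1)]) (use y in auto)

lemma r_pure: "\<not> nrole r" using last rW y(3) rL by blast

lemma at_q: "leaves_at W S q = {x, y}"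
proof -
  have "{x, y} \<subseteq> leaves_at W S q" using x y by (auto simp: leaves_at_def)
  moreover have "card (leaves_at W S q) \<le> card {x, y}" using card_leaves_at[OF qW] xy by simp
  ultimately show ?thesis using card_seteq[OF finite_leaves_at] by blast
qed

lemma qI: "q \<notin> I" "r \<notin> I"
proof -
  show "q \<notin> I" by (rule Lrole_not_I, rule LroleI[OF x(1)]) (use x in auto)
  show "r \<notin> I" by (rule Lrole_not_I[OF rL])
qed

lemma r_bag: "i \<in> I \<Longrightarrow> r \<in> bag S i \<Longrightarrow> lf i \<and> r \<in> S i"
  using pure_in_leaf_only[OF r_pure, of i] qI IW unfolding bag_def by blast

lemma x_bag: "i \<in> I \<Longrightarrow> x \<in> bag S i \<Longrightarrow> i = x" using leaf_bag x IW by blast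
lemma y_bag: "i \<in> I \<Longrightarrow> y \<in> bag S i \<Longrightarrow> i = y" using leaf_bag y IW by blast

text \<open>If \<open>y\<close> were the only leaf at \<open>r\<close>, every required bag meeting
  \<open>{x, y, r}\<close> would contain \<open>q\<close>, one vertex too many for
  \<open>dominated_card\<close>.\<close>

lemma second_leaf:
  obtains z where "z \<noteq> y" "lf z" "r \<in> S z" "leaves_at W S r = {y, z}"
proof (rule leaves_at_cases[OF rW y(1)])
  show "r \<in> S y" using y by simp
  assume at: "leaves_at W S r = {y}"
  have "card {x, y, r} \<le> 2"
  proof (rule dominated_card[OF qW])
    fix w i assume wi: "w \<in> {x, y, r}" "i \<in> I" "w \<in> bag S i"
    have "w = r \<Longrightarrow> i = y" using r_bag[of i] wi leaves_atD[OF _ _ at] by blast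
    then have "i = x \<or> i = y" using wi x_bag y_bag by blast
    then show "q \<in> bag S i" using x y by (auto simp: bag_def)
  qed (use WI rW nl x y in auto)
  moreover have "card {x, y, r} = 3" using xy nl x(1) y(1) by (intro set_card3) auto
  ultimately show ?thesis by simp
qed (use that in blast)

end

locale mixed2 = mixed +
  fixes z c1 d
  assumes z: "z \<noteq> y" "leaf W S z" "S z = {c1, d, r}" "c1 < d" "d < r" and at_r: "leaves_at W S r = {y, z}"
begin

lemma zx: "z \<noteq> x" using r_notin_x z(3) by auto

lemma qz: "q \<notin> S z"
  using leaves_atD[OF z(2) _ at_q] zx z(1) by blast

lemma WIz: "z \<in> W" "z \<in> I" using leafD z leaf_in_I by auto

lemma nlz: "\<not> lf c1" "\<not> lf d" using leaf_nbr_nonleaf[OF z(2)] z(3) by auto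

lemma r_bag': "i \<in> I \<Longrightarrow> r \<in> bag S i \<Longrightarrow> i = y \<or> i = z"
  using r_bag leaves_atD[OF _ _ at_r] by blast

lemma z_bag: "i \<in> I \<Longrightarrow> z \<in> bag S i \<Longrightarrow> i = z" using leaf_bag z IW by blast

text \<open>A vertex common to \<open>y\<close> and \<open>z\<close> besides \<open>r\<close> would
  take care of \<open>r\<close>, \<open>y\<close> and \<open>z\<close>. If it lies in the root, it
  is free for one colour and \<open>r\<close> is bought for the other two: 14 against 18.\<close>

lemma ez: "e \<notin> S z"
proof
  assume e: "e \<in> S z"
  have ryz: "card {r, y, z} = 3" using nl y z by (intro set_card3) auto
  have cov: "i = y \<or> i = z" if "i \<in> I" "bag S i \<inter> {r, y, z} \<noteq> {}" for i
    using that r_bag' y_bag z_bag by blast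
  show False
  proof (cases "e \<in> W")
    case True
    have "card {r, y, z} \<le> 2"
    proof (rule dominated_card[OF True])
      fix w i assume wi: "w \<in> {r, y, z}" "i \<in> I" "w \<in> bag S i"
      then have "i = y \<or> i = z" using cov by blast
      then show "e \<in> bag S i" using e y by (auto simp: bag_def)
    qed (use rW WI WIz nl y z in auto)
    then show ?thesis using ryz by simp
  next
    case False
    then have eK: "e \<in> K" using Ssub[OF WI(2)] y by blast
    show ?thesis
    proof (rule no_del_root[of "{r, y, z}" "{}" "{r}" e])
      fix i assume i: "i \<in> I" "bag S i \<inter> {r, y, z} \<noteq> {}"
      have "i = y \<or> i = z" using cov i by blast
      then show "bag S i \<inter> {e} \<noteq> {}" "bag S i \<inter> {r} \<noteq> {}" using e y z by (auto simp: bag_def)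
    qed (use rW WI WIz eK ryz in auto)
  qed
qed

lemma ne: "c1 \<noteq> q" "d \<noteq> q" "c1 \<noteq> e" "d \<noteq> e" "q \<noteq> r" "e \<noteq> r" "c1 \<noteq> r" "d \<noteq> r" "c1 \<noteq> d"
  using qz ez z y by auto

lemma neL: "lf l \<Longrightarrow> l \<noteq> q \<and> l \<noteq> r \<and> l \<noteq> e \<and> l \<noteq> c1 \<and> l \<noteq> d"
  using nl nlz by blast

text \<open>Each earlier neighbour of \<open>r\<close> is supported by a later vertex, which can
  only be one of the two leaves at \<open>r\<close>.\<close>

lemma Sr: "S r = {q, e, c1, d}"
proof
  show "S r \<subseteq> {q, e, c1, d}"
  proof
    fix s assume s: "s \<in> S r"
    then obtain j where j: "j \<in> W" "r \<in> S j" "s \<in> S j" using supported rW nl by blast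
    then have "lf j" using pure_in_leaf_only r_pure by blast
    then have "j = y \<or> j = z" using leaves_atD[OF _ j(2) at_r] by blast
    then show "s \<in> {q, e, c1, d}" using j y z Sless[OF rW s] by auto
  qed
  show "{q, e, c1, d} \<subseteq> S r"
    using peo[OF WI(2), of _ r] peo[OF WIz(1), of _ r] y z rW by auto
qed

lemma below_in_S: "s \<in> S r \<Longrightarrow> t \<in> S r \<Longrightarrow> t \<in> W \<Longrightarrow> s < t \<Longrightarrow> s \<in> S t"
  using peo rW by blast

lemma c1d: "d \<in> W \<Longrightarrow> c1 \<in> S d" using below_in_S Sr z(4) by auto

lemma inW: "e \<in> K \<union> W" "c1 \<in> K \<union> W" "d \<in> K \<union> W"
  using Ssub[OF rW] Sr by auto

lemma c1K: "d \<in> K \<Longrightarrow> c1 \<in> K" using inW z(4) KW by fastforce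

text \<open>A non-leaf bag that contains \<open>d\<close> properly has a leaf with \<open>d\<close>
  below it. This leaf is \<open>z\<close>, and its vertex \<open>c1 < d\<close> is handed back to
  the bag.\<close>

lemma d_bag_single:
  assumes "d \<in> W" "leaves_at W S d = {z}" "i \<in> I" "d \<in> bag S i" shows "c1 \<in> bag S i"
  using assms(3,4,1) nlz(2)
proof (cases rule: bag_cases)
  case 1 then show ?thesis using leaves_atD[OF _ _ assms(2)] z by (auto simp: bag_def)
next
  case 2 then show ?thesis using c1d assms(1) by (simp add: bag_def)
next
  case (3 x')
  then have "x' = z" using leaves_atD[OF _ _ assms(2)] by blast
  then show ?thesis using path_mem[of i z c1] 3 z assms(3) IW by auto
qed

lemma e_single:
  assumes qe: "q < e" and at: "leaves_at W S e = {y}"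
  shows False
proof -
  have eW: "e \<in> W" using above_in_W[OF rW, of e q] Sr qW qe by auto
  have qe': "q \<in> S e" using below_in_S[of q e] Sr qe eW by auto
  have dom: "q \<in> bag S i" if "i \<in> I" "e \<in> bag S i" for i
    using that eW nl(5)
  proof (cases rule: bag_cases)
    case 1 then show ?thesis using leaves_atD[OF _ _ at] y by (auto simp: bag_def)
  next
    case 2 then show ?thesis using qe' by (simp add: bag_def)
  next
    case (3 x')
    then have "x' = y" using leaves_atD[OF _ _ at] by blast
    then show ?thesis using path_mem[of i y q] 3 y that IW qe by auto
  qed
  have "card {x, y, e} \<le> 2"
  proof (rule dominated_card[OF qW])
    fix w i assume wi: "w \<in> {x, y, e}" "i \<in> I" "w \<in> bag S i"
    then have "i = x \<or> i = y \<or> e \<in> bag S i" using x_bag y_bag by blast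
    then show "q \<in> bag S i" using dom[OF wi(2)] x y by (auto simp: bag_def)
  qed (use WI eW nl x y in auto)
  moreover have "card {x, y, e} = 3" using xy nl x(1) y(1) by (intro set_card3) auto
  ultimately show False by simp
qed

text \<open>A second leaf at \<open>d\<close> gives seven vertices for two. Without it, every
  required bag with \<open>d\<close> also contains \<open>c1\<close>, which replaces
  \<open>d\<close>. If \<open>c1\<close> is in the root it is not deleted, but the price drops to 1
  + 2 * 2 = 5 for six vertices, 35 against 36.\<close>

lemma case_A: "q < d \<Longrightarrow> False"
proof -
  assume dq: "q < d"
  have dW: "d \<in> W" using above_in_W[OF rW, of d q] Sr qW dq by auto
  have "d \<in> S z" using z by simp
  from leaves_at_cases[OF dW z(2) this] show False
  proof cases
    case (2 z')
    have z'y: "z' \<noteq> y" using 2 y ne by auto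
    have z'x: "z' \<noteq> x" using 2 x dq by auto
    have z'W: "z' \<in> W" using 2 leafD by blast
    show False
    proof (rule no_del_const[of "{q, d, r, x, y, z, z'}" "{q, d}"])
      fix i assume i: "i \<in> I" "bag S i \<inter> {q, d, r, x, y, z, z'} \<noteq> {}"
      have "z' \<in> bag S i \<Longrightarrow> i = z'" using leaf_bag[OF 2(2)] i IW by blast
      then have "q \<in> bag S i \<or> d \<in> bag S i \<or> i = x \<or> i = y \<or> i = z \<or> i = z'"
        using i r_bag' x_bag y_bag z_bag by blast
      then show "bag S i \<inter> {q, d} \<noteq> {}" using x y z 2 by (auto simp: bag_def)
    next
      have "card {q, d, r, x, y, z, z'} = 7"
        using ne neL[OF x(1)] neL[OF y(1)] neL[OF z(2)] neL[OF 2(2)] xy z(1) zx 2(1) z'x z'y by auto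
      then show "21 * card {q, d} \<le> 6 * card {q, d, r, x, y, z, z'}" using ne by simp
    qed (use qW dW rW WI WIz z'W in auto)
  next
    case 1
    note dc = d_bag_single[OF dW 1]
    have cov: "q \<in> bag S i \<or> c1 \<in> bag S i \<and> (d \<in> bag S i \<or> i = z)"
      if i: "i \<in> I" "bag S i \<inter> {q, r, d, x, y, z} \<noteq> {}" for i
    proof -
      have "q \<in> bag S i \<or> d \<in> bag S i \<or> i = x \<or> i = y \<or> i = z"
        using i r_bag' x_bag y_bag z_bag by blast
      moreover have "q \<in> bag S x" "q \<in> bag S y" "c1 \<in> bag S z" using x y z by (simp_all add: bag_def)
      ultimately show ?thesis using dc[OF i(1)] by blast
    qed
    have dz: "d \<in> bag S z" using z by (simp add: bag_def)
    show False
    proof (cases "c1 \<in> W")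
      case True
      show False
      proof (rule no_del_const[of "{q, c1, r, d, x, y, z}" "{q, c1}"])
        fix i assume i: "i \<in> I" "bag S i \<inter> {q, c1, r, d, x, y, z} \<noteq> {}"
        then have "c1 \<in> bag S i \<or> bag S i \<inter> {q, r, d, x, y, z} \<noteq> {}" by blast
        then show "bag S i \<inter> {q, c1} \<noteq> {}" using cov[OF i(1)] by blast
      next
        have "card {q, c1, r, d, x, y, z} = 7"
          using ne neL[OF x(1)] neL[OF y(1)] neL[OF z(2)] xy z(1) zx by auto
        then show "21 * card {q, c1} \<le> 6 * card {q, c1, r, d, x, y, z}" using ne by simp
      qed (use qW dW rW WI WIz True in auto)
    next
      case False
      then have cK: "c1 \<in> K" using inW by blast
      show False
      proof (rule no_del_root[of "{q, r, d, x, y, z}" "{q}" "{q, d}" c1])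
        fix i assume i: "i \<in> I" "bag S i \<inter> {q, r, d, x, y, z} \<noteq> {}"
        show "bag S i \<inter> {c1, q} \<noteq> {}" "bag S i \<inter> {q, d} \<noteq> {}"
          using cov[OF i] dz by blast+
      next
        have "card {q, r, d, x, y, z} = 6"
          using ne neL[OF x(1)] neL[OF y(1)] neL[OF z(2)] xy z(1) zx by auto
        then show "7 * (card {q} + 2 * card {q, d}) \<le> 6 * card {q, r, d, x, y, z}" using ne by simp
      qed (use qW dW rW WI WIz cK in auto)
    qed
  qed
qed

lemma in_bags: "q \<in> bag S x" "v \<in> bag S x" "b \<in> bag S x" "q \<in> bag S y" "r \<in> bag S y" "e \<in> bag S y"
    "c1 \<in> bag S z" "d \<in> bag S z" "r \<in> bag S z"
  using x y z by (simp_all add: bag_def)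

lemma distinctL: "x \<noteq> y" "y \<noteq> z" "x \<noteq> z" "x \<noteq> r" "y \<noteq> r" "z \<noteq> r" "x \<noteq> q" "y \<noteq> q" "z \<noteq> q"
    "x \<noteq> c1" "y \<noteq> c1" "z \<noteq> c1" "x \<noteq> d" "y \<noteq> d" "z \<noteq> d" "x \<noteq> e" "y \<noteq> e" "z \<noteq> e"
  using xy z(1) zx neL[OF x(1)] neL[OF y(1)] neL[OF z(2)] by auto

text \<open>The root vertices \<open>c1\<close> and \<open>d\<close> meet the clique of
  \<open>z\<close> for free in two colours, so \<open>r\<close> is bought only in the third: 7 * 4 =
  28 against 6 * 5 = 30.\<close>

lemma rooted_pair:
  assumes dq: "d < q" and dK: "d \<in> K"
  shows "e < q \<Longrightarrow> False" "q < e \<Longrightarrow> False"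
proof -
  have cK: "c1 \<in> K" using c1K dK by blast
  show False if "e < q"
  proof (rule no_del_root2[of "{q, r, x, y, z}" "{q}" "{q, r}" c1 d])
    fix i assume i: "i \<in> I" "bag S i \<inter> {q, r, x, y, z} \<noteq> {}"
    then have "q \<in> bag S i \<or> i = x \<or> i = y \<or> i = z" using r_bag' x_bag y_bag z_bag by blast
    then show "bag S i \<inter> {q} \<noteq> {} \<or> c1 \<in> bag S i \<and> d \<in> bag S i" "bag S i \<inter> {q, r} \<noteq> {}"
      using in_bags by blast+
  next
    have "card {q, r, x, y, z} = 5" using distinctL ne by auto
    then show "7 * (2 * card {q} + card {q, r}) \<le> 6 * card {q, r, x, y, z}" using ne by simp
  qed (use qW rW WI WIz cK dK ne in auto)
  assume qe: "q < e"
  have eW: "e \<in> W" using above_in_W[OF rW, of e q] Sr qW qe by auto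
  have "e \<in> S y" using y by simp
  from leaves_at_cases[OF eW y(1) this] show False
  proof cases
    case 1
    show False using e_single[OF qe 1] .
  next
    case (2 y')
    have y'W: "y' \<in> W" using 2 leafD by blast
    have nq: "y' \<noteq> z" "y' \<noteq> r" "y' \<noteq> e" using ez 2 neL[OF 2(2)] by auto
    show False
    proof (rule no_del_root2[of "{e, y, y', z, r}" "{e}" "{e, r}" c1 d])
      fix i assume i: "i \<in> I" "bag S i \<inter> {e, y, y', z, r} \<noteq> {}"
      have "y' \<in> bag S i \<Longrightarrow> i = y'" using leaf_bag[OF 2(2)] i IW by blast
      then have "e \<in> bag S i \<or> i = y' \<or> i = y \<or> i = z" using i r_bag' y_bag z_bag by blast
      moreover have "e \<in> bag S y'" using 2 by (simp add: bag_def)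
      ultimately show "bag S i \<inter> {e} \<noteq> {} \<or> c1 \<in> bag S i \<and> d \<in> bag S i" "bag S i \<inter> {e, r} \<noteq> {}"
        using in_bags by blast+
    next
      have "card {e, y, y', z, r} = 5" using distinctL ne nq 2(1) by auto
      then show "7 * (2 * card {e} + card {e, r}) \<le> 6 * card {e, y, y', z, r}" using ne by simp
    qed (use eW y'W rW WI WIz cK dK ne in auto)
  qed
qed

text \<open>The pattern of \<open>case_A\<close>, with \<open>e\<close> and its second leaf
  \<open>y'\<close> in the places of \<open>q\<close> and \<open>x\<close>. The new difficulty is
  that \<open>y'\<close> may also be a leaf at \<open>d\<close>.\<close>

lemma case_B2:
  assumes dq: "d < q" and qe: "q < e" and dW: "d \<in> W"
  shows False
proof -
  have eW: "e \<in> W" using above_in_W[OF rW, of e q] Sr qW qe by auto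
  have "e \<in> S y" using y by simp
  from leaves_at_cases[OF eW y(1) this] show False
  proof cases
    case 1
    show False using e_single[OF qe 1] .
  next
    case (2 y')
    have y'W: "y' \<in> W" using 2 leafD by blast
    have nq: "y' \<noteq> z" "y' \<noteq> r" "y' \<noteq> e" "y' \<noteq> c1" "y' \<noteq> d" using ez 2 neL[OF 2(2)] by auto
    have ey': "e \<in> bag S y'" using 2 by (simp add: bag_def)
    have y'b: "y' \<in> bag S i \<Longrightarrow> i \<in> I \<Longrightarrow> i = y'" for i using leaf_bag[OF 2(2)] IW by blast
    have c1e: "c1 \<in> S e" using below_in_S[of c1 e] Sr z(4) dq qe eW by auto
    show False
    proof (cases "leaves_at W S d \<subseteq> {z, y'}")
      case False
      then obtain z' where z': "lf z'" "d \<in> S z'" "z' \<noteq> z" "z' \<noteq> y'" by (auto simp: leaves_at_def)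
      have z'W: "z' \<in> W" using z' leafD by blast
      have z'y: "z' \<noteq> y" using z' y ne by auto
      show False
      proof (rule no_del_const[of "{e, d, r, y, y', z, z'}" "{e, d}"])
        fix i assume i: "i \<in> I" "bag S i \<inter> {e, d, r, y, y', z, z'} \<noteq> {}"
        have "z' \<in> bag S i \<Longrightarrow> i = z'" using leaf_bag[OF z'(1)] i IW by blast
        then have "e \<in> bag S i \<or> d \<in> bag S i \<or> i = y \<or> i = y' \<or> i = z \<or> i = z'"
          using i r_bag' y'b y_bag z_bag by blast
        moreover have "d \<in> bag S z'" using z' by (simp add: bag_def)
        ultimately show "bag S i \<inter> {e, d} \<noteq> {}" using in_bags ey' by blast
      next
        have "card {e, d, r, y, y', z, z'} = 7"
          using ne distinctL nq 2(1) z' z'y neL[OF z'(1)] by auto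
        then show "21 * card {e, d} \<le> 6 * card {e, d, r, y, y', z, z'}" using ne by simp
      qed (use eW dW rW WI WIz z'W y'W in auto)
    next
      case True
      have dc: "e \<in> bag S i \<or> c1 \<in> bag S i" if i: "i \<in> I" "d \<in> bag S i" for i
        using i dW nlz(2)
      proof (cases rule: bag_cases)
        case 1
        then have "i = z \<or> i = y'" using True by (auto simp: leaves_at_def)
        then show ?thesis using in_bags ey' by blast
      next
        case 2 then show ?thesis using c1d dW by (simp add: bag_def)
      next
        case (3 x')
        have iW: "i \<in> W" using i IW by blast
        have "x' = z \<or> x' = y'" using 3 True by (auto simp: leaves_at_def)
        then show ?thesis
        proof
          assume "x' = z"
          then show ?thesis using path_mem[OF iW, of z c1] 3 z by auto
        next
          assume x': "x' = y'"
          \<comment> \<open>With \<open>y'\<close> as the leaf below \<open>i\<close>, the bag of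
            \<open>i\<close> contains \<open>e\<close> unless \<open>i < e\<close>. In that case
            \<open>e\<close> is a descendant of \<open>i\<close>, and its earlier neighbour
            \<open>c1\<close> is handed back to \<open>i\<close>.\<close>
          consider "e = i" | "e < i" | "i < e" by linarith
          then show ?thesis
          proof cases
            case be: 2 then show ?thesis using path_mem[OF iW, of y' e] 3 x' 2 by blast
          next
            case be: 3
            then have "e \<in> Des W S i" using Des_path_gt[OF iW, of y' e] 3 x' 2 by blast
            then have "c1 \<in> bag S i" using path_mem[OF iW, of e c1] c1e 3(3) z(4) by auto
            then show ?thesis by blast
          qed (simp add: bag_def)
        qed
      qed
      have cov: "e \<in> bag S i \<or> c1 \<in> bag S i \<and> (d \<in> bag S i \<or> i = z)"
        if i: "i \<in> I" "bag S i \<inter> {e, y, y', z, r, d} \<noteq> {}" for i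
      proof -
        have "e \<in> bag S i \<or> d \<in> bag S i \<or> i = y \<or> i = y' \<or> i = z"
          using i r_bag' y_bag y'b z_bag by blast
        then show ?thesis using dc[OF i(1)] in_bags ey' by blast
      qed
      show False
      proof (cases "c1 \<in> W")
        case True
        show False
        proof (rule no_del_const[of "{e, c1, y, y', z, r, d}" "{e, c1}"])
          fix i assume i: "i \<in> I" "bag S i \<inter> {e, c1, y, y', z, r, d} \<noteq> {}"
          then have "c1 \<in> bag S i \<or> bag S i \<inter> {e, y, y', z, r, d} \<noteq> {}" by blast
          then show "bag S i \<inter> {e, c1} \<noteq> {}" using cov[OF i(1)] by blast
        next
          have "card {e, c1, y, y', z, r, d} = 7" using ne distinctL nq 2(1) by auto
          then show "21 * card {e, c1} \<le> 6 * card {e, c1, y, y', z, r, d}" using ne by simp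
        qed (use eW dW rW WI WIz y'W True in auto)
      next
        case False
        then have cK: "c1 \<in> K" using inW by blast
        show False
        proof (rule no_del_root[of "{e, y, y', z, r, d}" "{e}" "{e, d}" c1])
          fix i assume i: "i \<in> I" "bag S i \<inter> {e, y, y', z, r, d} \<noteq> {}"
          show "bag S i \<inter> {c1, e} \<noteq> {}" "bag S i \<inter> {e, d} \<noteq> {}"
            using cov[OF i] in_bags by blast+
        next
          have "card {e, y, y', z, r, d} = 6" using ne distinctL nq 2(1) by auto
          then show "7 * (card {e} + 2 * card {e, d}) \<le> 6 * card {e, y, y', z, r, d}" using ne by simp
        qed (use eW dW rW WI WIz y'W cK in auto)
      qed
    qed
  qed
qed

text \<open>If \<open>S x\<close> contains both \<open>c1\<close> and \<open>d\<close>, every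
  required bag meeting \<open>{x, z, d}\<close> contains \<open>c1\<close>. Otherwise some
  \<open>w\<close> of the two lies outside \<open>S x\<close>; then \<open>x\<close>,
  \<open>y\<close>, \<open>z\<close>, \<open>r\<close> are deleted and \<open>q\<close> becomes a
  required leaf on \<open>{v, b, w}\<close>. A set hitting \<open>q\<close>, \<open>v\<close> or
  \<open>b\<close> meets the clique of \<open>x\<close> and needs only \<open>r\<close> for the
  other two; a set hitting \<open>w\<close> meets that of \<open>z\<close> and needs only
  \<open>q\<close>.\<close>

lemma case_B1:
  assumes dq: "d < q" and eq: "e < q" and dW: "d \<in> W"
  shows False
proof (cases "{c1, d} \<subseteq> {v, b}")
  case True
  then have cvb: "c1 \<in> S x" "d \<in> S x" using x by auto
  have "d \<in> leaves_at W S d \<or> {x, z} \<subseteq> leaves_at W S d" using cvb x z by (auto simp: leaves_at_def)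
  then have sub: "{x, z} \<subseteq> leaves_at W S d" using nlz by (auto simp: leaves_at_def)
  have "card (leaves_at W S d) \<le> card {x, z}" using card_leaves_at[OF dW] zx by simp
  then have at: "leaves_at W S d = {x, z}" using card_seteq[OF finite_leaves_at sub] by blast
  have dc: "c1 \<in> bag S i" if i: "i \<in> I" "d \<in> bag S i" for i
    using i dW nlz(2)
  proof (cases rule: bag_cases)
    case 1
    then have "i = z \<or> i = x" using leaves_atD[OF _ _ at] by blast
    then show ?thesis using cvb in_bags by (auto simp: bag_def)
  next
    case 2 then show ?thesis using c1d dW by (simp add: bag_def)
  next
    case (3 x')
    have iW: "i \<in> W" using i IW by blast
    have "x' = z \<or> x' = x" using 3 leaves_atD[OF _ _ at] by blast
    then have "c1 \<in> S x'" using cvb z by auto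
    then show ?thesis using path_mem[OF iW, of x' c1] 3 z(4) by auto
  qed
  have cov: "c1 \<in> bag S i \<and> d \<in> bag S i" if i: "i \<in> I" "bag S i \<inter> {x, z, d} \<noteq> {}" for i
  proof -
    have "c1 \<in> bag S x" "d \<in> bag S x" using cvb by (simp_all add: bag_def)
    moreover have "d \<in> bag S i \<or> i = x \<or> i = z" using i x_bag z_bag by blast
    ultimately show ?thesis using dc[OF i(1)] in_bags by blast
  qed
  have c3: "card {x, z, d} = 3" using distinctL by auto
  show False
  proof (cases "c1 \<in> W")
    case True
    have "card {x, z, d} \<le> 2"
    proof (rule dominated_card[OF True])
      show "{x, z, d} \<subseteq> W" using WI WIz dW by blast
      show "c1 \<notin> {x, z, d}" using ne distinctL by blast
      show "c1 \<in> bag S i" if "w \<in> {x, z, d}" "i \<in> I" "w \<in> bag S i" for w i using cov[of i] that by blast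
    qed
    then show False using c3 by simp
  next
    case False
    then have cK: "c1 \<in> K" using inW by blast
    show False
    proof (rule no_del_root[of "{x, z, d}" "{}" "{d}" c1])
      fix i assume i: "i \<in> I" "bag S i \<inter> {x, z, d} \<noteq> {}"
      show "bag S i \<inter> {c1} \<noteq> {}" "bag S i \<inter> {d} \<noteq> {}" using cov[OF i] by blast+
    qed (use WI WIz dW cK c3 in auto)
  qed
next
  case False
  then obtain w where w: "w \<in> {c1, d}" "w \<notin> {v, b}" by blast
  have c1q: "c1 \<in> S q" "d \<in> S q" using below_in_S[of _ q] Sr dq z(4) qW by auto
  have vq: "v \<in> S q" "b \<in> S q" using peo[OF WI(1), of _ q] x qW by auto
  have wq: "w \<in> S q" using w c1q by auto
  define W' where "W' = W - {r, x, y, z}"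
  define S' where "S' = S(q := {v, b, w})"
  define I' where "I' = insert q (I - {x, y, z})"
  have qW': "q \<in> W'" using qW ne distinctL by (auto simp: W'_def)
  \<comment> \<open>This makes \<open>q\<close> a leaf after the deletion: \<open>r\<close> is its
    only later neighbour that is not a leaf, and the leaves at \<open>q\<close> are deleted
    too.\<close>
  have dead: "u = r" if u: "u \<in> W" "\<not> lf u" "q \<in> S u" for u
  proof -
    obtain t where t: "lf t" "q \<in> S t" "t \<in> Des W S u" using leaf_below u by blast
    obtain s where s: "s \<in> S t" "s = u \<or> s \<in> Des W S u" using Des_last t by blast
    have qu: "q < u" using Sless u by blast
    then have qs: "q < s" using s Des_gt[of s u] by auto
    have "t = x \<or> t = y" using leaves_atD[OF _ _ at_q] t by blast
    then have sr: "s = r" using qs s x y eq by auto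
    show ?thesis
    proof (rule ccontr)
      assume "u \<noteq> r"
      then have "r \<in> Des W S u" using s sr by blast
      then obtain s' where "s' \<in> S r" "u \<le> s'" using Des_last_ge by blast
      then show False using Sr qu eq dq z(4) by auto
    qed
  qed
  have qS: "q \<notin> S j" if "j \<in> W'" for j
  proof
    assume j: "q \<in> S j"
    have "j \<in> W" "j \<noteq> r" "j \<noteq> x" "j \<noteq> y" using that by (auto simp: W'_def)
    then show False using dead[of j] j leaves_atD[OF _ _ at_q, of j] by blast
  qed
  have S'sub: "S' j \<subseteq> S j" for j using vq wq by (auto simp: S'_def)
  have rS: "s \<in> W \<Longrightarrow> s \<noteq> r \<Longrightarrow> r \<notin> S s \<or> s = y \<or> s = z" for s
    using pure_in_leaf_only[OF r_pure, of s] leaves_atD[OF _ _ at_r, of s] by blast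
  have sys: "peo_sys K W' S' I'"
  proof
    show "finite K" "finite W'" using finK finW by (auto simp: W'_def)
    show "k < j" if "k \<in> K" "j \<in> W'" for k j using that KW by (auto simp: W'_def)
    show "S' j \<subseteq> K \<union> W'" if j: "j \<in> W'" for j
    proof
      fix s assume "s \<in> S' j"
      then have s: "s \<in> S j" using S'sub by blast
      have jW: "j \<in> W" "j \<noteq> r" "j \<noteq> y" "j \<noteq> z" using j by (auto simp: W'_def)
      have "s \<noteq> r" using rS[OF jW(1,2)] jW s by blast
      moreover have "s \<noteq> x" "s \<noteq> y" "s \<noteq> z" using leafD(2) x(1) y(1) z(2) s jW(1) by blast+
      moreover have "s \<in> K \<union> W" using Ssub jW(1) s by blast
      ultimately show "s \<in> K \<union> W'" by (auto simp: W'_def)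
    qed
    show "u < j" if "j \<in> W'" "u \<in> S' j" for u j
      using that S'sub Sless[of j u] by (auto simp: W'_def)
    show "s \<in> S' t" if j: "j \<in> W'" "s \<in> S' j" "t \<in> S' j" "t \<in> W'" "s < t" for j s t
    proof -
      have jt: "s \<in> S j" "t \<in> S j" "j \<in> W" "t \<in> W" using j S'sub by (auto simp: W'_def)
      then have "s \<in> S t" using peo j(5) by blast
      moreover have "t \<noteq> q" using jt qS j(1) by blast
      ultimately show ?thesis by (simp add: S'_def)
    qed
    show "I' \<subseteq> W'" using IW qI qW' by (auto simp: I'_def W'_def)
    show "3 \<le> card (S' j)" if j: "j \<in> I'" for j
    proof (cases "j = q")
      case True
      have "card {v, b, w} = 3" using x(5) w by (intro set_card3) auto
      then show ?thesis using True by (simp add: S'_def)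
    next
      case False
      then have "j \<in> I" using j by (simp add: I'_def)
      then show ?thesis using Icard False by (simp add: S'_def)
    qed
  qed
  show False
  proof (rule no_modify[OF sys])
    show "W' \<subseteq> W" "W' \<noteq> W" using rW by (auto simp: W'_def)
    have c4: "card {r, x, y, z} = 4" using distinctL by auto
    have "{r, x, y, z} \<subseteq> W" using rW WI WIz by blast
    then have "card W' = card W - 4" "4 \<le> card W"
      using c4 finW card_mono[OF finW, of "{r, x, y, z}"] by (simp_all add: W'_def card_Diff_subset)
    then show "7 * (\<Sum>i<(3::nat). 1) + 6 * card W' \<le> 6 * card W" by (simp add: sum3)
  next
    fix i U' assume i: "i < (3::nat)" and U': "U' \<subseteq> W'" "transv S' I' (U' \<union> root_colour c K i)"
    let ?D = "U' \<union> root_colour c K i"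
    have finU: "finite U'" using U' finW by (auto simp: W'_def intro: finite_subset)
    have "bag S' q \<inter> ?D \<noteq> {}" using U'(2) unfolding transv_def I'_def by blast
    then have hq: "({q, v, b} \<inter> ?D \<noteq> {}) \<or> w \<in> ?D" by (auto simp: bag_def S'_def)
    have oth: "bag S j \<inter> ?D \<noteq> {}" if "j \<in> I" "j \<noteq> x" "j \<noteq> y" "j \<noteq> z" for j
    proof -
      have "j \<noteq> q" using that qI by blast
      moreover have "bag S' j \<inter> ?D \<noteq> {}" using U'(2) that unfolding transv_def I'_def by blast
      ultimately show ?thesis by (simp add: bag_def S'_def)
    qed
    have key: "transv S I (insert s U' \<union> root_colour c K i)" if "bag S x \<inter> insert s ?D \<noteq> {}" "bag S y \<inter> insert s ?D \<noteq> {}" "bag S z \<inter> insert s ?D \<noteq> {}" for s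
      unfolding transv_def
    proof
      fix j assume j: "j \<in> I"
      have "bag S j \<inter> insert s ?D \<noteq> {}" using that oth[OF j] by blast
      then show "bag S j \<inter> (insert s U' \<union> root_colour c K i) \<noteq> {}" by blast
    qed
    have cI: "card (insert s U') \<le> card U' + 1" for s using finU by (simp add: card_insert_if)
    have sW: "insert s U' \<subseteq> W" if "s \<in> W" for s using that U'(1) by (auto simp: W'_def)
    from hq show "\<exists>U\<subseteq>W. transv S I (U \<union> root_colour c K i) \<and> card U \<le> card U' + 1"
    proof
      assume "{q, v, b} \<inter> ?D \<noteq> {}"
      then have "transv S I (insert r U' \<union> root_colour c K i)" using in_bags by (intro key) blast+
      then show ?thesis using cI[of r] sW[OF rW] by blast
    next
      assume "w \<in> ?D"
      then have "transv S I (insert q U' \<union> root_colour c K i)" using in_bags w(1) by (intro key) blast+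
      then show ?thesis using cI[of q] sW[OF qW] by blast
    qed
  qed
qed

lemma mixed2_False: False
proof -
  have de: "d < q \<or> q < d" "e < q \<or> q < e" using ne(2) y(5) by auto
  show False
  proof (cases "q < d")
    case True then show ?thesis by (rule case_A)
  next
    case False
    then have dq: "d < q" using de(1) by blast
    show ?thesis
    proof (cases "d \<in> W")
      case True then show ?thesis using case_B1[OF dq _ True] case_B2[OF dq _ True] de(2) by metis
    next
      case False
      then have "d \<in> K" using inW by blast
      then show ?thesis using rooted_pair[OF dq] de(2) by metis
    qed
  qed
qed

end

lemma (in mixed) mixed_False: False
proof -
  obtain z where z: "z \<noteq> y" "lf z" "r \<in> S z" "leaves_at W S r = {y, z}" using second_leaf by blast
  obtain h m l where t: "tri W S z h m l" using tri_exists z by blast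
  note T = triD[OF t]
  have "r = l"
  proof (rule ccontr)
    assume "r \<noteq> l"
    then have "r = h \<or> r = m" using z(3) T(2) by blast
    then show False using t r_pure unfolding nrole_def by blast
  qed
  then interpret mixed2 K W S I c q v b x y r e z h m
    using z T by unfold_locales auto
  show False by (rule mixed2_False)
qed

text \<open>Induction from the largest vertex downwards supplies the hypothesis \<open>last\<close>
  of \<open>mixed\<close>.\<close>

lemma (in rooted_critical) no_mixed: "Lrole w \<Longrightarrow> \<not> nrole w"
proof (induction "Max W - w" arbitrary: w rule: less_induct)
  case less
  show ?case
  proof
    assume n: "nrole w"
    obtain x v b where tx: "tri W S x v b w" using less(2) unfolding Lrole_def by blast
    obtain y h m l where ty: "tri W S y h m l" "w = h \<or> w = m" using n unfolding nrole_def by blast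
    define e where "e = (if w = h then m else h)"
    note T = triD[OF tx] and T' = triD[OF ty(1)]
    have e: "S y = {l, w, e}" "e < l" "e \<noteq> w" "w < l" using T' ty(2) by (auto simp: e_def)
    have wl: "w \<in> W" by (rule T(5))
    have last: "\<not> nrole u" if "u \<in> W" "w < u" "Lrole u" for u
    proof (rule less(1)[OF _ that(3)])
      show "Max W - u < Max W - w" using that finW Max_ge[OF finW, of u] by linarith
    qed
    interpret mixed K W S I c w v b x y l e
      using T T' e wl last by unfold_locales auto
    show False by (rule mixed_False)
  qed
qed


section \<open>Colouring a minimal rooted counterexample\<close>

context rooted_critical begin

definition NL :: "nat set" where "NL = {q \<in> W. \<not> lf q \<and> \<not> Lrole q}"

lemma finite_NL: "finite NL" unfolding NL_def using finW by simp

lemma nrole_NL: "nrole w \<Longrightarrow> w \<in> K \<union> NL"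
proof -
  assume n: "nrole w"
  then obtain x h m l where t: "tri W S x h m l" "w = h \<or> w = m" unfolding nrole_def by blast
  note T = triD[OF t(1)]
  have wx: "w \<in> S x" using t T(2) by blast
  have "\<not> lf w" by (rule leaf_nbr_nonleaf[OF T(1) wx])
  moreover have "\<not> Lrole w" using no_mixed n by blast
  moreover have "w \<in> K \<union> W" using Ssub[OF T(9)] wx by blast
  ultimately show ?thesis by (simp add: NL_def)
qed

text \<open>Some leaf below \<open>v\<close> contains \<open>y\<close> and a vertex not before
  \<open>v\<close>, so \<open>y\<close> is not last there. Hence all earlier neighbours of a
  non-leaf are coloured vertices.\<close>

lemma S_nonleaf_NL: "v \<in> W \<Longrightarrow> \<not> lf v \<Longrightarrow> y \<in> S v \<Longrightarrow> y \<in> K \<union> NL"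
proof -
  assume v: "v \<in> W" "\<not> lf v" "y \<in> S v"
  obtain x where x: "lf x" "y \<in> S x" "x \<in> Des W S v" using leaf_below[OF v] by blast
  obtain w where w: "w \<in> S x" "v \<le> w" using Des_last_ge[OF x(3)] by blast
  then have "y < w" using Sless v by (meson less_le_trans)
  then show ?thesis using nroleI[OF x(1,2) w(1)] nrole_NL by blast
qed

lemma required_NL: "v \<in> I \<Longrightarrow> \<not> lf v \<Longrightarrow> v \<in> NL"
  using Lrole_not_I IW by (auto simp: NL_def)

text \<open>The third clause prepares the fourth: once the top vertex of \<open>S v\<close> is
  coloured, two colours occur in \<open>S v\<close>, so a required \<open>v\<close> can itself
  supply a missing third.\<close>

definition goodcol :: "(nat \<Rightarrow> nat) \<Rightarrow> nat \<Rightarrow> bool" where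
  "goodcol col u \<longleftrightarrow> col u < 3 \<and> (\<forall>x h l. tri W S x h u l \<longrightarrow> col h \<noteq> col u) \<and>
     (\<forall>v\<in>I. \<not> lf v \<longrightarrow> u \<in> S v \<longrightarrow> (\<forall>s\<in>S v. s \<le> u) \<longrightarrow> (\<exists>s\<in>S v. col s \<noteq> col u)) \<and>
     (u \<in> I \<longrightarrow> (\<forall>i<3. \<exists>w\<in>bag S u. col w = i))"

lemma goodcol_cong:
  assumes "goodcol col u" "u \<in> W" "\<And>w. w \<le> u \<Longrightarrow> col' w = col w"
  shows "goodcol col' u"
proof -
  have eu: "col' u = col u" using assms(3) by simp
  have "col' h \<noteq> col' u" if t: "tri W S x h u l" for x h l
  proof -
    have "col' h = col h" using t assms(3)[of h] by (simp add: tri_def)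
    moreover have "col h \<noteq> col u" using assms(1) t unfolding goodcol_def by blast
    ultimately show ?thesis using eu by simp
  qed
  moreover have "\<exists>s\<in>S v. col' s \<noteq> col' u" if v: "v \<in> I" "\<not> lf v" "u \<in> S v" "\<forall>s\<in>S v. s \<le> u" for v
  proof -
    obtain s where s: "s \<in> S v" "col s \<noteq> col u" using assms(1) v unfolding goodcol_def by blast
    have "col' s = col s" using assms(3) s v by blast
    then show ?thesis using eu s by metis
  qed
  moreover have "\<exists>w\<in>bag S u. col' w = i" if i: "i < 3" "u \<in> I" for i
  proof -
    obtain w where w: "w \<in> bag S u" "col w = i" using assms(1) i unfolding goodcol_def by blast
    have "w \<le> u" using w Sless[OF assms(2)] by (auto simp: bag_def intro: less_imp_le)
    then show ?thesis using w assms(3) by metis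
  qed
  ultimately show ?thesis using assms(1) eu unfolding goodcol_def by simp
qed

text \<open>At most one colour is forbidden at \<open>u\<close> by each leaf \<open>x\<close>: that of the first vertex if \<open>u\<close> is the middle one,
  and that of a required clique which would become monochromatic up to its top if \<open>u\<close> is the first one.\<close>

definition forb :: "(nat \<Rightarrow> nat) \<Rightarrow> nat \<Rightarrow> nat \<Rightarrow> nat \<Rightarrow> bool" where
  "forb col u x f \<longleftrightarrow> (\<exists>h l. tri W S x h u l \<and> f = col h) \<or>
     (\<exists>m l v. tri W S x u m l \<and> v \<in> I \<and> u \<in> S v \<and> (\<forall>s\<in>S v. s \<le> u) \<and> x \<in> Des W S v \<and>
        (\<forall>s\<in>S v - {u}. col s = f))"

text \<open>The forbidden colour always belongs to an earlier neighbour of \<open>u\<close>. A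
  colour absent from \<open>S u\<close> is therefore never forbidden.\<close>

lemma forb_sub: "u \<in> W \<Longrightarrow> forb col u x f \<Longrightarrow> \<exists>s\<in>S u. col s = f"
proof -
  assume u: "u \<in> W" and "forb col u x f"
  then consider h l where "tri W S x h u l" "f = col h"
    | v where "v \<in> I" "u \<in> S v" "\<forall>s\<in>S v. s \<le> u" "\<forall>s\<in>S v - {u}. col s = f"
    unfolding forb_def by blast
  then show ?thesis
  proof cases
    case 1 then show ?thesis using triD(6)[OF 1(1)] u by blast
  next
    case 2
    have vW: "v \<in> W" using 2 IW by blast
    have "card (S v - {u}) \<noteq> 0" using Icard[OF 2(1)] 2(2) by (simp add: card_Diff_singleton_if)
    then have "S v - {u} \<noteq> {}" by (metis card.empty)
    then obtain s where s: "s \<in> S v" "s \<noteq> u" by blast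
    then have "s < u" using 2(3) by force
    then have "s \<in> S u" using peo[OF vW s(1) 2(2) u] by blast
    then show ?thesis using 2(4) s by blast
  qed
qed

lemma tri_unique:
  assumes "tri W S x h m l" "tri W S x h' m' l'"
  shows "h = h' \<and> m = m' \<and> l = l'"
proof -
  have e: "{h, m, l} = {h', m', l'}" and o: "h < m" "m < l" "h' < m'" "m' < l'"
    using assms unfolding tri_def by auto
  have "h \<in> {h', m', l'}" "m \<in> {h', m', l'}" "l \<in> {h', m', l'}" using e by blast+
  then show ?thesis using o by auto
qed

text \<open>The position of \<open>u\<close> in \<open>x\<close> decides which clause applies. For a
  first vertex, two required cliques with top \<open>u\<close> above the same leaf are comparable by
  \<open>Des_tree\<close>; the later one would then have an earlier neighbour beyond
  \<open>u\<close>, so they coincide.\<close>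

lemma forb_unique: "forb col u x f \<Longrightarrow> forb col u x g \<Longrightarrow> f = g"
proof -
  assume f: "forb col u x f" and g: "forb col u x g"
  show "f = g"
  proof (cases "\<exists>h l. tri W S x h u l")
    case True
    then obtain h l where t: "tri W S x h u l" by blast
    have "\<not> tri W S x u m l'" for m l' using tri_unique[OF t] triD(3)[OF t] by blast
    then have "\<exists>h l. tri W S x h u l \<and> f = col h" "\<exists>h l. tri W S x h u l \<and> g = col h"
      using f g unfolding forb_def by blast+
    then show ?thesis using tri_unique[OF t] by metis
  next
    case False
    then obtain v where v: "v \<in> I" "u \<in> S v" "\<forall>s\<in>S v. s \<le> u" "x \<in> Des W S v" "\<forall>s\<in>S v - {u}. col s = f"
      using f unfolding forb_def by blast
    obtain v' where v': "v' \<in> I" "u \<in> S v'" "\<forall>s\<in>S v'. s \<le> u" "x \<in> Des W S v'" "\<forall>s\<in>S v' - {u}. col s = g"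
      using g False unfolding forb_def by blast
    have vW: "v \<in> W" "v' \<in> W" using v v' IW by blast+
    have uv: "u < v" "u < v'" using Sless v v' vW by blast+
    have nD: "w' \<notin> Des W S w" if "u < w" "\<forall>s\<in>S w'. s \<le> u" for w w'
    proof
      assume "w' \<in> Des W S w"
      then obtain s where "s \<in> S w'" "w \<le> s" using Des_last_ge by blast
      then show False using that by fastforce
    qed
    have "v = v'"
    proof (rule ccontr)
      assume "v \<noteq> v'"
      then consider "v < v'" | "v' < v" by linarith
      then show False
      proof cases
        case 1 then show False using Des_tree[OF vW 1 v'(4) v(4)] nD[OF uv(1) v'(3)] by blast
      next
        case 2 then show False using Des_tree[OF vW(2,1) 2 v(4) v'(4)] nD[OF uv(2) v(3)] by blast
      qed
    qed
    have "card (S v - {u}) \<noteq> 0" using Icard[OF v(1)] v(2) by (simp add: card_Diff_singleton_if)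
    then have "S v - {u} \<noteq> {}" by (metis card.empty)
    then obtain s where "s \<in> S v - {u}" by blast
    then show ?thesis using v(5) v'(5) \<open>v = v'\<close> by metis
  qed
qed

lemma few_forb:
  assumes "u \<in> W" shows "card {f. \<exists>x\<in>leaves_at W S u. forb col u x f} \<le> 2"
proof -
  let ?F = "{f. \<exists>x\<in>leaves_at W S u. forb col u x f}"
  have "?F \<subseteq> (\<lambda>x. THE f. forb col u x f) ` leaves_at W S u"
  proof
    fix f assume "f \<in> ?F"
    then obtain x where x: "x \<in> leaves_at W S u" "forb col u x f" by blast
    have "(THE f. forb col u x f) = f" using x(2) forb_unique by (intro the_equality) blast+
    then show "f \<in> (\<lambda>x. THE f. forb col u x f) ` leaves_at W S u" using x(1) by blast
  qed
  then have "card ?F \<le> card (leaves_at W S u)" by (rule surj_card_le[OF finite_leaves_at])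
  then show ?thesis using card_leaves_at[OF assms] by simp
qed

lemma top_in_W: "v \<in> I \<Longrightarrow> \<exists>w\<in>S v. w \<in> W \<and> (\<forall>s\<in>S v. s \<le> w)"
proof -
  assume v: "v \<in> I"
  have vW: "v \<in> W" using v IW by blast
  obtain s where s: "s \<in> S v" "s \<in> W" using not_all_rooted v by blast
  have fin: "finite (S v)" "S v \<noteq> {}" using finS vW s by auto
  have M: "Max (S v) \<in> S v" "\<forall>s\<in>S v. s \<le> Max (S v)" using fin by auto
  then have "Max (S v) \<in> W" using above_in_W[OF vW M(1) s(2)] s by blast
  then show ?thesis using M by blast
qed

lemma colour_step:
  assumes u: "u \<in> NL" and cl: "\<forall>w\<in>K. col w < 3" and below: "\<forall>w\<in>NL. w < u \<longrightarrow> goodcol col w"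
  shows "\<exists>i. goodcol (col(u := i)) u"
proof -
  have uW: "u \<in> W" and nlu: "\<not> lf u" and nL: "\<not> Lrole u" using u by (auto simp: NL_def)
  define F where "F = {f. \<exists>x\<in>leaves_at W S u. forb col u x f}"
  have FS: "\<exists>s\<in>S u. col s = f" if "f \<in> F" for f using that forb_sub[OF uW] unfolding F_def by blast
  have c3: "col s < 3" if "s \<in> S u" for s
  proof -
    have "s \<in> K \<union> NL" using S_nonleaf_NL[OF uW nlu that] .
    moreover have "s < u" using Sless uW that by blast
    ultimately show ?thesis using cl below unfolding goodcol_def by blast
  qed
  have "finite (col ` S u)" using finS[OF uW] by simp
  then have finF: "finite F" using FS by (auto intro: finite_subset[of F "col ` S u"])
  have "\<not> {..<3} \<subseteq> F"
  proof
    assume "{..<3} \<subseteq> F"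
    then have "card {..<3::nat} \<le> card F" by (rule card_mono[OF finF])
    then show False using few_forb[OF uW, of col] unfolding F_def by simp
  qed
  then obtain j where j: "j < 3" "j \<notin> F" by blast
  have "\<exists>i<3. i \<notin> F \<and> (u \<in> I \<longrightarrow> (\<forall>k<3. k = i \<or> (\<exists>w\<in>S u. col w = k)))"
  \<comment> \<open>The free colour \<open>j\<close> suffices unless \<open>u\<close> is required
    and some colour is absent from \<open>S u\<close>. Then the absent colour is taken, and the
    condition at the top vertex of \<open>S u\<close> ensures that the other two occur.\<close>
  proof (cases "\<exists>i<3. u \<in> I \<and> (\<forall>w\<in>S u. col w \<noteq> i)")
    case False then show ?thesis using j by blast
  next
    case True
    then obtain i where i: "i < 3" "u \<in> I" "\<forall>w\<in>S u. col w \<noteq> i" by blast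
    have iF: "i \<notin> F" using FS i(3) by blast
    obtain w where w: "w \<in> S u" "w \<in> W" "\<forall>s\<in>S u. s \<le> w" using top_in_W i(2) by blast
    have "w \<in> NL" using S_nonleaf_NL[OF uW nlu w(1)] w(2) KW by blast
    then have "goodcol col w" using below Sless[OF uW w(1)] by blast
    then obtain s where s: "s \<in> S u" "col s \<noteq> col w" using w i(2) nlu unfolding goodcol_def by blast
    have "k = i \<or> k = col s \<or> k = col w" if "k < 3" for k
      using that i(1) c3[OF s(1)] c3[OF w(1)] s(2) i(3) s(1) w(1) by (metis less_Suc_eq numeral_3_eq_3 not_less0)
    then show ?thesis using i(1) iF s(1) w(1) by metis
  qed
  then obtain i where i: "i < 3" "i \<notin> F" "u \<in> I \<Longrightarrow> k < 3 \<Longrightarrow> k = i \<or> (\<exists>w\<in>S u. col w = k)" for k by metis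
  let ?c = "col(u := i)"
  have uS: "u \<notin> S u" using Sless uW by blast
  have "goodcol ?c u" unfolding goodcol_def
  proof (intro conjI allI impI ballI)
    show "?c u < 3" using i by simp
    fix x h l assume t: "tri W S x h u l"
    have "x \<in> leaves_at W S u" using t by (auto simp: leaves_at_def tri_def)
    then have "col h \<in> F" unfolding F_def forb_def using t by blast
    then show "?c h \<noteq> ?c u" using i(2) triD(3)[OF t] by auto
  next
    fix v assume v: "v \<in> I" "\<not> lf v" "u \<in> S v" "\<forall>s\<in>S v. s \<le> u"
    have vW: "v \<in> W" using v IW by blast
    show "\<exists>s\<in>S v. ?c s \<noteq> ?c u"
    proof (rule ccontr)
      assume "\<not> ?thesis"
      then have "\<forall>s\<in>S v. ?c s = i" by simp
      then have mono: "\<forall>s\<in>S v - {u}. col s = i" by (metis Diff_iff fun_upd_other insertI1)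
      \<comment> \<open>A leaf below the monochromatic clique contains \<open>u\<close>, as first or
        middle vertex because \<open>u\<close> is never last. In either position this leaf forbids
        the colour \<open>i\<close>.\<close>
      obtain x where x: "lf x" "u \<in> S x" "x \<in> Des W S v" using leaf_below[OF vW v(2,3)] by blast
      have xa: "x \<in> leaves_at W S u" using x by (simp add: leaves_at_def)
      obtain h m l where t: "tri W S x h m l" using tri_exists x by blast
      have "u = h \<or> u = m \<or> u = l" using x(2) triD(2)[OF t] by blast
      moreover have "u \<noteq> l" using nL t unfolding Lrole_def by blast
      ultimately show False
      proof (elim disjE)
        assume "u = h"
        then have "forb col u x i" unfolding forb_def using t v x mono by blast
        then show False using i(2) xa unfolding F_def by blast
      next
        assume um: "u = m"
        have "u < v" using Sless vW v by blast
        then have hv: "h < v" using triD(3)[OF t] um by simp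
        have "h \<in> S x" using triD(2)[OF t] by simp
        then have "h \<in> S v" by (rule Des_path_less[OF vW x(3) _ hv])
        then have "col h = i" using mono triD(3)[OF t] um by auto
        moreover have "forb col u x (col h)" unfolding forb_def using t um by blast
        ultimately show False using i(2) xa unfolding F_def by blast
      qed blast
    qed
  next
    fix k assume k: "u \<in> I" "k < (3::nat)"
    from i(3)[OF k] show "\<exists>w\<in>bag S u. ?c w = k"
    proof
      assume "\<exists>w\<in>S u. col w = k"
      then obtain w where "w \<in> S u" "col w = k" by blast
      then show ?thesis using uS by (intro bexI[of _ w]) (auto simp: bag_def)
    qed (auto simp: bag_def)
  qed
  then show ?thesis by blast
qed

lemma colouring_exists: "\<exists>col. (\<forall>k\<in>K. col k = c k) \<and> (\<forall>u\<in>NL. goodcol col u)"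
proof -
  have "\<exists>col. (\<forall>k\<in>K. col k = c k) \<and> (\<forall>u\<in>NL. u < n \<longrightarrow> goodcol col u)" for n
  proof (induction n)
    case (Suc n)
    then obtain col where col: "\<forall>k\<in>K. col k = c k" "\<forall>u\<in>NL. u < n \<longrightarrow> goodcol col u" by blast
    show ?case
    proof (cases "n \<in> NL")
      case False
      then show ?thesis using col by (intro exI[of _ col]) (auto simp: less_Suc_eq)
    next
      case True
      have "\<forall>w\<in>K. col w < 3" using col(1) rng by auto
      then obtain i where i: "goodcol (col(n := i)) n" using colour_step[OF True _ col(2)] by blast
      have nK: "n \<notin> K" using True KW unfolding NL_def by blast
      show ?thesis
      proof (intro exI[of _ "col(n := i)"] conjI ballI impI)
        show "(col(n := i)) k = c k" if "k \<in> K" for k using that nK col(1) by auto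
        fix u assume u: "u \<in> NL" "u < Suc n"
        show "goodcol (col(n := i)) u"
        proof (cases "u = n")
          case False
          then have un: "u < n" using u by simp
          show ?thesis
            by (rule goodcol_cong[of col]) (use col(2) u un in \<open>auto simp: NL_def\<close>)
        qed (use i in simp)
      qed
    qed
  qed auto
  then obtain col where col: "\<forall>k\<in>K. col k = c k" "\<forall>u\<in>NL. u < Suc (Max W) \<longrightarrow> goodcol col u" by blast
  have "u < Suc (Max W)" if "u \<in> NL" for u using that finW by (simp add: NL_def less_Suc_eq_le)
  then show ?thesis using col by blast
qed

lemma contradiction: False
proof -
  obtain col where cK: "\<forall>k\<in>K. col k = c k" and gc: "\<And>u. u \<in> NL \<Longrightarrow> goodcol col u"
    using colouring_exists by blast
  define L where "L = {x. lf x}"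
  define Lt where "Lt = {q. Lrole q}"
  have finL: "finite L" "L \<subseteq> W" using finW by (auto simp: L_def leaf_def)
  have finLt: "Lt \<subseteq> W" using Lrole_nonleaf by (auto simp: Lt_def)
  then have finLt': "finite Lt" using finW by (auto intro: finite_subset)
  have hm: "h \<in> K \<union> NL" "m \<in> K \<union> NL" if t: "tri W S x h m l" for x h m l
  proof -
    have "nrole h" "nrole m" using t unfolding nrole_def by blast+
    then show "h \<in> K \<union> NL" "m \<in> K \<union> NL" using nrole_NL by blast+
  qed
  have diff: "col h \<noteq> col m" if t: "tri W S x h m l" for x h m l
  proof (cases "m \<in> NL")
    case True then show ?thesis using gc t unfolding goodcol_def by blast
  next
    case False
    then have mK: "m \<in> K" using hm[OF t] by blast
    have "h \<notin> NL" using KW[OF mK, of h] triD(3)[OF t] by (auto simp: NL_def)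
    then have hK: "h \<in> K" using hm[OF t] by blast
    show ?thesis using inj cK mK hK triD(3)[OF t] by (metis inj_on_def less_irrefl)
  qed
  \<comment> \<open>The leaves whose first and middle vertex both miss colour \<open>i\<close>.
    Since these two have different colours, a leaf belongs to at most one of the three sets, so its
    last vertex is charged at most once per leaf.\<close>
  define M where "M i = {x \<in> L. \<exists>h m l. tri W S x h m l \<and> col h \<noteq> i \<and> col m \<noteq> i}" for i
  define last where "last x = (THE q. \<exists>h m. tri W S x h m q)" for x
  have last: "last x = l" if "tri W S x h m l" for x h m l
    unfolding last_def by (rule the_equality) (use that tri_unique in blast)+
  define U where "U i = {u \<in> NL. col u = i} \<union> last ` M i" for i
  have MW: "last ` M i \<subseteq> Lt" for i
  proof
    fix q assume "q \<in> last ` M i"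
    then obtain x h m l where "q = last x" "tri W S x h m l" by (auto simp: M_def)
    then show "q \<in> Lt" using last by (auto simp: Lt_def Lrole_def)
  qed
  have UW: "U i \<subseteq> W" for i using MW finLt by (auto simp: U_def NL_def)
  have cover: "w \<in> U i \<union> root_colour c K i" if "w \<in> K \<union> NL" "col w = i" for w i
    using that cK by (auto simp: U_def root_colour_def)
  have tr: "transv S I (U i \<union> root_colour c K i)" if i: "i < 3" for i
    unfolding transv_def
  proof
    fix v assume v: "v \<in> I"
    show "bag S v \<inter> (U i \<union> root_colour c K i) \<noteq> {}"
    proof (cases "lf v")
      case True
      then obtain h m l where t: "tri W S v h m l" using tri_exists by blast
      have b: "h \<in> bag S v" "m \<in> bag S v" "l \<in> bag S v" using triD(2)[OF t] by (auto simp: bag_def)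
      show ?thesis
      proof (cases "col h = i \<or> col m = i")
        case True
        then show ?thesis using cover[OF hm(1)[OF t]] cover[OF hm(2)[OF t]] b by blast
      next
        case False
        then have "v \<in> M i" using True t by (auto simp: M_def L_def)
        then have "l \<in> U i" using last[OF t] unfolding U_def by blast
        then show ?thesis using b by blast
      qed
    next
      case False
      have vN: "v \<in> NL" using required_NL v False by blast
      then obtain w where w: "w \<in> bag S v" "col w = i" using gc v i unfolding goodcol_def by blast
      have "w \<in> K \<union> NL" using w(1) vN S_nonleaf_NL[of v w] v IW False by (auto simp: bag_def)
      then show ?thesis using cover w by blast
    qed
  qed
  have finM: "finite (M i)" for i using finL by (simp add: M_def)
  have "(\<Sum>i<3. card (U i)) \<le> (\<Sum>i<3. card {u \<in> NL. col u = i} + card (M i))"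
  proof (rule sum_mono)
    fix i
    have "card (U i) \<le> card {u \<in> NL. col u = i} + card (last ` M i)" unfolding U_def by (rule card_Un_le)
    also have "card (last ` M i) \<le> card (M i)" by (rule card_image_le[OF finM])
    finally show "card (U i) \<le> card {u \<in> NL. col u = i} + card (M i)" by simp
  qed
  also have "\<dots> = (\<Sum>i<3. card {u \<in> NL. col u = i}) + (\<Sum>i<3. card (M i))" by (rule sum.distrib)
  also have "(\<Sum>i<3. card {u \<in> NL. col u = i}) = card NL"
  proof -
    have "(\<Sum>i<3. card {u \<in> NL. col u = i}) = card (\<Union>i\<in>{..<3}. {u \<in> NL. col u = i})"
      by (rule card_UN_disjoint[symmetric]) (use finite_NL in auto)
    also have "(\<Union>i\<in>{..<3}. {u \<in> NL. col u = i}) = NL"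
      using gc unfolding goodcol_def by auto
    finally show ?thesis .
  qed
  also have "(\<Sum>i<3. card (M i)) \<le> card L"
  proof -
    have disj: "M i \<inter> M j = {}" if ij: "i < 3" "j < 3" "i \<noteq> j" for i j
    proof (rule ccontr)
      assume "M i \<inter> M j \<noteq> {}"
      then obtain x where x: "x \<in> M i" "x \<in> M j" by blast
      obtain h m l where t: "tri W S x h m l" "col h \<noteq> i" "col m \<noteq> i" using x(1) by (auto simp: M_def)
      obtain h' m' l' where t': "tri W S x h' m' l'" "col h' \<noteq> j" "col m' \<noteq> j" using x(2) by (auto simp: M_def)
      have e: "h' = h" "m' = m" using tri_unique[OF t(1) t'(1)] by auto
      have lt: "col w < 3" if "w \<in> K \<union> NL" for w
        using that gc cK rng unfolding goodcol_def by auto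
      have "col h < 3" "col m < 3" using lt hm[OF t(1)] by blast+
      then show False using t t' e diff[OF t(1)] ij by (metis less_Suc_eq numeral_3_eq_3 not_less0)
    qed
    have "(\<Sum>i<3. card (M i)) = card (\<Union>i\<in>{..<3}. M i)"
      by (rule card_UN_disjoint[symmetric]) (use finM disj in auto)
    also have "\<dots> \<le> card L" by (rule card_mono[OF finL(1)]) (auto simp: M_def)
    finally show ?thesis .
  qed
  finally have cost: "(\<Sum>i<3. card (U i)) \<le> card NL + card L" by simp
  have L2: "card L \<le> 2 * card Lt"
  proof -
    have "L \<subseteq> (\<Union>q\<in>Lt. leaves_at W S q)"
    proof
      fix x assume "x \<in> L"
      then have "lf x" by (simp add: L_def)
      then obtain h m l where t: "tri W S x h m l" using tri_exists by blast
      then have "l \<in> Lt" "x \<in> leaves_at W S l" using triD(1,2)[OF t] by (auto simp: Lt_def Lrole_def leaves_at_def)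
      then show "x \<in> (\<Union>q\<in>Lt. leaves_at W S q)" by blast
    qed
    then have "card L \<le> card (\<Union>q\<in>Lt. leaves_at W S q)"
      by (rule card_mono[rotated]) (use finLt' finite_leaves_at in auto)
    also have "\<dots> \<le> (\<Sum>q\<in>Lt. card (leaves_at W S q))" by (rule card_UN_le[OF finLt'])
    also have "\<dots> \<le> (\<Sum>q\<in>Lt. 2)" by (rule sum_mono) (use finLt card_leaves_at in auto)
    finally show ?thesis by (simp add: mult.commute)
  qed
  have N2: "card NL \<le> 2 * card L"
  proof -
    have "NL \<subseteq> (\<Union>x\<in>L. S x - {last x})"
    proof
      fix w assume w: "w \<in> NL"
      then have "w \<in> W" "\<not> lf w" by (simp_all add: NL_def)
      then obtain x where x: "lf x" "w \<in> S x" using nonleaf_has_leaf by blast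
      obtain h m l where t: "tri W S x h m l" using tri_exists x(1) by blast
      have "w \<noteq> l" using w t unfolding NL_def Lrole_def by blast
      then have "w \<in> S x - {last x}" using x(2) last[OF t] by blast
      then show "w \<in> (\<Union>x\<in>L. S x - {last x})" using x(1) by (auto simp: L_def)
    qed
    then have "card NL \<le> card (\<Union>x\<in>L. S x - {last x})"
      by (rule card_mono[rotated]) (use finL finS in auto)
    also have "\<dots> \<le> (\<Sum>x\<in>L. card (S x - {last x}))" by (rule card_UN_le[OF finL(1)])
    also have "\<dots> \<le> (\<Sum>x\<in>L. 2)"
    proof (rule sum_mono)
      fix x assume "x \<in> L"
      then have x: "lf x" by (simp add: L_def)
      obtain h m l where t: "tri W S x h m l" using tri_exists x by blast
      have "last x \<in> S x" using last[OF t] triD(2)[OF t] by simp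
      then show "card (S x - {last x}) \<le> 2" using leaf_card[OF x] by simp
    qed
    finally show ?thesis by (simp add: mult.commute)
  qed
  have "card NL + card L + card Lt \<le> card W"
  proof -
    have d: "NL \<inter> L = {}" "(NL \<union> L) \<inter> Lt = {}" using Lrole_nonleaf by (auto simp: NL_def L_def Lt_def)
    have "card NL + card L + card Lt = card (NL \<union> L \<union> Lt)"
      using d finite_NL finL finLt' by (simp add: card_Un_disjoint)
    also have "\<dots> \<le> card W" by (rule card_mono[OF finW]) (use finL finLt in \<open>auto simp: NL_def\<close>)
    finally show ?thesis .
  qed
  then have "7 * (\<Sum>i<3. card (U i)) \<le> 6 * card W" using cost L2 N2 by linarith
  then have "good K c W S I" unfolding good_def using UW tr by blast
  then show False using notgood by blast
qed

end

lemma smaller_measure: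
  assumes "smaller W' S' I' W S I"
  shows "((card W', (\<Sum>v\<in>W'. card (S' v)), card I'), (card W, (\<Sum>v\<in>W. card (S v)), card I)) \<in> less_than <*lex*> less_than <*lex*> less_than"
  using assms unfolding smaller_def by auto

theorem rooted_good:
  assumes "peo_sys K W S I" "inj_on c K" "c ` K \<subseteq> {..<3::nat}"
  shows "good K c W S I"
proof -
  let ?r = "less_than <*lex*> less_than <*lex*> less_than"
  have wf: "wf ?r" by auto
  show ?thesis using assms
  proof (induction "(card W, (\<Sum>v\<in>W. card (S v)), card I)" arbitrary: K W S I c rule: wf_induct_rule[OF wf])
    case (1 W S I K c)
    show ?case
    proof (rule ccontr)
      assume n: "\<not> good K c W S I"
      have IH: "good K' c' W' S' I'" if "peo_sys K' W' S' I'" "inj_on c' K'" "c' ` K' \<subseteq> {..<3}" "smaller W' S' I' W S I"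
        for K' W' S' I' c'
        using 1(1)[OF smaller_measure[OF that(4)] that(1-3)] .
      have "rooted_critical K W S I c"
        by (rule rooted_critical.intro[OF 1(2) rooted_critical_axioms.intro[OF 1(3,4) n]]) (rule IH)
      then show False by (rule rooted_critical.contradiction)
    qed
  qed
qed


section \<open>Rankings and re-rooting\<close>

text \<open>Each colour class of the root is contracted to one representative, which makes the
  colouring injective. The hypothesis \<open>col\<close> counts colours instead of root vertices so
  that contracted bags remain large enough.\<close>

lemma rooted_good_merged:
  fixes c :: "nat \<Rightarrow> nat"
  assumes sys: "peo_sys K W S I0" and I: "I \<subseteq> W" and rng: "c ` K \<subseteq> {..<3}"
    and col: "\<And>v. v \<in> I \<Longrightarrow> 3 \<le> card (S v \<inter> W) + card (c ` (S v \<inter> K))"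
  shows "good K c W S I"
proof -
  interpret peo_sys K W S I0 by fact
  define f where "f k = (SOME k'. k' \<in> K \<and> c k' = c k)" for k
  have f: "f k \<in> K" "c (f k) = c k" if "k \<in> K" for k
    using someI[of "\<lambda>k'. k' \<in> K \<and> c k' = c k" k] that unfolding f_def by auto
  have fc: "f k = f k'" if "c k = c k'" for k k' using that unfolding f_def by simp
  define S' where "S' v = (S v \<inter> W) \<union> f ` (S v \<inter> K)" for v
  have fKW: "f k \<notin> W" if "k \<in> K" for k using f(1)[OF that] KW by blast
  have sys': "peo_sys (f ` K) W S' I"
  proof
    show "finite (f ` K)" "finite W" using finK finW by auto
    show "k < w" if "k \<in> f ` K" "w \<in> W" for k w using that f(1) KW by blast
    show "S' v \<subseteq> f ` K \<union> W" for v unfolding S'_def by blast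
    show "u < v" if "v \<in> W" "u \<in> S' v" for u v using that Sless f(1) KW unfolding S'_def by blast
    show "a \<in> S' b" if v: "v \<in> W" "a \<in> S' v" "b \<in> S' v" "b \<in> W" "a < b" for v a b
    proof -
      have b: "b \<in> S v" using v(3,4) fKW unfolding S'_def by blast
      from v(2) consider "a \<in> S v" "a \<in> W" | k where "k \<in> S v" "k \<in> K" "a = f k" unfolding S'_def by blast
      then show ?thesis
      proof cases
        case 1 then show ?thesis using peo v b unfolding S'_def by blast
      next
        case 2
        then have "k \<in> S b" using peo[OF v(1) _ b v(4)] KW v(4) by blast
        then show ?thesis using 2 unfolding S'_def by blast
      qed
    qed
    show "I \<subseteq> W" by fact
    show "3 \<le> card (S' v)" if v: "v \<in> I" for v
    proof -
      have fin: "finite (S v)" using finS v I by blast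
      have "card (c ` (S v \<inter> K)) = card (c ` f ` (S v \<inter> K))" using f(2) by (simp add: image_image)
      also have "\<dots> \<le> card (f ` (S v \<inter> K))" using fin by (intro card_image_le) simp
      finally have "3 \<le> card (S v \<inter> W) + card (f ` (S v \<inter> K))" using col[OF v] by simp
      also have "\<dots> = card (S' v)" unfolding S'_def using fin fKW by (intro card_Un_disjoint[symmetric]) auto
      finally show ?thesis .
    qed
  qed
  have "inj_on c (f ` K)"
  proof (rule inj_onI)
    fix a b assume "a \<in> f ` K" "b \<in> f ` K" "c a = c b"
    then obtain k l where kl: "k \<in> K" "a = f k" "l \<in> K" "b = f l" by blast
    then have "c k = c l" using f(2) \<open>c a = c b\<close> by metis
    then show "a = b" using fc kl by metis
  qed
  moreover have "c ` f ` K \<subseteq> {..<3}" using f(1) rng by blast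
  ultimately have g: "good (f ` K) c W S' I" by (rule rooted_good[OF sys'])
  have tr: "transv S I (U \<union> root_colour c K i)" if U: "U \<subseteq> W" "transv S' I (U \<union> root_colour c (f ` K) i)" for U i
    unfolding transv_def
  proof
    fix v assume v: "v \<in> I"
    then obtain w where w: "w \<in> bag S' v" "w \<in> U \<union> root_colour c (f ` K) i" using U(2) unfolding transv_def by blast
    show "bag S v \<inter> (U \<union> root_colour c K i) \<noteq> {}"
    proof (cases "w \<in> W")
      case True
      then have "w \<in> bag S v" using w(1) fKW unfolding bag_def S'_def by blast
      moreover have "w \<in> U" using w(2) True fKW unfolding root_colour_def by blast
      ultimately show ?thesis by blast
    next
      case False
      then have "w \<in> f ` (S v \<inter> K)" using w(1) v I unfolding bag_def S'_def by blast
      then obtain k where k: "k \<in> S v" "k \<in> K" "w = f k" by blast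
      have "w \<in> root_colour c (f ` K) i" using w(2) False U(1) by blast
      then have "c k = i" using k f(2)[OF k(2)] unfolding root_colour_def by simp
      then show ?thesis using k unfolding bag_def root_colour_def by blast
    qed
  qed
  from goodD[OF g] obtain U where U: "\<forall>i<3. U i \<subseteq> W \<and> transv S' I (U i \<union> root_colour c (f ` K) i)"
     "7 * (\<Sum>i<3. card (U i)) \<le> 6 * card W" by blast
  show ?thesis unfolding good_def using U tr by (intro exI[of _ U]) simp
qed

section \<open>Elimination orderings that begin with a given clique\<close>

definition simplicial_in :: "'a set \<Rightarrow> ('a \<Rightarrow> 'a \<Rightarrow> bool) \<Rightarrow> 'a \<Rightarrow> bool" where
  "simplicial_in U E v \<longleftrightarrow> v \<in> U \<and> (\<forall>a\<in>U. \<forall>b\<in>U. E v a \<longrightarrow> E v b \<longrightarrow> a \<noteq> b \<longrightarrow> E a b)"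

text \<open>For finite graphs this is an equivalent form of chordality; it passes to vertex subsets
  at once.\<close>

definition dismantlable :: "'a set \<Rightarrow> ('a \<Rightarrow> 'a \<Rightarrow> bool) \<Rightarrow> bool" where
  "dismantlable V E \<longleftrightarrow> (\<forall>U\<subseteq>V. U \<noteq> {} \<longrightarrow> (\<exists>v. simplicial_in U E v))"

lemma dismantlable_subset: "dismantlable V E \<Longrightarrow> U \<subseteq> V \<Longrightarrow> dismantlable U E"
  unfolding dismantlable_def by blast

text \<open>A simplicial \<open>v\<close> in \<open>Q\<close> has \<open>Q\<close> within its closed
  neighbourhood. Induction on \<open>V - {v}\<close> with the clique of neighbours of
  \<open>v\<close> gives a simplicial vertex not adjacent to \<open>v\<close>, which stays
  simplicial when \<open>v\<close> returns. If \<open>v\<close> is adjacent to everything, the whole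
  graph is complete.\<close>

lemma simplicial_outside_clique:
  assumes "finite V" "symp E" "dismantlable V E" "pairwise E Q" "Q \<subseteq> V" "Q \<noteq> V"
  shows "\<exists>v. v \<in> V \<and> v \<notin> Q \<and> simplicial_in V E v"
  using assms
proof (induction "card V" arbitrary: V Q rule: less_induct)
  case less
  have "V \<noteq> {}" using less.prems by blast
  then obtain v where v: "simplicial_in V E v" using less.prems(3) unfolding dismantlable_def by blast
  have vV: "v \<in> V" using v by (simp add: simplicial_in_def)
  show ?case
  proof (cases "v \<in> Q")
    case False
    then have "v \<in> V \<and> v \<notin> Q \<and> simplicial_in V E v" using v vV by simp
    then show ?thesis by (intro exI[of _ v])
  next
    case True
    define Q' where "Q' = {w \<in> V - {v}. E v w}"
    have QQ: "Q \<subseteq> insert v Q'"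
    proof
      fix x assume x: "x \<in> Q"
      then have "x \<noteq> v \<Longrightarrow> E v x" using pairwiseD[OF less.prems(4) True x] by simp
      then show "x \<in> insert v Q'" using x less.prems(5) by (auto simp: Q'_def)
    qed
    have pw: "pairwise E Q'"
    proof (rule pairwiseI)
      fix a b assume "a \<in> Q'" "b \<in> Q'" "a \<noteq> b"
      then show "E a b" using v by (simp add: Q'_def simplicial_in_def)
    qed
    show ?thesis
    proof (cases "Q' = V - {v}")
      case True
      have "E a b" if "a \<in> V" "b \<in> V" "a \<noteq> b" for a b
      proof -
        have mem: "w \<in> Q' \<longleftrightarrow> w \<noteq> v" if "w \<in> V" for w using that True by simp
        have adj: "w \<in> Q' \<Longrightarrow> E v w" for w by (simp add: Q'_def)
        show ?thesis
        proof (cases "a = v \<or> b = v")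
          case True
          then show ?thesis using adj mem that sympD[OF less.prems(2)] by metis
        next
          case False
          then show ?thesis using pairwiseD[OF pw, of a b] mem that by simp
        qed
      qed
      then have si: "simplicial_in V E w" if "w \<in> V" for w using that unfolding simplicial_in_def by metis
      obtain w where "w \<in> V" "w \<notin> Q" using less.prems(5,6) by blast
      then show ?thesis using si by metis
    next
      case False
      have "card (V - {v}) < card V" using vV less.prems(1) by (metis card_Diff1_less)
      moreover have "dismantlable (V - {v}) E" using dismantlable_subset[OF less.prems(3)] by blast
      moreover have "Q' \<subseteq> V - {v}" unfolding Q'_def by blast
      ultimately obtain w where w: "w \<in> V - {v}" "w \<notin> Q'" "simplicial_in (V - {v}) E w"
        using less.hyps[of "V - {v}" Q'] less.prems(1,2) pw False by blast
      then have "\<not> E w v" using sympD[OF less.prems(2), of w v] by (auto simp: Q'_def)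
      then have "simplicial_in V E w" using w(3) unfolding simplicial_in_def by (metis Diff_iff singletonD)
      moreover have "w \<in> V \<and> w \<notin> Q" using w(1,2) QQ by blast
      ultimately show ?thesis by metis
    qed
  qed
qed

text \<open>A simplicial vertex outside \<open>Q\<close> gets the highest rank and is removed; this
  is repeated until only the clique \<open>Q\<close> is left, whose internal order is
  arbitrary.\<close>

lemma ranking_exists:
  assumes "finite V" "symp E" "dismantlable V E" "pairwise E Q" "Q \<subseteq> V"
  shows "\<exists>f::'a \<Rightarrow> nat. inj_on f V \<and> (\<forall>q\<in>Q. \<forall>w\<in>V - Q. f q < f w) \<and>
    (\<forall>v\<in>V. pairwise E {u \<in> V. E u v \<and> f u < f v})"
  using assms
proof (induction "card V" arbitrary: V rule: less_induct)
  case less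
  show ?case
  proof (cases "Q = V")
    case True
    obtain f :: "'a \<Rightarrow> nat" where "inj_on f V" using finite_imp_inj_to_nat_seg[OF less.prems(1)] by blast
    moreover have "\<forall>v\<in>V. pairwise E {u \<in> V. E u v \<and> f u < f v}" for f :: "'a \<Rightarrow> nat"
      using less.prems(4) True unfolding pairwise_def by blast
    ultimately show ?thesis using True by (intro exI[of _ f]) blast
  next
    case False
    then obtain v where v: "v \<in> V" "v \<notin> Q" "simplicial_in V E v"
      using simplicial_outside_clique less.prems by blast
    have lt: "card (V - {v}) < card V" using v less.prems(1) by (metis card_Diff1_less)
    have fin: "finite (V - {v})" using less.prems(1) by simp
    have dis: "dismantlable (V - {v}) E" by (rule dismantlable_subset[OF less.prems(3)]) blast
    have QV: "Q \<subseteq> V - {v}" using less.prems(5) v(2) by blast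
    from less.hyps[OF lt fin less.prems(2) dis less.prems(4) QV]
    obtain f :: "'a \<Rightarrow> nat" where "inj_on f (V - {v}) \<and> (\<forall>q\<in>Q. \<forall>w\<in>V - {v} - Q. f q < f w) \<and>
      (\<forall>w\<in>V - {v}. pairwise E {u \<in> V - {v}. E u w \<and> f u < f w})" by (rule exE)
    note f = conjunct1[OF this] conjunct1[OF conjunct2[OF this]] conjunct2[OF conjunct2[OF this]]
    define m where "m = Suc (Max (insert 0 (f ` V)))"
    have m: "f u < m" if "u \<in> V" for u using that less.prems(1) unfolding m_def by (simp add: less_Suc_eq_le)
    define g where "g = f(v := m)"
    have gv: "g v = m" and go: "u \<noteq> v \<Longrightarrow> g u = f u" for u by (simp_all add: g_def)
    have gm: "u \<in> V \<Longrightarrow> u \<noteq> v \<Longrightarrow> g u < g v" for u using m go gv by simp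
    have "inj_on g V"
    proof (rule inj_onI)
      fix a b assume ab: "a \<in> V" "b \<in> V" "g a = g b"
      show "a = b"
      proof (rule ccontr)
        assume "a \<noteq> b"
        then consider "a = v" "b \<noteq> v" | "b = v" "a \<noteq> v" | "a \<noteq> v" "b \<noteq> v" by blast
        then show False
        proof cases
          case 1 then show False using gm[OF ab(2)] ab(3) by simp
        next
          case 2 then show False using gm[OF ab(1)] ab(3) by simp
        next
          case 3 then show False using f(1) ab go \<open>a \<noteq> b\<close> by (metis DiffI inj_on_def singletonD)
        qed
      qed
    qed
    moreover have "g q < g w" if "q \<in> Q" "w \<in> V - Q" for q w
      using that f(2) gm[of q] go v(2) less.prems(5) by (metis DiffD1 DiffD2 DiffI singletonD subsetD)
    moreover have "pairwise E {u \<in> V. E u w \<and> g u < g w}" if w: "w \<in> V" for w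
    proof (cases "w = v")
      case True
      show ?thesis using v(3) less.prems(2) unfolding True pairwise_def simplicial_in_def symp_def by blast
    next
      case False
      have "{u \<in> V. E u w \<and> g u < g w} \<subseteq> {u \<in> V - {v}. E u w \<and> f u < f w}"
        using False go gm[OF w] by (auto simp: g_def split: if_splits)
      then show ?thesis using f(3) w False pairwise_subset by blast
    qed
    ultimately show ?thesis by blast
  qed
qed

section \<open>Passing between graphs and systems of ranks\<close>

definition maxclique :: "'a set \<Rightarrow> ('a \<Rightarrow> 'a \<Rightarrow> bool) \<Rightarrow> 'a set \<Rightarrow> bool" where
  "maxclique V E B \<longleftrightarrow> B \<subseteq> V \<and> pairwise E B \<and> (\<forall>D\<subseteq>V. pairwise E D \<longrightarrow> B \<subseteq> D \<longrightarrow> D = B)"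

definition ranked :: "'a set \<Rightarrow> ('a \<Rightarrow> 'a \<Rightarrow> bool) \<Rightarrow> ('a \<Rightarrow> nat) \<Rightarrow> nat \<Rightarrow> nat set" where
  "ranked V E f n = f ` {u \<in> V. E u (inv_into V f n) \<and> f u < n}"

lemma ranked_at: "inj_on f V \<Longrightarrow> v \<in> V \<Longrightarrow> ranked V E f (f v) = f ` {u \<in> V. E u v \<and> f u < f v}"
  unfolding ranked_def by simp

lemma ranked_sys:
  assumes fin: "finite V" and inj: "inj_on f V"
    and first: "\<forall>q\<in>Q. \<forall>w\<in>V - Q. f q < f w" and Q: "Q \<subseteq> V"
    and cl: "\<forall>v\<in>V. pairwise E {u \<in> V. E u v \<and> f u < f v}"
  shows "peo_sys (f ` Q) (f ` (V - Q)) (ranked V E f) {}"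
proof
  show "finite (f ` Q)" "finite (f ` (V - Q))" using fin Q by (auto intro: finite_subset)
  show "k < w" if "k \<in> f ` Q" "w \<in> f ` (V - Q)" for k w using that first by blast
  note at = ranked_at[OF inj, of _ E]
  show "ranked V E f v \<subseteq> f ` Q \<union> f ` (V - Q)" for v unfolding ranked_def by blast
  show "u < v" if "u \<in> ranked V E f v" for u v using that unfolding ranked_def by blast
  show "a \<in> ranked V E f b" if h: "v \<in> f ` (V - Q)" "a \<in> ranked V E f v" "b \<in> ranked V E f v" "a < b" for v a b
  proof -
    obtain w where w: "w \<in> V" "v = f w" using h(1) by blast
    obtain a' where a: "a = f a'" "a' \<in> V" "E a' w" "f a' < f w" using h(2) w at by auto
    obtain b' where b: "b = f b'" "b' \<in> V" "E b' w" "f b' < f w" using h(3) w at by auto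
    have "a' \<noteq> b'" using a b h(4) by auto
    then have "E a' b'" using cl w(1) a b unfolding pairwise_def by blast
    then show ?thesis using a b h(4) at by auto
  qed
qed auto

lemma ranked_clique:
  assumes fin: "finite V" and inj: "inj_on f V" and B: "B \<subseteq> V" "pairwise E B" "B \<noteq> {}"
  shows "\<exists>t\<in>B. f ` B \<subseteq> bag (ranked V E f) (f t) \<and> (\<forall>b\<in>B. f b \<le> f t)"
proof -
  have finB: "finite (f ` B)" using B(1) fin by (auto intro: finite_subset)
  then have "Max (f ` B) \<in> f ` B" using B(3) by (intro Max_in) auto
  then obtain t where t: "t \<in> B" "f t = Max (f ` B)" by auto
  have le: "f b \<le> f t" if "b \<in> B" for b using that finB t(2) by simp
  have tV: "t \<in> V" using t(1) B(1) by blast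
  have "f b \<in> bag (ranked V E f) (f t)" if b: "b \<in> B" for b
  proof (cases "b = t")
    case False
    then have "f b \<noteq> f t" using inj b t(1) B(1) by (auto simp: inj_on_def)
    then have "b \<in> {u \<in> V. E u t \<and> f u < f t}" using le[OF b] B(1,2) b t(1) False unfolding pairwise_def by auto
    then show ?thesis unfolding bag_def ranked_at[OF inj tV] by blast
  qed (simp add: bag_def)
  then show ?thesis using t(1) le by blast
qed

text \<open>The bag at the highest vertex of a clique is itself a clique containing it. For a
  maximal clique the two coincide, so maximal cliques become bags under any such ranking.\<close>

lemma ranked_maxclique:
  assumes fin: "finite V" and sym: "symp E" and inj: "inj_on f V"
    and cl: "\<forall>v\<in>V. pairwise E {u \<in> V. E u v \<and> f u < f v}"
    and B: "maxclique V E B" "B \<noteq> {}"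
  shows "\<exists>t\<in>B. bag (ranked V E f) (f t) = f ` B \<and> (\<forall>b\<in>B. f b \<le> f t)"
proof -
  have BV: "B \<subseteq> V" "pairwise E B" using B(1) by (auto simp: maxclique_def)
  obtain t where t: "t \<in> B" "f ` B \<subseteq> bag (ranked V E f) (f t)" "\<forall>b\<in>B. f b \<le> f t"
    using ranked_clique[OF fin inj BV B(2)] by blast
  have tV: "t \<in> V" using t(1) BV(1) by blast
  let ?D = "insert t {u \<in> V. E u t \<and> f u < f t}"
  have bag: "bag (ranked V E f) (f t) = f ` ?D"
    unfolding bag_def ranked_at[OF inj tV] by blast
  have D: "?D \<subseteq> V" using tV by blast
  have "B \<subseteq> ?D"
  proof
    fix b assume b: "b \<in> B"
    then have "f b \<in> f ` ?D" using t(2) unfolding bag by blast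
    then obtain d where d: "f b = f d" "d \<in> ?D" by blast
    have "b = d" by (rule inj_onD[OF inj d(1)]) (use b BV(1) d(2) D in blast)+
    then show "b \<in> ?D" using d(2) by blast
  qed
  moreover have "pairwise E ?D"
    using cl tV sym unfolding pairwise_def symp_def by blast
  ultimately have "?D = B" using B(1) D unfolding maxclique_def by blast
  then show ?thesis using bag t(1,3) by metis
qed

lemma ranked_bag_maximal:
  assumes sym: "symp E" and inj: "inj_on f V" and B: "maxclique V E B" "bag (ranked V E f) n = f ` B"
    and j: "j \<in> f ` V"
  shows "\<not> bag (ranked V E f) n \<subseteq> ranked V E f j"
proof
  assume sub: "bag (ranked V E f) n \<subseteq> ranked V E f j"
  have mB: "B \<subseteq> V" "pairwise E B" using B(1) by (auto simp: maxclique_def)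
  obtain t where t: "t \<in> V" "j = f t" using j by blast
  have im: "f ` B \<subseteq> f ` {u \<in> V. E u t \<and> f u < f t}" using sub unfolding B(2) t(2) ranked_at[OF inj t(1)] .
  have Bt: "E b t \<and> f b < f t" if b: "b \<in> B" for b
  proof -
    obtain u where u: "u \<in> V" "E u t" "f u < f t" "f b = f u" using im b by blast
    then show ?thesis using inj_onD[OF inj u(4)] mB(1) b by auto
  qed
  have "pairwise E (insert t B)" using Bt mB(2) sym unfolding pairwise_def symp_def by blast
  then have "insert t B = B" using B(1) mB(1) t(1) unfolding maxclique_def by blast
  then show False using Bt[of t] by blast
qed

text \<open>The rooted bound in graph form, for an arbitrary three-colouring of a clique
  \<open>Q\<close>. The 4 here, against the 3 in \<open>rooted_good_merged\<close>, counts the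
  highest vertex of the clique, which lies outside \<open>Q\<close>.\<close>

theorem clique_rooted_transversals:
  fixes c :: "'a \<Rightarrow> nat"
  assumes fin: "finite V" and sym: "symp E" and dis: "dismantlable V E"
    and Q: "pairwise E Q" "Q \<subseteq> V" and rng: "c ` Q \<subseteq> {..<3}"
    and C: "\<And>B. B \<in> C \<Longrightarrow> maxclique V E B \<and> \<not> B \<subseteq> Q \<and> 4 \<le> card (B - Q) + card (c ` (B \<inter> Q))"
  shows "\<exists>U. (\<forall>i<3. U i \<subseteq> V - Q \<and> (\<forall>B\<in>C. B \<inter> (U i \<union> {q \<in> Q. c q = i}) \<noteq> {})) \<and>
     7 * (\<Sum>i<3. card (U i)) \<le> 6 * card (V - Q)"
proof -
  obtain f :: "'a \<Rightarrow> nat" where inj: "inj_on f V" and first: "\<forall>q\<in>Q. \<forall>w\<in>V - Q. f q < f w"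
    and cl: "\<forall>v\<in>V. pairwise E {u \<in> V. E u v \<and> f u < f v}"
    using ranking_exists[OF fin sym dis Q] by blast
  let ?S = "ranked V E f"
  define g where "g = inv_into V f"
  have gf: "g (f v) = v" if "v \<in> V" for v using that inj by (simp add: g_def)
  define I where "I = {n \<in> f ` (V - Q). \<exists>B\<in>C. bag ?S n = f ` B}"
  have good: "good (f ` Q) (c \<circ> g) (f ` (V - Q)) ?S I"
  proof (rule rooted_good_merged[OF ranked_sys[OF fin inj first Q(2) cl]])
    show "I \<subseteq> f ` (V - Q)" by (auto simp: I_def)
    show "(c \<circ> g) ` f ` Q \<subseteq> {..<3}" using rng gf Q(2) by force
    fix n assume "n \<in> I"
    then obtain B where B: "n \<in> f ` (V - Q)" "B \<in> C" "bag ?S n = f ` B" by (auto simp: I_def)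
    have BV: "B \<subseteq> V" using C[OF B(2)] by (auto simp: maxclique_def)
    have nS: "n \<notin> ?S n" by (auto simp: ranked_def)
    have Sn: "?S n = f ` B - {n}" using B(3) nS unfolding bag_def by blast
    have d: "f ` (V - Q) \<inter> f ` Q = {}"
    proof (rule ccontr)
      assume "f ` (V - Q) \<inter> f ` Q \<noteq> {}"
      then obtain w q where "w \<in> V - Q" "q \<in> Q" "f w = f q" by blast
      then show False using first by (metis less_irrefl)
    qed
    have nB: "n \<in> f ` (B - Q)"
    proof -
      have "n \<in> f ` B" using B(3) unfolding bag_def by blast
      then show ?thesis using B(1) d by blast
    qed
    have "f ` (B - Q) - {n} \<subseteq> ?S n \<inter> f ` (V - Q)" unfolding Sn using BV by blast
    then have "card (f ` (B - Q) - {n}) \<le> card (?S n \<inter> f ` (V - Q))"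
      by (rule card_mono[rotated]) (use fin in auto)
    moreover have "card (f ` (B - Q) - {n}) = card (B - Q) - 1"
    proof -
      have "inj_on f (B - Q)" using inj BV by (meson Diff_subset inj_on_subset)
      then show ?thesis using nB by (simp add: card_image)
    qed
    moreover have "c ` (B \<inter> Q) \<subseteq> (c \<circ> g) ` (?S n \<inter> f ` Q)"
    proof
      fix k assume "k \<in> c ` (B \<inter> Q)"
      then obtain q where q: "q \<in> B" "q \<in> Q" "k = c q" by blast
      have "f q \<in> ?S n \<inter> f ` Q" unfolding Sn using q B(1) d by blast
      moreover have "(c \<circ> g) (f q) = k" using gf q Q(2) by auto
      ultimately show "k \<in> (c \<circ> g) ` (?S n \<inter> f ` Q)" by (metis image_eqI)
    qed
    then have "card (c ` (B \<inter> Q)) \<le> card ((c \<circ> g) ` (?S n \<inter> f ` Q))"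
      by (rule card_mono[rotated]) (use finite_subset[OF Q(2) fin] in simp)
    ultimately show "3 \<le> card (?S n \<inter> f ` (V - Q)) + card ((c \<circ> g) ` (?S n \<inter> f ` Q))"
      using C[OF B(2)] by linarith
  qed
  from goodD[OF good] obtain U where
    U: "\<forall>i<3. U i \<subseteq> f ` (V - Q) \<and> transv ?S I (U i \<union> root_colour (c \<circ> g) (f ` Q) i)"
    and sz: "7 * (\<Sum>i<3. card (U i)) \<le> 6 * card (f ` (V - Q))" by blast
  define U' where "U' i = g ` U i" for i
  have finU: "finite (U i)" if "i < 3" for i using U that fin by (meson finite_Diff finite_imageI finite_subset)
  have cover: "U' i \<subseteq> V - Q \<and> (\<forall>B\<in>C. B \<inter> (U' i \<union> {q \<in> Q. c q = i}) \<noteq> {})" if i: "i < 3" for i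
  proof
    have Ui: "U i \<subseteq> f ` (V - Q)" and tr: "transv ?S I (U i \<union> root_colour (c \<circ> g) (f ` Q) i)" using U i by blast+
    show "U' i \<subseteq> V - Q" using Ui gf unfolding U'_def by force
    show "\<forall>B\<in>C. B \<inter> (U' i \<union> {q \<in> Q. c q = i}) \<noteq> {}"
    proof
      fix B assume B: "B \<in> C"
      have BV: "B \<subseteq> V" and Bn: "\<not> B \<subseteq> Q" using C[OF B] by (auto simp: maxclique_def)
      obtain t where t: "t \<in> B" "bag ?S (f t) = f ` B" "\<forall>b\<in>B. f b \<le> f t"
        using ranked_maxclique[OF fin sym inj cl, of B] C[OF B] by blast
      have "t \<notin> Q" using Bn t(3) first BV by (meson DiffI leD subsetD subsetI)
      then have "f t \<in> I" using t B BV unfolding I_def by blast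
      then have "f ` B \<inter> (U i \<union> root_colour (c \<circ> g) (f ` Q) i) \<noteq> {}" using tr t(2) unfolding transv_def by metis
      then obtain b where b: "b \<in> B" "f b \<in> U i \<union> root_colour (c \<circ> g) (f ` Q) i" by blast
      have "b \<in> U' i \<union> {q \<in> Q. c q = i}"
      proof (cases "f b \<in> U i")
        case True then show ?thesis using gf b(1) BV unfolding U'_def by (metis UnI1 image_eqI subsetD)
      next
        case False
        then have r: "f b \<in> f ` Q" "c (g (f b)) = i" using b(2) unfolding root_colour_def by auto
        then show ?thesis using gf[of b] b(1) BV Q(2) inj by (auto simp: inj_on_def)
      qed
      then show "B \<inter> (U' i \<union> {q \<in> Q. c q = i}) \<noteq> {}" using b(1) by blast
    qed
  qed
  have size: "7 * (\<Sum>i<3. card (U' i)) \<le> 6 * card (V - Q)"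
  proof -
    have "(\<Sum>i<3. card (U' i)) \<le> (\<Sum>i<3. card (U i))"
      by (rule sum_mono) (use finU in \<open>auto simp: U'_def card_image_le\<close>)
    moreover have "card (f ` (V - Q)) = card (V - Q)" using inj by (simp add: card_image inj_on_diff)
    ultimately show ?thesis using sz by simp
  qed
  show ?thesis
    by (rule exI[of _ U'], rule conjI[OF _ size], intro allI impI, rule cover)
qed

section \<open>Unrooted systems of maximal cliques and their re-ranking\<close>

locale bsys = peo_sys "{}" V S I for V S I +
  assumes Mx: "v \<in> I \<Longrightarrow> j \<in> V \<Longrightarrow> \<not> bag S v \<subseteq> S j"

definition sysE :: "(nat \<Rightarrow> nat set) \<Rightarrow> nat \<Rightarrow> nat \<Rightarrow> bool" where
  "sysE S u v \<longleftrightarrow> u \<in> S v \<or> v \<in> S u"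

lemma symp_sysE: "symp (sysE S)" unfolding symp_def sysE_def by blast

context bsys begin

lemma SV: "v \<in> V \<Longrightarrow> S v \<subseteq> V" using Ssub by simp

lemma sysE_less: "u \<in> V \<Longrightarrow> v \<in> V \<Longrightarrow> u < v \<Longrightarrow> sysE S u v \<longleftrightarrow> u \<in> S v"
  unfolding sysE_def using Sless by (meson less_asym)

lemma sysE_irrefl: "v \<in> V \<Longrightarrow> \<not> sysE S v v"
  unfolding sysE_def using Sless by blast

lemma bag_pairwise: "v \<in> V \<Longrightarrow> pairwise (sysE S) (bag S v)"
proof (rule pairwiseI)
  fix a b assume v: "v \<in> V" and ab: "a \<in> bag S v" "b \<in> bag S v" "a \<noteq> b"
  have *: "a \<in> S b" if "a \<in> bag S v" "b \<in> bag S v" "a < b" for a b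
    using that peo[OF v, of a b] Sless[OF v, of b] SV[OF v] unfolding bag_def by auto
  show "sysE S a b" using *[of a b] *[of b a] ab unfolding sysE_def by (meson nat_neq_iff)
qed

lemma dismantlable_sysE: "dismantlable V (sysE S)"
  unfolding dismantlable_def
proof (intro allI impI)
  fix U assume U: "U \<subseteq> V" "U \<noteq> {}"
  have fU: "finite U" using U finW by (auto intro: finite_subset)
  define m where "m = Max U"
  have m: "m \<in> U" using fU U by (simp add: m_def)
  have "a \<in> S m" if "a \<in> U" "sysE S m a" for a
  proof -
    have "a \<le> m" using fU that by (simp add: m_def)
    moreover have "a \<noteq> m" using that m U sysE_irrefl by blast
    ultimately show ?thesis using that m U sysE_less[of a m] symp_sysE[of S] by (auto simp: sysE_def)
  qed
  then have "simplicial_in U (sysE S) m"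
    using bag_pairwise[of m] m U unfolding simplicial_in_def pairwise_def bag_def by blast
  then show "\<exists>v. simplicial_in U (sysE S) v" by blast
qed

text \<open>A larger clique has its highest vertex \<open>t\<close> beyond \<open>v\<close>, and
  then the whole bag lies in \<open>S t\<close>, against \<open>Mx\<close>.\<close>

lemma bag_maxclique: "v \<in> I \<Longrightarrow> U \<subseteq> V \<Longrightarrow> bag S v \<subseteq> U \<Longrightarrow> maxclique U (sysE S) (bag S v)"
  unfolding maxclique_def
proof (intro conjI allI impI)
  assume v: "v \<in> I" and U: "U \<subseteq> V" "bag S v \<subseteq> U"
  have vV: "v \<in> V" using v IW by blast
  show "bag S v \<subseteq> U" by fact
  show "pairwise (sysE S) (bag S v)" using bag_pairwise vV .
  fix D assume D: "D \<subseteq> U" "pairwise (sysE S) D" "bag S v \<subseteq> D"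
  have DV: "D \<subseteq> V" and fD: "finite D" using D U finW by (auto intro: finite_subset)
  have vD: "v \<in> D" using D(3) by (auto simp: bag_def)
  define t where "t = Max D"
  have t: "t \<in> D" "\<And>d. d \<in> D \<Longrightarrow> d \<le> t" using Max_in[OF fD] Max_ge[OF fD] vD unfolding t_def by blast+
  have Dt: "d \<in> S t" if "d \<in> D" "d \<noteq> t" for d
    using that t D(2) DV sysE_less[of d t] unfolding pairwise_def by (metis le_neq_implies_less subsetD)
  have "t = v"
  proof (rule ccontr)
    assume ne: "t \<noteq> v"
    have "t \<notin> bag S v"
    proof
      assume "t \<in> bag S v"
      then have "t < v" using ne Sless vV by (auto simp: bag_def)
      then show False using t(2)[OF vD] by simp
    qed
    then have "bag S v \<subseteq> S t" using D(3) Dt by blast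
    then show False using Mx v t(1) DV by blast
  qed
  then show "D = bag S v" using D(3) Dt by (auto simp: bag_def)
qed


end

context peo_sys begin

lemma sum_card_edges:
  assumes "K = {}"
  shows "(\<Sum>v\<in>W. card (S v)) = card {{u, v} | u v. u \<in> W \<and> v \<in> W \<and> sysE S u v}"
proof -
  have eq: "{{u, v} | u v. u \<in> W \<and> v \<in> W \<and> sysE S u v} = (\<lambda>(v, u). {u, v}) ` (SIGMA v:W. S v)"
    (is "?A = ?f ` ?P")
  proof
    show "?A \<subseteq> ?f ` ?P"
    proof
      fix e assume "e \<in> ?A"
      then obtain u v where uv: "e = {u, v}" "u \<in> W" "v \<in> W" "u \<in> S v \<or> v \<in> S u" by (auto simp: sysE_def)
      then have "(v, u) \<in> ?P \<and> ?f (v, u) = e \<or> (u, v) \<in> ?P \<and> ?f (u, v) = e" by auto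
      then show "e \<in> ?f ` ?P" by (metis image_eqI)
    qed
    show "?f ` ?P \<subseteq> ?A" using Ssub assms by (fastforce simp: sysE_def)
  qed
  have "inj_on ?f ?P"
  proof (rule inj_onI)
    fix p p' assume "p \<in> ?P" "p' \<in> ?P" and e: "?f p = ?f p'"
    then obtain v u v' u' where p: "p = (v, u)" "v \<in> W" "u \<in> S v" "p' = (v', u')" "v' \<in> W" "u' \<in> S v'" by blast
    have "u < v" "u' < v'" using Sless p by blast+
    moreover have "{u, v} = {u', v'}" using e p by simp
    ultimately show "p = p'" using p(1,4) by (auto simp: doubleton_eq_iff)
  qed
  then have "card (?f ` ?P) = card ?P" by (rule card_image)
  also have "\<dots> = (\<Sum>v\<in>W. card (S v))" using finW finS by (intro card_SigmaI) auto
  finally show ?thesis unfolding eq by simp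
qed

end

lemma (in bsys) inj_bag: "inj_on (bag S) I"
proof (rule inj_onI)
  fix u v assume uv: "u \<in> I" "v \<in> I" "bag S u = bag S v"
  show "u = v"
  proof (rule ccontr)
    assume "u \<noteq> v"
    moreover have "u \<in> bag S v" "v \<in> bag S u" using uv(3) by (metis insertI1 bag_def)+
    ultimately have "u \<in> S v" "v \<in> S u" unfolding bag_def by simp_all
    then have "u < v" "v < u" using Sless uv(1,2) IW by blast+
    then show False by simp
  qed
qed

lemma graph_bsys:
  fixes f :: "'a \<Rightarrow> nat"
  assumes fin: "finite V" and sym: "symp E" and irr: "\<And>v. v \<in> V \<Longrightarrow> \<not> E v v" and inj: "inj_on f V"
    and cl: "\<forall>v\<in>V. pairwise E {u \<in> V. E u v \<and> f u < f v}"
    and C: "\<And>B. B \<in> C \<Longrightarrow> maxclique V E B \<and> 4 \<le> card B"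
    and I: "I = {n \<in> f ` V. \<exists>B\<in>C. bag (ranked V E f) n = f ` B}"
  shows "bsys (f ` V) (ranked V E f) I"
    and "\<And>u v. u \<in> V \<Longrightarrow> v \<in> V \<Longrightarrow> sysE (ranked V E f) (f u) (f v) \<longleftrightarrow> E u v"
    and "bag (ranked V E f) ` I = image f ` C"
    and "(\<Sum>v\<in>f ` V. card (ranked V E f v)) = card {{u, v} | u v. u \<in> V \<and> v \<in> V \<and> E u v}"
proof -
  let ?S = "ranked V E f"
  have sys0: "peo_sys {} (f ` V) ?S {}"
    using ranked_sys[OF fin inj _ _ cl, of "{}"] by simp
  interpret s0: peo_sys "{}" "f ` V" ?S "{}" by (rule sys0)
  note at = ranked_at[OF inj, of _ E]
  have nS: "n \<notin> ?S n" for n by (auto simp: ranked_def)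
  have Icard: "3 \<le> card (?S n)" if n: "n \<in> I" for n
  proof -
    obtain B where B: "B \<in> C" "bag ?S n = f ` B" using n I by blast
    have "B \<subseteq> V" using C B by (auto simp: maxclique_def)
    then have "card (bag ?S n) = card B" using B(2) inj by (metis card_image inj_on_subset)
    moreover have "finite (?S n)" using n I s0.finS by blast
    ultimately show ?thesis using C[OF B(1)] nS[of n] by (simp add: bag_def)
  qed
  have Mx: "\<not> bag ?S n \<subseteq> ?S j" if n: "n \<in> I" "j \<in> f ` V" for n j
  proof -
    obtain B where B: "B \<in> C" "bag ?S n = f ` B" using n I by blast
    show ?thesis by (rule ranked_bag_maximal[OF sym inj _ B(2) n(2)]) (use C B(1) in blast)
  qed
  show bs: "bsys (f ` V) ?S I"
  proof (rule bsys.intro)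
    show "peo_sys {} (f ` V) ?S I"
    proof (rule peo_sys.intro)
      show "I \<subseteq> f ` V" using I by blast
    qed (fact s0.finK s0.finW s0.KW s0.Ssub s0.Sless s0.peo Icard)+
    show "bsys_axioms (f ` V) ?S I" by (rule bsys_axioms.intro) (rule Mx)
  qed
  show E: "sysE ?S (f u) (f v) \<longleftrightarrow> E u v" if uv: "u \<in> V" "v \<in> V" for u v
  proof -
    have "f u \<in> ?S (f v) \<longleftrightarrow> E u v \<and> f u < f v" "f v \<in> ?S (f u) \<longleftrightarrow> E v u \<and> f v < f u"
      using at uv inj by (auto simp: inj_on_def)
    moreover have "E u v = E v u" using sym unfolding symp_def by blast
    moreover have "E u v \<Longrightarrow> f u \<noteq> f v" using irr inj uv by (metis inj_onD)
    ultimately show ?thesis unfolding sysE_def by (meson linorder_neqE_nat)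
  qed
  show "bag ?S ` I = image f ` C"
  proof
    show "bag ?S ` I \<subseteq> image f ` C" using I by blast
    show "image f ` C \<subseteq> bag ?S ` I"
    proof
      fix X assume "X \<in> image f ` C"
      then obtain B where B: "B \<in> C" "X = f ` B" by blast
      have "maxclique V E B" "B \<noteq> {}" using C[OF B(1)] by auto
      then obtain t where t: "t \<in> B" "bag ?S (f t) = f ` B" using ranked_maxclique[OF fin sym inj cl] by blast
      have "B \<subseteq> V" using C[OF B(1)] by (auto simp: maxclique_def)
      then have "f t \<in> I" using t B I by blast
      then show "X \<in> bag ?S ` I" using t B(2) by (metis image_eqI)
    qed
  qed
  have "{{u, v} | u v. u \<in> f ` V \<and> v \<in> f ` V \<and> sysE ?S u v} = image f ` {{u, v} | u v. u \<in> V \<and> v \<in> V \<and> E u v}"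
    (is "?L = image f ` ?R")
  proof
    show "?L \<subseteq> image f ` ?R"
    proof
      fix e assume "e \<in> ?L"
      then obtain u v where "e = {f u, f v}" "u \<in> V" "v \<in> V" "E u v" using E by blast
      then have "e = f ` {u, v}" "{u, v} \<in> ?R" by auto
      then show "e \<in> image f ` ?R" by blast
    qed
    show "image f ` ?R \<subseteq> ?L"
    proof
      fix e assume "e \<in> image f ` ?R"
      then obtain u v where "e = f ` {u, v}" "u \<in> V" "v \<in> V" "E u v" by blast
      then have "e = {f u, f v}" "f u \<in> f ` V" "f v \<in> f ` V" "sysE ?S (f u) (f v)" using E by auto
      then show "e \<in> ?L" by blast
    qed
  qed
  moreover have "inj_on (image f) ?R"
    by (rule inj_on_subset[OF inj_on_image_Pow[OF inj]]) auto
  ultimately show "(\<Sum>v\<in>f ` V. card (?S v)) = card ?R"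
    using s0.sum_card_edges[OF refl] by (simp add: card_image)
qed

text \<open>The bound \<open>t \<le> 2 * (n - 1) / 7\<close>, except that four vertices may need a transversal of size one.\<close>

definition ok :: "nat \<Rightarrow> nat \<Rightarrow> bool" where
  "ok n t \<longleftrightarrow> (if n < 4 then t = 0 else if n = 4 then t \<le> 1 else 7 * t + 2 \<le> 2 * n)"

definition small_transversal :: "nat set \<Rightarrow> (nat \<Rightarrow> nat set) \<Rightarrow> nat set \<Rightarrow> bool" where
  "small_transversal V S I \<longleftrightarrow> (\<exists>T\<subseteq>V. transv S I T \<and> ok (card V) (card T))"

text \<open>Without a root the measure counts vertices, edges and required maximal cliques, none of
  which depends on the ranking. Hence minimality survives when any clique is moved to the
  front.\<close>

lemma (in bsys) reroot:
  assumes Q: "Q \<subseteq> V" "pairwise (sysE S) Q"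
  shows "\<exists>f V' S' I'. inj_on f V \<and> V' = f ` V \<and> bsys V' S' I' \<and>
    (\<forall>u\<in>V. \<forall>v\<in>V. sysE S' (f u) (f v) \<longleftrightarrow> sysE S u v) \<and> (\<forall>q\<in>Q. \<forall>w\<in>V - Q. f q < f w) \<and>
    (\<forall>X X' J. smaller X X' J V' S' I' \<longleftrightarrow> smaller X X' J V S I) \<and>
    (small_transversal V' S' I' \<longrightarrow> small_transversal V S I)"
proof -
  obtain f :: "nat \<Rightarrow> nat" where inj: "inj_on f V" and first: "\<forall>q\<in>Q. \<forall>w\<in>V - Q. f q < f w"
    and cl: "\<forall>v\<in>V. pairwise (sysE S) {u \<in> V. sysE S u v \<and> f u < f v}"
    using ranking_exists[OF finW symp_sysE dismantlable_sysE Q(2,1)] by blast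
  define S' where "S' = ranked V (sysE S) f"
  define I' where "I' = {n \<in> f ` V. \<exists>B\<in>bag S ` I. bag (ranked V (sysE S) f) n = f ` B}"
  have bV: "bag S v \<subseteq> V" if "v \<in> I" for v using that SV IW by (auto simp: bag_def)
  have C: "maxclique V (sysE S) B \<and> 4 \<le> card B" if B: "B \<in> bag S ` I" for B
  proof -
    obtain v where v: "v \<in> I" "B = bag S v" using B by blast
    have "v \<in> V" using v IW by blast
    then have "card B = Suc (card (S v))" unfolding v(2) bag_def using finS Sless by (intro card_insert_disjoint) blast+
    then show ?thesis using bag_maxclique[OF v(1) _ bV[OF v(1)]] Icard[OF v(1)] v(2) by simp
  qed
  note G = graph_bsys[OF finW symp_sysE sysE_irrefl inj cl C I'_def, folded S'_def]
  interpret b': bsys "f ` V" S' I' by (rule G(1))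
  have cV: "card (f ` V) = card V" using inj by (rule card_image)
  have cS: "(\<Sum>v\<in>f ` V. card (S' v)) = (\<Sum>v\<in>V. card (S v))"
    using G(4) sum_card_edges by simp
  have "inj_on (image f) (bag S ` I)"
    by (rule inj_on_subset[OF inj_on_image_Pow[OF inj]]) (use bV in blast)
  then have cI: "card I' = card I"
    using G(3) inj_bag b'.inj_bag by (metis card_image)
  have less: "smaller X X' J (f ` V) S' I' \<longleftrightarrow> smaller X X' J V S I" for X X' J
    unfolding smaller_def cV cS cI ..
  have st: "small_transversal V S I" if sm: "small_transversal (f ` V) S' I'"
  proof -
    obtain T where T: "T \<subseteq> f ` V" "transv S' I' T" "ok (card V) (card T)"
      using sm unfolding small_transversal_def cV by blast
    obtain T' where T': "T' \<subseteq> V" "T = f ` T'" using T(1) by (meson subset_imageE)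
    have "card T = card T'" using T' inj by (metis card_image inj_on_subset)
    moreover have "transv S I T'" unfolding transv_def
    proof
      fix v assume v: "v \<in> I"
      then have "f ` bag S v \<in> image f ` (bag S ` I)" by simp
      then have "f ` bag S v \<in> bag S' ` I'" using G(3) by metis
      then obtain n where n: "n \<in> I'" "bag S' n = f ` bag S v" by (metis imageE)
      have "bag S' n \<inter> T \<noteq> {}" using T(2) n(1) by (simp add: transv_def)
      then have "f ` bag S v \<inter> f ` T' \<noteq> {}" unfolding n(2) T'(2) .
      then obtain a b where ab: "a \<in> bag S v" "b \<in> T'" "f a = f b" by auto
      then have "a = b" using inj_onD[OF inj ab(3)] bV[OF v] T'(1) by blast
      then show "bag S v \<inter> T' \<noteq> {}" using ab by blast
    qed
    ultimately show ?thesis using T(3) T'(1) unfolding small_transversal_def by metis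
  qed
  then show ?thesis
    by (intro exI[of _ f] exI[of _ "f ` V"] exI[of _ S'] exI[of _ I'])
      (intro conjI refl inj G(1) first ballI allI impI less G(2) st)
qed


section \<open>Minimal unrooted counterexamples\<close>

lemma ok_mono: "ok n t \<Longrightarrow> s \<le> t \<Longrightarrow> ok n s"
  by (auto simp: ok_def split: if_splits)

lemma ok_add: "ok n t \<Longrightarrow> ok (n + m) t"
  by (auto simp: ok_def split: if_splits)

text \<open>The exceptional case \<open>n = 4\<close>, \<open>t = 1\<close> is tight: eight vertices
  allow exactly two.\<close>

lemma ok_four: "ok n t \<Longrightarrow> ok (n + 4) (t + 1)"
  by (auto simp: ok_def split: if_splits)

text \<open>Two purchases for seven vertices would do in the linear range, but not starting from
  \<open>n = 4\<close>, \<open>t = 1\<close>; nine vertices leave enough slack.\<close>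

lemma ok_nine: "ok n t \<Longrightarrow> ok (n + 9) (t + 2)"
  by (auto simp: ok_def split: if_splits)

lemma one_of_three:
  fixes f :: "nat \<Rightarrow> nat"
  assumes "7 * (\<Sum>i<3. f i) \<le> 6 * n" shows "\<exists>i<3. 21 * f i \<le> 6 * n"
proof (rule ccontr)
  assume "\<not> ?thesis"
  then have "\<forall>i<3. 6 * n < 21 * f i" by (meson not_le)
  then have "(\<Sum>i<3::nat. 6 * n) < (\<Sum>i<3. 21 * f i)" by (intro sum_strict_mono) (auto simp: lessThan_empty_iff)
  then have "18 * n < 21 * (\<Sum>i<3. f i)" by (simp add: sum_distrib_left)
  then show False using assms by linarith
qed

locale min_counterexample = bsys +
  assumes nost: "\<not> small_transversal V S I"
    and IH: "bsys V' S' I' \<Longrightarrow> smaller V' S' I' V S I \<Longrightarrow> small_transversal V' S' I'"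
begin

abbreviation "lf x \<equiv> leaf V S x"

lemma no_change:
  assumes sys: "bsys V' S' I'" and less: "smaller V' S' I' V S I"
    and ext: "\<And>T. T \<subseteq> V' \<Longrightarrow> transv S' I' T \<Longrightarrow> \<exists>T2\<subseteq>V. transv S I T2 \<and> card T2 \<le> card T + e"
    and num: "\<And>t. ok (card V') t \<Longrightarrow> ok (card V) (t + e)"
  shows False
proof -
  obtain T where T: "T \<subseteq> V'" "transv S' I' T" "ok (card V') (card T)"
    using IH[OF sys less] unfolding small_transversal_def by blast
  obtain T2 where T2: "T2 \<subseteq> V" "transv S I T2" "card T2 \<le> card T + e" using ext[OF T(1,2)] by blast
  have "ok (card V) (card T2)" using ok_mono[OF num[OF T(3)] T2(3)] .
  then show False using nost T2(1,2) unfolding small_transversal_def by blast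
qed

lemma smaller_sub: "V' \<subseteq> V \<Longrightarrow> V' \<noteq> V \<Longrightarrow> smaller V' S' I' V S I"
  unfolding smaller_def using finW by (simp add: psubset_card_mono psubsetI)

lemma sub_bsys:
  assumes "X \<subseteq> V"
  shows "bsys (V - X) (\<lambda>v. S v - X) {v \<in> I. bag S v \<inter> X = {}}"
proof (rule bsys.intro)
  have eq: "S v - X = S v" "v \<notin> X" if "bag S v \<inter> X = {}" for v using that by (auto simp: bag_def)
  show "peo_sys {} (V - X) (\<lambda>v. S v - X) {v \<in> I. bag S v \<inter> X = {}}"
  proof (rule peo_sys.intro)
    show "finite {}" "finite (V - X)" using finW by auto
    show "S v - X \<subseteq> {} \<union> (V - X)" if "v \<in> V - X" for v using that SV by blast
    show "u < v" if "v \<in> V - X" "u \<in> S v - X" for u v using that Sless by blast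
    show "a \<in> S b - X" if "v \<in> V - X" "a \<in> S v - X" "b \<in> S v - X" "b \<in> V - X" "a < b" for v a b
      using that peo by blast
    show "{v \<in> I. bag S v \<inter> X = {}} \<subseteq> V - X" using IW eq by blast
    show "3 \<le> card (S v - X)" if "v \<in> {v \<in> I. bag S v \<inter> X = {}}" for v
      using that eq Icard by simp
  qed auto
  show "bsys_axioms (V - X) (\<lambda>v. S v - X) {v \<in> I. bag S v \<inter> X = {}}"
  proof (rule bsys_axioms.intro)
    fix v j assume v: "v \<in> {v \<in> I. bag S v \<inter> X = {}}" and j: "j \<in> V - X"
    have e: "bag (\<lambda>v. S v - X) v = bag S v" unfolding bag_def using v eq(1)[of v] by simp
    have "\<not> bag S v \<subseteq> S j" by (rule Mx) (use v j in auto)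
    then show "\<not> bag (\<lambda>v. S v - X) v \<subseteq> S j - X" unfolding e by blast
  qed
qed

lemma no_del:
  assumes X: "X \<subseteq> V" "X \<noteq> {}" and A: "A \<subseteq> V"
    and hit: "\<And>v. v \<in> I \<Longrightarrow> bag S v \<inter> X \<noteq> {} \<Longrightarrow> bag S v \<inter> A \<noteq> {}"
    and num: "\<And>t. ok (card V - card X) t \<Longrightarrow> ok (card V) (t + card A)"
  shows False
proof (rule no_change[OF sub_bsys[OF X(1)]])
  let ?I = "{v \<in> I. bag S v \<inter> X = {}}"
  show "smaller (V - X) (\<lambda>v. S v - X) ?I V S I" by (rule smaller_sub) (use X in blast)+
  show "ok (card V) (t + card A)" if "ok (card (V - X)) t" for t
    using that num X(1) finW by (simp add: card_Diff_subset finite_subset)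
  fix T assume T: "T \<subseteq> V - X" "transv (\<lambda>v. S v - X) ?I T"
  have "transv S I (T \<union> A)" unfolding transv_def
  proof
    fix v assume v: "v \<in> I"
    show "bag S v \<inter> (T \<union> A) \<noteq> {}"
    proof (cases "bag S v \<inter> X = {}")
      case True
      then have "bag (\<lambda>v. S v - X) v \<inter> T \<noteq> {}" using T(2) v unfolding transv_def by blast
      moreover have "bag (\<lambda>v. S v - X) v \<subseteq> bag S v" by (auto simp: bag_def)
      ultimately show ?thesis by blast
    next
      case False then show ?thesis using hit[OF v] by blast
    qed
  qed
  moreover have "T \<union> A \<subseteq> V" using T A by blast
  moreover have "card (T \<union> A) \<le> card T + card A" by (rule card_Un_le)
  ultimately show "\<exists>T2\<subseteq>V. transv S I T2 \<and> card T2 \<le> card T + card A" by blast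
qed

lemma num_split: "X \<subseteq> V \<Longrightarrow> (\<And>n. ok n t \<Longrightarrow> ok (n + card X) s) \<Longrightarrow> ok (card V - card X) t \<Longrightarrow> ok (card V) s"
proof -
  assume X: "X \<subseteq> V" and h: "\<And>n. ok n t \<Longrightarrow> ok (n + card X) s" and k: "ok (card V - card X) t"
  have "card X \<le> card V" by (rule card_mono[OF finW X])
  then show "ok (card V) s" using h[OF k] by simp
qed

lemma dominated_card:
  assumes v: "v \<in> V" and X: "X \<subseteq> V" "v \<notin> X"
    and dom: "\<And>w i. w \<in> X \<Longrightarrow> i \<in> I \<Longrightarrow> w \<in> bag S i \<Longrightarrow> v \<in> bag S i"
  shows "card X \<le> 2"
proof (rule ccontr)
  assume "\<not> card X \<le> 2"
  then have "3 \<le> card X" by simp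
  \<comment> \<open>Exactly three vertices of \<open>X\<close> are used, so that the deletion is the
    exchange of four vertices for one.\<close>
  then obtain Y where Y: "Y \<subseteq> X" "card Y = 3" "finite Y" by (rule obtain_subset_with_card_n)
  have "v \<notin> Y" using Y(1) X(2) by blast
  then have c: "card (insert v Y) = 4" using Y(2,3) by simp
  have sub: "insert v Y \<subseteq> V" using Y X v by blast
  show False
  proof (rule no_del[OF sub, of "{v}"])
    show "bag S i \<inter> {v} \<noteq> {}" if "i \<in> I" "bag S i \<inter> insert v Y \<noteq> {}" for i
      using that dom Y(1) by blast
    show "ok (card V) (t + card {v})" if "ok (card V - card (insert v Y)) t" for t
      by (rule num_split[OF sub _ that]) (use c ok_four in simp)
  qed (use v in auto)
qed

lemma leaf_in_I: "lf x \<Longrightarrow> x \<in> I"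
proof (rule ccontr)
  assume x: "lf x" "x \<notin> I"
  have xV: "{x} \<subseteq> V" using leafD x by blast
  show False
  proof (rule no_del[OF xV, of "{}"])
    show "bag S v \<inter> {} \<noteq> {}" if "v \<in> I" "bag S v \<inter> {x} \<noteq> {}" for v
      using leaf_bag[OF x(1), of v] that x(2) IW by blast
    show "ok (card V) (t + card {})" if "ok (card V - card {x}) t" for t
      by (rule num_split[OF xV _ that]) (simp add: ok_add del: add_Suc_right)
  qed auto
qed

text \<open>Compared with the rooted case, maximality of required bags has to survive as well.
  Shrinking the bag of a required \<open>v\<close> is harmless when \<open>v\<close> is a leaf, as
  \<open>v\<close> then lies in no set \<open>S j\<close>.\<close>

lemma unsupported_edge:
  assumes v: "v \<in> V" "y \<in> S v" and uns: "\<And>j. j \<in> V \<Longrightarrow> v \<in> S j \<Longrightarrow> y \<notin> S j"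
    and vI: "v \<in> I \<Longrightarrow> lf v \<and> 4 \<le> card (S v)"
  shows False
proof -
  define S' where "S' = S(v := S v - {y})"
  have sub: "S' w \<subseteq> S w" for w unfolding S'_def by auto
  have oth: "w \<noteq> v \<Longrightarrow> S' w = S w" for w unfolding S'_def by simp
  have sys: "bsys V S' I"
  proof (rule bsys.intro)
    show "peo_sys {} V S' I"
    proof (rule peo_sys.intro)
      show "S' v \<subseteq> {} \<union> V" if "v \<in> V" for v using that SV sub by blast
      show "u < v" if "v \<in> V" "u \<in> S' v" for u v using that Sless sub by blast
      show "a \<in> S' b" if j: "j \<in> V" "a \<in> S' j" "b \<in> S' j" "b \<in> V" "a < b" for j a b
      proof -
        have "a \<in> S b" using j sub peo by blast
        moreover have "\<not> (b = v \<and> a = y)" using j sub uns by blast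
        ultimately show ?thesis unfolding S'_def by auto
      qed
      show "3 \<le> card (S' w)" if "w \<in> I" for w
      proof (cases "w = v")
        case True
        then have "4 \<le> card (S v)" using vI that by blast
        moreover have "S' w = S v - {y}" using True by (simp add: S'_def)
        ultimately show ?thesis using v(2) finS[OF v(1)] by (simp add: card_Diff_singleton)
      qed (use Icard[OF that] oth in simp)
    qed (use finW IW in auto)
    show "bsys_axioms V S' I"
    proof (rule bsys_axioms.intro)
      fix u j assume u: "u \<in> I" and j: "j \<in> V"
      show "\<not> bag S' u \<subseteq> S' j"
      proof (cases "u = v")
        case True
        then have "lf u" using vI u by blast
        then have "u \<notin> S' j" using leafD(2) j sub by blast
        moreover have "u \<in> bag S' u" by (simp add: bag_def)
        ultimately show ?thesis by blast
      next
        case False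
        then have "bag S' u = bag S u" using oth by (simp add: bag_def)
        then show ?thesis using Mx[OF u j] sub[of j] by auto
      qed
    qed
  qed
  have "(\<Sum>w\<in>V. card (S' w)) < (\<Sum>w\<in>V. card (S w))"
  proof (rule sum_strict_mono_ex1)
    show "finite V" by (rule finW)
    show "\<forall>x\<in>V. card (S' x) \<le> card (S x)" using sub finS by (meson card_mono)
    show "\<exists>a\<in>V. card (S' a) < card (S a)"
      by (rule bexI[of _ v]) (use v finS[OF v(1)] in \<open>simp_all add: S'_def card_Diff1_less del: card_Diff_insert\<close>)
  qed
  then have less: "smaller V S' I V S I" unfolding smaller_def by simp
  show False
  proof (rule no_change[OF sys less, of 0])
    fix T assume T: "T \<subseteq> V" "transv S' I T"
    have "bag S' w \<subseteq> bag S w" for w using sub by (auto simp: bag_def)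
    then have "transv S I T" using T(2) unfolding transv_def by blast
    then show "\<exists>T2\<subseteq>V. transv S I T2 \<and> card T2 \<le> card T + 0" using T(1) by auto
  qed simp
qed

lemma leaf_card: "lf x \<Longrightarrow> card (S x) = 3"
proof (rule ccontr)
  assume x: "lf x" "card (S x) \<noteq> 3"
  have "3 \<le> card (S x)" using Icard leaf_in_I x by blast
  then have c: "4 \<le> card (S x)" using x(2) by simp
  then obtain y where "y \<in> S x" by fastforce
  then show False using unsupported_edge[of x y] x c leafD by blast
qed

lemma supported: "v \<in> V \<Longrightarrow> v \<notin> I \<Longrightarrow> y \<in> S v \<Longrightarrow> \<exists>j\<in>V. v \<in> S j \<and> y \<in> S j"
  using unsupported_edge by blast

lemma no_drop:
  assumes v: "v \<in> I"
    and ext: "\<And>T. T \<subseteq> V \<Longrightarrow> transv S (I - {v}) T \<Longrightarrow> \<exists>T2\<subseteq>V. transv S I T2 \<and> card T2 \<le> card T"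
  shows False
proof -
  have finI: "finite I" using IW finW by (auto intro: finite_subset)
  have sys: "bsys V S (I - {v})"
  proof (rule bsys.intro)
    show "peo_sys {} V S (I - {v})"
    proof (rule peo_sys.intro)
      show "I - {v} \<subseteq> V" using IW by blast
      show "3 \<le> card (S w)" if "w \<in> I - {v}" for w using that Icard by blast
    qed (fact finK finW KW Ssub Sless peo)+
    show "bsys_axioms V S (I - {v})" by (rule bsys_axioms.intro) (use Mx in blast)
  qed
  have "smaller V S (I - {v}) V S I"
    using card_Diff1_less[OF finI v] unfolding smaller_def by simp
  then show False by (rule no_change[OF sys _ _, of 0]) (use ext in auto)
qed

lemma no_leaf_in_bag:
  assumes v: "v \<in> I" "\<not> lf v" and x: "lf x" "S x \<subseteq> bag S v"
  shows False
proof -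
  have xI: "x \<in> I" using leaf_in_I x(1) by blast
  have xV: "x \<in> V" using xI IW by blast
  have "S x \<noteq> {}" using leaf_card[OF x(1)] by auto
  then obtain s where s: "s \<in> S x" "s \<in> V" using SV[OF xV] by blast
  have xv: "x \<noteq> v" using v x by blast
  show False
  proof (rule no_drop[OF v(1)])
    fix T assume T: "T \<subseteq> V" "transv S (I - {v}) T"
    have hx: "bag S x \<inter> T \<noteq> {}" using T(2) xI xv unfolding transv_def by blast
    show "\<exists>T2\<subseteq>V. transv S I T2 \<and> card T2 \<le> card T"
    proof (cases "S x \<inter> T = {}")
      case False
      then have "transv S I T" using T(2) x(2) unfolding transv_def by blast
      then show ?thesis using T(1) by blast
    next
      case True
      then have xT: "x \<in> T" using hx unfolding bag_def by blast
      define T2 where "T2 = insert s (T - {x})"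
      have finT: "finite T" using T(1) finW by (auto intro: finite_subset)
      have "card T2 \<le> Suc (card (T - {x}))" unfolding T2_def using finT by (simp add: card_insert_if)
      also have "\<dots> = card T" by (rule card_Suc_Diff1[OF finT xT])
      finally have "card T2 \<le> card T" .
      moreover have "T2 \<subseteq> V" using T(1) s(2) unfolding T2_def by blast
      moreover have "transv S I T2" unfolding transv_def
      proof
        fix w assume w: "w \<in> I"
        consider "w = v" | "w = x" | "w \<noteq> v" "w \<noteq> x" by blast
        then show "bag S w \<inter> T2 \<noteq> {}"
        proof cases
          case 1 then show ?thesis using s x(2) unfolding T2_def by blast
        next
          case 2 then show ?thesis using s unfolding T2_def bag_def by blast
        next
          case 3
          then have "x \<notin> bag S w" using leaf_bag[OF x(1)] w IW by blast
          moreover have "bag S w \<inter> T \<noteq> {}" using T(2) w 3 unfolding transv_def by blast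
          ultimately show ?thesis unfolding T2_def by blast
        qed
      qed
      ultimately show ?thesis by blast
    qed
  qed
qed

lemma leaf_nbr_nonleaf: "lf x \<Longrightarrow> w \<in> S x \<Longrightarrow> \<not> lf w"
  unfolding leaf_def by blast

lemma leaves_dominated: "lf x \<Longrightarrow> v \<in> S x \<Longrightarrow> i \<in> I \<Longrightarrow> x \<in> bag S i \<Longrightarrow> v \<in> bag S i"
  using leaf_bag[of x i] IW unfolding bag_def by blast

lemma card_leaves_at: "v \<in> V \<Longrightarrow> card (leaves_at V S v) \<le> 2"
  by (rule dominated_card[of v]) (use leaves_dominated in \<open>auto simp: leaves_at_def leaf_def\<close>)

lemma finite_leaves_at: "finite (leaves_at V S v)"
  by (rule finite_subset[OF _ finW]) (auto simp: leaves_at_def leaf_def)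

lemma three_leaves: "v \<in> V \<Longrightarrow> lf x \<Longrightarrow> lf y \<Longrightarrow> lf z \<Longrightarrow> v \<in> S x \<Longrightarrow> v \<in> S y \<Longrightarrow> v \<in> S z \<Longrightarrow>
  x \<noteq> y \<Longrightarrow> y \<noteq> z \<Longrightarrow> x \<noteq> z \<Longrightarrow> False"
proof -
  assume a: "v \<in> V" "lf x" "lf y" "lf z" "v \<in> S x" "v \<in> S y" "v \<in> S z" "x \<noteq> y" "y \<noteq> z" "x \<noteq> z"
  then have "{x, y, z} \<subseteq> leaves_at V S v" by (simp add: leaves_at_def)
  then have "card {x, y, z} \<le> card (leaves_at V S v)" by (rule card_mono[OF finite_leaves_at])
  then show False using a card_leaves_at[of v] by simp
qed

lemma leaves_at_cases:
  assumes "v \<in> V" "lf x" "v \<in> S x"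
  obtains "leaves_at V S v = {x}" | z where "z \<noteq> x" "lf z" "v \<in> S z" "leaves_at V S v = {x, z}"
proof -
  have "x \<in> leaves_at V S v" using assms by (simp add: leaves_at_def)
  from finite_card2_ex[OF finite_leaves_at this card_leaves_at[OF assms(1)]] show ?thesis
  proof
    assume "\<exists>b. b \<noteq> x \<and> leaves_at V S v = {x, b}"
    then obtain z where z: "z \<noteq> x" "leaves_at V S v = {x, z}" by blast
    then have "z \<in> leaves_at V S v" by blast
    then show ?thesis using that(2)[of z] z by (simp add: leaves_at_def)
  qed (rule that(1))
qed

lemma leaves_atD: "lf i \<Longrightarrow> v \<in> S i \<Longrightarrow> leaves_at V S v = A \<Longrightarrow> i \<in> A"
  by (auto simp: leaves_at_def)

text \<open>On at most four vertices a required bag is the whole vertex set, and one vertex meets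
  it; this is what the exceptional value in \<open>ok\<close> is for.\<close>

lemma large: "5 \<le> card V"
proof (rule ccontr)
  assume "\<not> 5 \<le> card V"
  then have le: "card V \<le> 4" by simp
  have bag: "bag S v = V \<and> card V = 4" if v: "v \<in> I" for v
  proof -
    have vV: "v \<in> V" using v IW by blast
    have "card (bag S v) = Suc (card (S v))"
      unfolding bag_def using finS[OF vV] Sless[OF vV] by (intro card_insert_disjoint) auto
    moreover have sub: "bag S v \<subseteq> V" using SV vV by (simp add: bag_def)
    moreover have "card (bag S v) \<le> card V" by (rule card_mono[OF finW sub])
    ultimately show ?thesis using Icard[OF v] le finW card_subset_eq[OF finW sub] by linarith
  qed
  have "small_transversal V S I"
  proof (cases "I = {}")
    case True
    then show ?thesis using le unfolding small_transversal_def
      by (intro exI[of _ "{}"]) (simp add: transv_def ok_def)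
  next
    case False
    then obtain v where v: "v \<in> I" by blast
    have "transv S I {v}" unfolding transv_def
    proof
      fix u assume "u \<in> I"
      then have "bag S u = V" using bag by blast
      then show "bag S u \<inter> {v} \<noteq> {}" using v IW by auto
    qed
    then show ?thesis using bag[OF v] v IW unfolding small_transversal_def
      by (intro exI[of _ "{v}"]) (auto simp: ok_def)
  qed
  then show False using nost by simp
qed

text \<open>The clique \<open>S x\<close> of a leaf is moved to the front. Since \<open>x\<close>
  has no other neighbours, all of its neighbours still precede it and it remains a leaf.\<close>

lemma rooted_exists:
  "\<exists>V' S' I' x. min_counterexample V' S' I' \<and> leaf V' S' x \<and> (\<forall>k\<in>S' x. \<forall>w\<in>V' - S' x. k < w)"
proof -
  have V: "V \<noteq> {}" using large by auto
  define x where "x = Max V"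
  have xV: "x \<in> V" using V finW by (simp add: x_def)
  have x: "lf x" unfolding leaf_def
  proof (intro conjI ballI xV notI)
    fix j assume "j \<in> V" "x \<in> S j"
    then have "x < j" "j \<le> x" using Sless finW by (auto simp: x_def)
    then show False by simp
  qed
  have "pairwise (sysE S) (S x)" using bag_pairwise[OF xV] by (rule pairwise_subset) (auto simp: bag_def)
  from reroot[OF SV[OF xV] this] obtain f V' S' I' where
    f: "inj_on f V" "V' = f ` V" and b: "bsys V' S' I'"
    and E: "\<forall>u\<in>V. \<forall>v\<in>V. sysE S' (f u) (f v) \<longleftrightarrow> sysE S u v" and first: "\<forall>q\<in>S x. \<forall>w\<in>V - S x. f q < f w"
    and less: "\<forall>X X' J. smaller X X' J V' S' I' \<longleftrightarrow> smaller X X' J V S I"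
    and st: "small_transversal V' S' I' \<longrightarrow> small_transversal V S I" by blast
  have crit: "min_counterexample V' S' I'"
    by (rule min_counterexample.intro[OF b], rule min_counterexample_axioms.intro) (use nost st IH less in metis)+
  interpret b': bsys V' S' I' by (rule b)
  have xS: "x \<notin> S x" using Sless[OF xV] by blast
  have Ex: "w \<in> S x" if "w \<in> V" "sysE S' (f x) (f w)" for w
    using that E xV leafD(2)[OF x] unfolding sysE_def by metis
  have lx: "leaf V' S' (f x)" unfolding leaf_def
  proof (intro conjI ballI notI)
    show "f x \<in> V'" using f xV by simp
    fix j assume j: "j \<in> V'" "f x \<in> S' j"
    obtain w where w: "w \<in> V" "j = f w" using j f by blast
    have "w \<in> S x" by (rule Ex[OF w(1)]) (use j w in \<open>simp add: sysE_def\<close>)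
    then have "f w < f x" using first xV xS by blast
    then show False using b'.Sless[OF j] w by simp
  qed
  have Sx: "S' (f x) = f ` S x"
  proof
    show "S' (f x) \<subseteq> f ` S x"
    proof
      fix u assume u: "u \<in> S' (f x)"
      then have "u \<in> V'" using b'.SV f xV by blast
      then obtain w where w: "w \<in> V" "u = f w" using f by blast
      have "w \<in> S x" by (rule Ex[OF w(1)]) (use u w in \<open>simp add: sysE_def\<close>)
      then show "u \<in> f ` S x" using w by blast
    qed
    show "f ` S x \<subseteq> S' (f x)"
    proof
      fix u assume "u \<in> f ` S x"
      then obtain w where w: "w \<in> S x" "u = f w" by blast
      have wV: "w \<in> V" using w SV xV by blast
      have "sysE S' (f w) (f x)" using E wV xV w unfolding sysE_def by blast
      moreover have "f w < f x" using first w xV xS by blast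
      ultimately show "u \<in> S' (f x)" using b'.sysE_less[of "f w" "f x"] f wV xV w by blast
    qed
  qed
  have "\<forall>k\<in>S' (f x). \<forall>w\<in>V' - S' (f x). k < w" unfolding Sx f(2) using first by blast
  then show ?thesis using crit lx by blast
qed

end

text \<open>The initial segment \<open>S x0\<close> is a reserve far from the last branching. When
  it serves as a root, \<open>x0\<close> can be deleted too, because any root vertex meets its
  bag.\<close>

locale rooted_min_counterexample = min_counterexample +
  fixes x0
  assumes x0: "leaf V S x0" and first: "k \<in> S x0 \<Longrightarrow> w \<in> V \<Longrightarrow> w \<notin> S x0 \<Longrightarrow> k < w"
begin

lemma x0V: "x0 \<in> V" "S x0 \<subseteq> V" using x0 leafD(1) SV by blast+

lemma root_down: "k \<in> S x0 \<Longrightarrow> w \<in> V \<Longrightarrow> w \<le> k \<Longrightarrow> w \<in> S x0"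
  using first by (meson leD)

lemma root_S: assumes "k \<in> S x0" shows "S k \<subseteq> S x0 - {k}"
proof
  fix s assume s: "s \<in> S k"
  have kV: "k \<in> V" using assms x0V by blast
  have "s < k" "s \<in> V" using Sless[OF kV s] SV[OF kV] s by auto
  then show "s \<in> S x0 - {k}" using root_down[OF assms] by simp
qed

lemma root_card: assumes "k \<in> S x0" shows "card (S k) \<le> 2"
proof -
  have "card (S k) \<le> card (S x0 - {k})" by (rule card_mono[OF _ root_S[OF assms]]) (use finS x0V in blast)
  then show ?thesis using assms leaf_card[OF x0] by simp
qed

lemma root_not_I: "k \<in> S x0 \<Longrightarrow> k \<notin> I"
  using root_card Icard by fastforce

text \<open>With three earlier neighbours, maximality leaves \<open>S d\<close> at most three
  vertices, so the dichotomy for the region below \<open>d\<close> applies, with an empty outer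
  root. The four vertices of \<open>bag S u\<close> and \<open>x0\<close> survive the deletion,
  which keeps the rest in the linear range of \<open>ok\<close>.\<close>

lemma nonleaf_required_card:
  assumes u: "u \<in> I" "\<not> lf u" shows "4 \<le> card (S u)"
proof (rule ccontr)
  assume "\<not> 4 \<le> card (S u)"
  then have c3: "card (S u) = 3" using Icard[OF u(1)] by simp
  have uV: "u \<in> V" using u IW by blast
  obtain d where d: "d \<in> V" "u \<in> S d" "\<forall>s\<in>S d. s \<le> u" using child_exists[OF uV u(2)] by blast
  define O' where "O' = insert d (Des V S d)"
  have OV: "O' \<subseteq> V" using d Des_sub O'_def by blast
  have finO: "finite O'" using OV finW by (auto intro: finite_subset)
  have fb: "finite (bag S u)" using finS[OF uV] by (simp add: bag_def)
  have cb: "card (bag S u) = 4"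
    using c3 finS[OF uV] Sless[OF uV] unfolding bag_def by (subst card_insert_disjoint) auto
  have "S d \<subset> bag S u" using child_bag[OF uV d] Mx[OF u(1) d(1)] by blast
  then have cd: "card (S d) \<le> 3" using psubset_card_mono[OF fb, of "S d"] cb by simp
  have R: "good (S d) c' O' S (I \<inter> O')" if "inj_on c' (S d)" "c' ` S d \<subseteq> {..<3}" for c'
    using rooted_good[OF region_sys[OF d(1)] that] unfolding O'_def .
  have uroot: "u \<notin> S x0" using root_not_I u(1) by blast
  have below: "u < w" if "w \<in> O'" for w
    using that Sless[OF d(1,2)] Des_gt[of w d] unfolding O'_def by auto
  have x0O: "x0 \<notin> O'"
  proof
    assume a: "x0 \<in> O'"
    then have "\<exists>w\<in>S x0. u \<le> w"
    proof (cases "x0 = d")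
      case True then show ?thesis using d(2) by blast
    next
      case False
      then have "x0 \<in> Des V S d" using a O'_def by blast
      then obtain w where "w \<in> S x0" "d \<le> w" using Des_last_ge by blast
      then show ?thesis using below[of d] O'_def by (meson insertI1 le_trans less_imp_le)
    qed
    then show False using root_down uV uroot by blast
  qed
  have x0b: "x0 \<notin> bag S u" using u(2) x0 leafD(2)[OF x0 uV] by (auto simp: bag_def)
  have bO: "bag S u \<inter> O' = {}"
  proof (rule ccontr)
    assume "bag S u \<inter> O' \<noteq> {}"
    then obtain w where w: "w \<in> bag S u" "w \<in> O'" by blast
    then have "w \<le> u" using Sless[OF uV, of w] by (auto simp: bag_def)
    then show False using below[OF w(2)] by simp
  qed
  have five: "card O' + 5 \<le> card V"
  proof -
    have "card (insert x0 (bag S u)) = 5" using x0b fb cb by simp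
    moreover have "insert x0 (bag S u) \<subseteq> V - O'" using x0V x0O bO SV[OF uV] uV by (auto simp: bag_def)
    ultimately have "5 \<le> card (V - O')" using card_mono[of "V - O'" "insert x0 (bag S u)"] finW by simp
    then show ?thesis using card_Diff_subset[OF finO OV] card_mono[OF finW OV] by simp
  qed
  have c0: "inj_on (\<lambda>_::nat. 0::nat) {}" "(\<lambda>_::nat. 0::nat) ` {} \<subseteq> {..<3}" by auto
  from region_redundant_or_paid[OF u(1) d cd c0 O'_def R] show False
  proof
    assume "\<forall>i U. i < 3 \<longrightarrow> U \<subseteq> V \<longrightarrow> transv S (I - {u}) (U \<union> root_colour (\<lambda>_. 0::nat) {} i) \<longrightarrow>
             (\<exists>U2\<subseteq>V. transv S I (U2 \<union> root_colour (\<lambda>_. 0::nat) {} i) \<and> card U2 \<le> card U)"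
    then have "\<exists>U2\<subseteq>V. transv S I (U2 \<union> {}) \<and> card U2 \<le> card U"
      if "U \<subseteq> V" "transv S (I - {u}) (U \<union> {})" for U
      using that \<open>\<forall>i U. _\<close>[rule_format, of 0 U] unfolding root_colour_def by simp
    then have "\<exists>U2\<subseteq>V. transv S I U2 \<and> card U2 \<le> card U" if "U \<subseteq> V" "transv S (I - {u}) U" for U
      using that unfolding Un_empty_right .
    then show False using no_drop[OF u(1)] by metis
  next
    assume "\<exists>A. (\<forall>i<3. A i \<subseteq> O' \<and> (\<forall>v\<in>I \<inter> O'. bag S v \<inter> (A i \<union> root_colour (\<lambda>_. 0::nat) {} i) \<noteq> {})) \<and>
             7 * (\<Sum>i<3. card (A i)) \<le> 6 * card O'"
    then obtain A :: "nat \<Rightarrow> nat set" where A: "\<And>i. i < 3 \<Longrightarrow> A i \<subseteq> O' \<and> (\<forall>v\<in>I \<inter> O'. bag S v \<inter> A i \<noteq> {})"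
      "7 * (\<Sum>i<3. card (A i)) \<le> 6 * card O'" unfolding root_colour_def by auto
    have "\<exists>i<3. 7 * card (A i) \<le> 2 * card O'" using one_of_three[OF A(2)] by auto
    then obtain i where i: "i < 3" "7 * card (A i) \<le> 2 * card O'" by blast
    show False
    proof (rule no_del[OF OV, of "A i"])
      show "O' \<noteq> {}" by (simp add: O'_def)
      show "A i \<subseteq> V" using A(1)[OF i(1)] OV by blast
      show "bag S v \<inter> A i \<noteq> {}" if v: "v \<in> I" "bag S v \<inter> O' \<noteq> {}" for v
      proof -
        have "v \<in> O'" using region_closed[of _ d v] v IW unfolding O'_def by blast
        then show ?thesis using A(1)[OF i(1)] v(1) by blast
      qed
      show "ok (card V) (t + card (A i))" if t: "ok (card V - card O') t" for t
      proof -
        have "7 * t + 2 \<le> 2 * (card V - card O')" using t five by (simp add: ok_def split: if_splits)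
        then show ?thesis using i(2) five by (simp add: ok_def)
      qed
    qed
  qed
qed

end


section \<open>Vertices below leaves only\<close>

text \<open>Giving \<open>b\<close> and \<open>c\<close> one colour costs a colour only in a clique
  containing both, and such a clique has a fifth vertex to compensate.\<close>

lemma merged_colours_card:
  fixes k :: "'a \<Rightarrow> nat"
  assumes fin: "finite B" "finite Q" and B: "4 \<le> card B" and Q: "b \<in> Q" "c \<in> Q" "b \<noteq> c" "card Q \<le> 4"
    and inj: "inj_on k (Q - {b})" "inj_on k (Q - {c})"
    and five: "b \<in> B \<Longrightarrow> c \<in> B \<Longrightarrow> 5 \<le> card B"
  shows "\<not> B \<subseteq> Q \<and> 4 \<le> card (B - Q) + card (k ` (B \<inter> Q))"
proof
  show "\<not> B \<subseteq> Q"
  proof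
    assume "B \<subseteq> Q"
    then have "B = Q" using fin B Q(4) by (meson card_seteq le_trans)
    then show False using five Q by auto
  qed
  have c1: "card B = card (B - Q) + card (B \<inter> Q)" using fin by (metis Int_commute card_Int_Diff add.commute)
  show "4 \<le> card (B - Q) + card (k ` (B \<inter> Q))"
  proof (cases "b \<in> B \<and> c \<in> B")
    case False
    then have "B \<inter> Q \<subseteq> Q - {b} \<or> B \<inter> Q \<subseteq> Q - {c}" by blast
    then have "inj_on k (B \<inter> Q)" using inj inj_on_subset by metis
    then have "card (k ` (B \<inter> Q)) = card (B \<inter> Q)" by (rule card_image)
    then show ?thesis using c1 B by simp
  next
    case True
    have "inj_on k (B \<inter> Q - {b})" using inj(1) by (rule inj_on_subset) blast
    then have "card (k ` (B \<inter> Q - {b})) = card (B \<inter> Q - {b})" by (rule card_image)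
    moreover have "card (k ` (B \<inter> Q - {b})) \<le> card (k ` (B \<inter> Q))" using fin by (intro card_mono) auto
    moreover have "card (B \<inter> Q - {b}) = card (B \<inter> Q) - 1" using True Q(1) by simp
    ultimately show ?thesis using c1 five True by linarith
  qed
qed

context rooted_min_counterexample begin

definition lev1 :: "nat \<Rightarrow> bool" where
  "lev1 r \<longleftrightarrow> r \<in> V \<and> \<not> lf r \<and> (\<forall>j\<in>V. r \<in> S j \<longrightarrow> lf j)"

lemma lev1D: "lev1 r \<Longrightarrow> r \<in> V" "lev1 r \<Longrightarrow> \<not> lf r" "lev1 r \<Longrightarrow> j \<in> V \<Longrightarrow> r \<in> S j \<Longrightarrow> lf j"
  unfolding lev1_def by blast+

lemma lev1_top: "lev1 r \<Longrightarrow> lf x \<Longrightarrow> r \<in> S x \<Longrightarrow> s \<in> S x \<Longrightarrow> s \<le> r"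
proof (rule ccontr)
  assume a: "lev1 r" "lf x" "r \<in> S x" "s \<in> S x" "\<not> s \<le> r"
  have xV: "x \<in> V" using a(2) leafD by blast
  have sV: "s \<in> V" using SV[OF xV] a(4) by blast
  have "r \<in> S s" using peo[OF xV a(3,4) sV] a(5) by simp
  then have "lf s" using lev1D(3)[OF a(1) sV] by blast
  then show False using leaf_nbr_nonleaf[OF a(2,4)] by blast
qed

lemma leaf_in_bag: "lev1 r \<Longrightarrow> lf x \<Longrightarrow> r \<in> S x \<Longrightarrow> S x \<subseteq> bag S r"
  using child_bag[of r x] lev1D(1) leafD(1) lev1_top by blast

lemma lev1_leaf: "lev1 r \<Longrightarrow> \<exists>x. lf x \<and> r \<in> S x"
  unfolding lev1_def leaf_def by blast

lemma lev1_not_I: "lev1 r \<Longrightarrow> r \<notin> I"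
  using lev1_leaf leaf_in_bag no_leaf_in_bag lev1D(2) by metis

lemma lev1_bag: "lev1 r \<Longrightarrow> i \<in> I \<Longrightarrow> r \<in> bag S i \<Longrightarrow> lf i \<and> r \<in> S i"
  using lev1_not_I lev1D(3) IW unfolding bag_def by blast

lemma lev1_union: "lev1 r \<Longrightarrow> s \<in> S r \<Longrightarrow> \<exists>x. lf x \<and> r \<in> S x \<and> s \<in> S x"
  using supported[of r s] lev1_not_I lev1D by blast

lemma leaf_bag_I: "lf x \<Longrightarrow> i \<in> I \<Longrightarrow> x \<in> bag S i \<Longrightarrow> i = x"
  using leaf_bag IW by blast

lemma leaf_S: assumes "lf x" "w \<in> S x" shows "w \<in> V" "w < x" "\<not> lf w"
  using assms SV Sless leafD(1) leaf_nbr_nonleaf by blast+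

lemma leaf_triple:
  assumes "lf x" "r \<in> S x" "p \<in> S x" "r \<noteq> p"
  shows "\<exists>b. S x = {r, p, b} \<and> b \<noteq> r \<and> b \<noteq> p"
proof -
  have "finite (S x)" using finS leafD(1) assms(1) by blast
  then have "card (S x - {r, p}) = 1" using leaf_card[OF assms(1)] assms by (simp add: card_Diff_subset)
  then obtain b where "S x - {r, p} = {b}" by (auto simp: card_1_singleton_iff)
  then have "S x = {r, p, b}" "b \<noteq> r" "b \<noteq> p" using assms by blast+
  then show ?thesis by blast
qed

lemma leaf_clique: assumes "lf x" "a \<in> S x" "b \<in> S x" "a < b" shows "a \<in> S b"
  using peo[of x a b] leaf_S[OF assms(1,3)] leafD(1)[OF assms(1)] assms by blast

text \<open>A vertex \<open>r\<close> with a single leaf \<open>l\<close>: buy the lowest vertex \<open>b\<close> of the leaf bag, delete the other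
  two from all bags, and root the rest at \<open>S x0\<close>.\<close>

lemma no_single_leaf:
  assumes r: "lev1 r" "r \<notin> S x0" and l: "leaves_at V S r = {l}" shows False
proof -
  have ll: "lf l" "r \<in> S l" using l by (auto simp: leaves_at_def)
  have lV: "l \<in> V" using ll leafD by blast
  have lx: "l \<noteq> x0" using ll r(2) by blast
  have rV: "r \<in> V" by (rule lev1D(1)[OF r(1)])
  have "card (S l - {r}) = 2" using leaf_card[OF ll(1)] ll(2) by simp
  then obtain a0 b0 where ab0: "S l - {r} = {a0, b0}" "a0 \<noteq> b0" by (auto simp: card_2_iff)
  define a where "a = max a0 b0"
  define b where "b = min a0 b0"
  have ba: "b < a" using ab0(2) by (auto simp: a_def b_def)
  have "{a0, b0} = {a, b}" by (auto simp: a_def b_def max_def min_def)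
  then have ab: "S l - {r} = {a, b}" using ab0 by simp
  have Sl: "S l = {r, a, b}" using ab ll(2) by blast
  have ne: "a \<noteq> r" "b \<noteq> r" using ab by blast+
  have mem: "a \<in> S l" "b \<in> S l" using Sl by auto
  \<comment> \<open>With a second leaf at \<open>a\<close> or \<open>b\<close>, that vertex would
    dominate \<open>r\<close>, \<open>l\<close> and the second leaf.\<close>
  have one: "l' = l" if s: "s \<in> {a, b}" "lf l'" "s \<in> S l'" for s l'
  proof (rule ccontr)
    assume l': "l' \<noteq> l"
    have sl: "s \<in> S l" using s(1) mem by blast
    have sV: "s \<in> V" using leaf_S[OF s(2,3)] by blast
    have "card {r, l, l'} \<le> 2"
    proof (rule dominated_card[OF sV])
      show "{r, l, l'} \<subseteq> V" using rV lV leafD(1)[OF s(2)] by blast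
      show "s \<notin> {r, l, l'}" using s(1) ne leaf_S[OF s(2,3)] leaf_S[OF ll(1) sl] by auto
      fix w i assume w: "w \<in> {r, l, l'}" "i \<in> I" "w \<in> bag S i"
      have "w = r \<Longrightarrow> i = l" using lev1_bag[OF r(1) w(2)] w leaves_atD[OF _ _ l] by blast
      then have "i = l \<or> i = l'" using w leaf_bag_I[OF ll(1)] leaf_bag_I[OF s(2)] by blast
      then show "s \<in> bag S i" using sl s(3) by (auto simp: bag_def)
    qed
    moreover have "card {r, l, l'} = 3" using l' lev1D(2)[OF r(1)] ll(1) s(2) by (intro set_card3) auto
    ultimately show False by simp
  qed
  have notroot: "a \<notin> S x0" "b \<notin> S x0" using one[OF _ x0] lx by blast+
  have aV: "a \<in> V" "b \<in> V" "\<not> lf a" "\<not> lf b" using leaf_S[OF ll(1)] mem by blast+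
  have bSa: "b \<in> S a" by (rule leaf_clique[OF ll(1) mem(2,1) ba])
  \<comment> \<open>Five deleted vertices and three root vertices make eight. The two purchases
    beyond \<open>U i\<close>, namely \<open>b\<close> and one root vertex, leave exactly the
    constant of the bound: 7 * 2 + 2 = 2 * 8.\<close>
  define P where "P = {x0, r, l, a, b}"
  define K where "K = S x0"
  define W where "W = V - K - P"
  define S' where "S' v = S v \<inter> (K \<union> W)" for v
  define J where "J = {v \<in> I \<inter> W. b \<notin> S v}"
  have KV: "K \<subseteq> V" "finite K" "card K = 3" using x0V finS leaf_card[OF x0] by (auto simp: K_def)
  have PV: "P \<subseteq> V" using x0V rV lV aV by (auto simp: P_def)
  have "x0 \<noteq> r" "x0 \<noteq> a" "x0 \<noteq> b" "l \<noteq> r" "l \<noteq> a" "l \<noteq> b"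
    using x0 ll(1) aV(3,4) lev1D(2)[OF r(1)] by metis+
  then have cP: "card P = 5" using ne ba lx unfolding P_def by simp
  have "x0 \<notin> K" "l \<notin> K" unfolding K_def by (rule leafD(2)[OF x0 x0V(1)], rule leafD(2)[OF ll(1) x0V(1)])
  then have KP: "K \<inter> P = {}" using r(2) notroot unfolding K_def P_def by simp
  have cW: "card W + 8 = card V"
  proof -
    have "K \<union> P \<subseteq> V" "finite P" using KV PV finW by (auto intro: finite_subset)
    moreover have "card (K \<union> P) = 8" using KP KV cP \<open>finite P\<close> by (simp add: card_Un_disjoint)
    moreover have "W = V - (K \<union> P)" by (auto simp: W_def)
    ultimately show ?thesis using card_Diff_subset[of "K \<union> P" V] card_mono[OF finW, of "K \<union> P"] KV(2) by simp
  qed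
  have sys: "peo_sys K W S' J"
  proof (rule peo_sys.intro)
    show "finite K" "finite W" using KV finW by (auto simp: W_def)
    show "k < w" if "k \<in> K" "w \<in> W" for k w using first[of k w] that by (auto simp: K_def W_def)
    show "S' v \<subseteq> K \<union> W" for v by (auto simp: S'_def)
    show "u < v" if "v \<in> W" "u \<in> S' v" for u v using that Sless[of v u] by (auto simp: S'_def W_def)
    show "s \<in> S' t" if "v \<in> W" "s \<in> S' v" "t \<in> S' v" "t \<in> W" "s < t" for v s t
      using that peo[of v s t] by (auto simp: S'_def W_def)
    show "J \<subseteq> W" by (auto simp: J_def)
    show "3 \<le> card (S' v)" if v: "v \<in> J" for v
    proof -
      have vI: "v \<in> I" "v \<in> V" "b \<notin> S v" "v \<noteq> x0" "v \<noteq> l" using v IW by (auto simp: J_def W_def P_def)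
      have fin: "finite (S v)" using finS vI by blast
      have rS: "r \<notin> S v"
      proof
        assume "r \<in> S v"
        then have "lf v" using lev1D(3)[OF r(1)] vI by blast
        then show False using leaves_atD[OF _ \<open>r \<in> S v\<close> l] vI(5) by blast
      qed
      \<comment> \<open>Of the removed vertices only \<open>a\<close> can occur in
        \<open>S v\<close>. A leaf avoids it by \<open>one\<close>, and a required non-leaf has an
        earlier neighbour to spare.\<close>
      have sub: "S v - {a} \<subseteq> S' v"
      proof
        fix s assume s: "s \<in> S v - {a}"
        then have "s \<in> V" "s \<noteq> x0" "s \<noteq> l" using SV[OF vI(2)] leafD(2)[OF x0 vI(2)] leafD(2)[OF ll(1) vI(2)] by blast+
        moreover have "s \<noteq> r" "s \<noteq> b" "s \<noteq> a" using s rS vI(3) by blast+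
        ultimately show "s \<in> S' v" using s by (auto simp: S'_def W_def P_def)
      qed
      have fin': "finite (S' v)" using fin by (simp add: S'_def)
      show ?thesis
      proof (cases "lf v")
        case True
        then have "a \<notin> S v" using one[of a v] vI by blast
        then show ?thesis using sub card_mono[OF fin', of "S v"] Icard[OF vI(1)] by simp
      next
        case False
        then have "4 \<le> card (S v)" using nonleaf_required_card vI by blast
        then have "3 \<le> card (S v - {a})" using fin by (cases "a \<in> S v") simp_all
        then show ?thesis using card_mono[OF fin' sub] by simp
      qed
    qed
  qed
  obtain c :: "nat \<Rightarrow> nat" where c: "inj_on c K" "c ` K \<subseteq> {..<3}"
    using extend_inj_colouring[of K "{}"] KV by auto
  have cK: "c ` K = {..<3}" using c KV card_image[OF c(1)] by (intro card_subset_eq) auto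
  obtain U where U: "\<forall>i<3. U i \<subseteq> W \<and> transv S' J (U i \<union> root_colour c K i)" "7 * (\<Sum>i<3. card (U i)) \<le> 6 * card W"
    using goodD[OF rooted_good[OF sys c]] by blast
  obtain i where i: "i < 3" "21 * card (U i) \<le> 6 * card W" using one_of_three[OF U(2)] by blast
  obtain k where k: "k \<in> K" "c k = i" using cK i(1) by (metis imageE lessThan_iff)
  have root_colour: "root_colour c K i = {k}" using k c(1) by (auto simp: root_colour_def inj_on_def)
  have UW: "U i \<subseteq> W" and tU: "transv S' J (U i \<union> {k})" using U(1) i(1) root_colour by metis+
  have finU: "finite (U i)" using UW finW by (auto simp: W_def intro: finite_subset)
  define T where "T = insert b (insert k (U i))"
  have "transv S I T" unfolding transv_def
  proof
    fix v assume v: "v \<in> I"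
    have vV: "v \<in> V" using v IW by blast
    have "v \<notin> K" using root_not_I v by (auto simp: K_def)
    moreover have "v \<noteq> r" using lev1_not_I r(1) v by blast
    ultimately consider "v = x0" | "v = l" | "v = a" | "v = b" | "v \<in> W" using vV by (auto simp: W_def P_def)
    then show "bag S v \<inter> T \<noteq> {}"
    proof cases
      case 1 then show ?thesis using k by (auto simp: T_def bag_def K_def)
    next
      case 2 then show ?thesis using mem by (auto simp: T_def bag_def)
    next
      case 3 then show ?thesis using bSa by (auto simp: T_def bag_def)
    next
      case 4 then show ?thesis by (auto simp: T_def bag_def)
    next
      case 5
      show ?thesis
      proof (cases "b \<in> S v")
        case False
        then have "v \<in> J" using v 5 by (simp add: J_def)
        then have "bag S' v \<inter> (U i \<union> {k}) \<noteq> {}" using tU by (simp add: transv_def)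
        moreover have "bag S' v \<subseteq> bag S v" by (auto simp: bag_def S'_def)
        ultimately show ?thesis by (auto simp: T_def)
      qed (auto simp: T_def bag_def)
    qed
  qed
  moreover have "T \<subseteq> V" using UW aV k KV by (auto simp: T_def W_def)
  moreover have "card T \<le> card (U i) + 2" unfolding T_def using finU by (simp add: card_insert_if)
  then have "ok (card V) (card T)" using i(2) cW by (simp add: ok_def)
  ultimately show False using nost unfolding small_transversal_def by blast
qed

text \<open>The normal form at a level-one vertex: two leaf cliques that share only \<open>r\<close>
  and together use up its bag, with \<open>p\<close> marking one of the four earlier
  neighbours.\<close>

definition cfg :: "nat \<Rightarrow> nat \<Rightarrow> nat \<Rightarrow> nat \<Rightarrow> nat \<Rightarrow> nat \<Rightarrow> nat \<Rightarrow> bool" where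
  "cfg p r y z b c d \<longleftrightarrow> lev1 r \<and> lf y \<and> lf z \<and> S y = {r, p, b} \<and> S z = {r, c, d} \<and>
     leaves_at V S r = {y, z} \<and> S r = {p, b, c, d} \<and> distinct [p, b, c, d] \<and> y \<noteq> z"

text \<open>A further common vertex of the two leaves would dominate \<open>r\<close>,
  \<open>y\<close> and \<open>z\<close>, and every earlier neighbour of \<open>r\<close> is
  supported by one of these leaves.\<close>

lemma two_leaves:
  assumes r: "lev1 r" "r \<notin> S x0" and p: "p \<in> S r"
  shows "\<exists>y z b c d. cfg p r y z b c d"
proof -
  have rV: "r \<in> V" by (rule lev1D(1)[OF r(1)])
  obtain y where y: "lf y" "r \<in> S y" "p \<in> S y" using lev1_union r(1) p by blast
  have rp: "r \<noteq> p" using Sless[OF rV p] by simp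
  obtain b where Sy: "S y = {r, p, b}" "b \<noteq> r" "b \<noteq> p" using leaf_triple[OF y rp] by blast
  from leaves_at_cases[OF rV y(1,2)] show ?thesis
  proof cases
    case 1 then show ?thesis using no_single_leaf r by blast
  next
    case (2 z)
    have disj: "s \<notin> S y" if s: "s \<in> S z" "s \<noteq> r" for s
    proof
      assume sy: "s \<in> S y"
      have sV: "s \<in> V" using leaf_S[OF y(1) sy] by blast
      have "card {r, y, z} \<le> 2"
      proof (rule dominated_card[OF sV])
        show "{r, y, z} \<subseteq> V" using rV leafD(1) y(1) 2(2) by blast
        show "s \<notin> {r, y, z}" using s leaf_S[OF y(1) sy] leaf_S[OF 2(2) s(1)] by auto
        fix w i assume w: "w \<in> {r, y, z}" "i \<in> I" "w \<in> bag S i"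
        have "w = r \<Longrightarrow> i = y \<or> i = z" using lev1_bag[OF r(1) w(2)] w leaves_atD[OF _ _ 2(4)] by blast
        then have "i = y \<or> i = z" using w leaf_bag_I[OF y(1)] leaf_bag_I[OF 2(2)] by blast
        then show "s \<in> bag S i" using sy s(1) by (auto simp: bag_def)
      qed
      moreover have "card {r, y, z} = 3" using 2(1,2) lev1D(2)[OF r(1)] y(1) by (intro set_card3) auto
      ultimately show False by simp
    qed
    have "card (S z - {r}) = 2" using leaf_card[OF 2(2)] 2(3) by simp
    then obtain c d where cd: "S z - {r} = {c, d}" "c \<noteq> d" by (auto simp: card_2_iff)
    have Sz: "S z = {r, c, d}" using cd 2(3) by blast
    have "c \<in> S z - {r}" "d \<in> S z - {r}" using cd by blast+
    then have cdn: "c \<noteq> r" "d \<noteq> r" "c \<noteq> p" "d \<noteq> p" "c \<noteq> b" "d \<noteq> b" using disj[of c] disj[of d] Sy by auto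
    have "S r \<subseteq> {p, b, c, d}"
    proof
      fix s assume s: "s \<in> S r"
      then obtain x where x: "lf x" "r \<in> S x" "s \<in> S x" using lev1_union r(1) by blast
      have "s \<noteq> r" using Sless[OF rV s] by simp
      moreover have "x = y \<or> x = z" using leaves_atD[OF x(1,2) 2(4)] by blast
      ultimately show "s \<in> {p, b, c, d}" using x(3) Sy Sz by auto
    qed
    moreover have "b \<in> S r" "c \<in> S r" "d \<in> S r"
      using leaf_in_bag[OF r(1) y(1,2)] leaf_in_bag[OF r(1) 2(2,3)] Sy Sz cdn by (auto simp: bag_def)
    ultimately have Sr: "S r = {p, b, c, d}" using p by blast
    have dist: "distinct [p, b, c, d]" using Sy(3) cd(2) cdn by simp
    have "cfg p r y z b c d" unfolding cfg_def
      by (intro conjI r(1) y(1) 2(2) Sy(1) Sz 2(4) Sr 2(1)[symmetric] dist)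
    then show ?thesis by blast
  qed
qed

text \<open>The weighted form of a reduction: delete \<open>P\<close>, root the rest at the clique \<open>Q\<close> whose vertices
  \<open>b\<close> and \<open>c\<close> are merged, and cover the deleted bags by one of three sets.\<close>

lemma no_merged_root:
  fixes k :: "nat \<Rightarrow> nat"
  assumes P: "P \<subseteq> V" and Q: "Q \<subseteq> V - P" "pairwise (sysE S) Q" and A: "\<And>i. i < 3 \<Longrightarrow> A i \<subseteq> V"
    and rng: "k ` Q \<subseteq> {..<3}" and kA: "\<And>q. q \<in> Q \<Longrightarrow> q \<in> A (k q)"
    and hit: "\<And>v i. v \<in> I \<Longrightarrow> bag S v \<inter> P \<noteq> {} \<Longrightarrow> i < 3 \<Longrightarrow> bag S v \<inter> A i \<noteq> {}"
    and bc: "b \<in> Q" "c \<in> Q" "b \<noteq> c" and inj: "inj_on k (Q - {b})" "inj_on k (Q - {c})"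
    and leafbc: "\<And>x. lf x \<Longrightarrow> b \<in> S x \<Longrightarrow> c \<in> S x \<Longrightarrow> bag S x \<inter> P \<noteq> {}"
    and nl: "\<not> lf b" "\<not> lf c"
    and size: "card P + card Q = 8" "card Q \<le> 4" "(\<Sum>i<3. card (A i)) \<le> 6"
  shows False
proof -
  define C where "C = {bag S v | v. v \<in> I \<and> bag S v \<inter> P = {}}"
  have finQ: "finite Q" using Q finW by (auto intro: finite_subset)
  have finP: "finite P" using P finW by (auto intro: finite_subset)
  have finU: "finite (V - P)" using finW by simp
  have dis: "dismantlable (V - P) (sysE S)" by (rule dismantlable_subset[OF dismantlable_sysE]) blast
  have C: "maxclique (V - P) (sysE S) B \<and> \<not> B \<subseteq> Q \<and> 4 \<le> card (B - Q) + card (k ` (B \<inter> Q))" if B: "B \<in> C" for B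
  proof -
    obtain v where v: "B = bag S v" "v \<in> I" "bag S v \<inter> P = {}" using B by (auto simp: C_def)
    have vV: "v \<in> V" using v IW by blast
    have sub: "bag S v \<subseteq> V - P" using v(3) SV[OF vV] vV by (auto simp: bag_def)
    have mc: "maxclique (V - P) (sysE S) B" unfolding v(1) by (rule bag_maxclique[OF v(2) _ sub]) blast
    have finB: "finite B" unfolding v(1) bag_def using finS[OF vV] by simp
    have cB: "card B = Suc (card (S v))"
      unfolding v(1) bag_def using finS[OF vV] Sless[OF vV] by (intro card_insert_disjoint) auto
    have five: "5 \<le> card B" if bB: "b \<in> B" "c \<in> B"
    proof (cases "lf v")
      case False then show ?thesis using nonleaf_required_card[OF v(2)] cB by simp
    next
      case True
      then have "b \<in> S v" "c \<in> S v" using bB v(1) nl by (auto simp: bag_def)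
      then show ?thesis using leafbc[OF True] v(3) by blast
    qed
    have "4 \<le> card B" using cB Icard[OF v(2)] by simp
    then show ?thesis using mc merged_colours_card[OF finB finQ _ bc size(2) inj five] by blast
  qed
  from clique_rooted_transversals[OF finU symp_sysE dis Q(2,1) rng C]
  obtain U where "(\<forall>i<3. U i \<subseteq> V - P - Q \<and> (\<forall>B\<in>C. B \<inter> (U i \<union> {q \<in> Q. k q = i}) \<noteq> {})) \<and>
    7 * (\<Sum>i<3. card (U i)) \<le> 6 * card (V - P - Q)" by (rule exE)
  note U = conjunct1[OF this] conjunct2[OF this]
  have cV: "card (V - P - Q) + 8 = card V"
  proof -
    have d: "P \<inter> Q = {}" "P \<union> Q \<subseteq> V" using P Q by blast+
    have "card (P \<union> Q) = 8" using size(1) d finP finQ by (simp add: card_Un_disjoint)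
    moreover have "V - P - Q = V - (P \<union> Q)" by blast
    ultimately show ?thesis using card_Diff_subset[OF _ d(2)] card_mono[OF finW d(2)] finP finQ by simp
  qed
  \<comment> \<open>Six purchases spread over three transversals are worth seven vertices, while
    eight have left the instance. The one vertex of difference is the constant in the bound.\<close>
  have "7 * (\<Sum>i<3. card (U i) + card (A i)) \<le> 6 * (card (V - P - Q) + 7)"
    using U(2) size(3) by (simp add: sum.distrib)
  then obtain i where i: "i < 3" "21 * (card (U i) + card (A i)) \<le> 6 * (card (V - P - Q) + 7)"
    using one_of_three[of "\<lambda>i. card (U i) + card (A i)"] by blast
  have Ui: "U i \<subseteq> V - P - Q" and hitC: "\<And>B. B \<in> C \<Longrightarrow> B \<inter> (U i \<union> {q \<in> Q. k q = i}) \<noteq> {}"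
    using U(1) i(1) by blast+
  have kAi: "{q \<in> Q. k q = i} \<subseteq> A i" using kA by blast
  have "transv S I (U i \<union> A i)" unfolding transv_def
  proof
    fix v assume v: "v \<in> I"
    show "bag S v \<inter> (U i \<union> A i) \<noteq> {}"
    proof (cases "bag S v \<inter> P = {}")
      case True
      then have "bag S v \<in> C" using v by (auto simp: C_def)
      then show ?thesis using hitC[of "bag S v"] kAi by blast
    next
      case False
      then show ?thesis using hit[OF v False i(1)] by blast
    qed
  qed
  moreover have "U i \<union> A i \<subseteq> V" using Ui A[OF i(1)] by blast
  moreover have "card (U i \<union> A i) \<le> card (U i) + card (A i)" by (rule card_Un_le)
  then have "ok (card V) (card (U i \<union> A i))" using i(2) cV by (simp add: ok_def)
  ultimately show False using nost unfolding small_transversal_def by blast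
qed

end


section \<open>The last branching\<close>

text \<open>Maximality makes every non-leaf later neighbour of \<open>p\<close> a level-one vertex,
  so beyond \<open>p\<close> there are only configurations \<open>cfg\<close> and leaves.\<close>

locale last_branch = rooted_min_counterexample +
  fixes p
  assumes p_in: "\<exists>j\<in>V. \<not> leaf V S j \<and> p \<in> S j"
    and p_max: "j \<in> V \<Longrightarrow> \<not> leaf V S j \<Longrightarrow> s \<in> S j \<Longrightarrow> s \<le> p"
    and p_root: "p \<notin> S x0"
begin

lemma pV: "p \<in> V" "\<not> lf p"
  using p_in SV unfolding leaf_def by blast+

lemma above_lev1: "j \<in> V \<Longrightarrow> \<not> lf j \<Longrightarrow> p \<in> S j \<Longrightarrow> lev1 j"
  unfolding lev1_def
proof (intro conjI ballI impI)
  fix j' assume a: "j \<in> V" "p \<in> S j" "j' \<in> V" "j \<in> S j'"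
  show "lf j'"
  proof (rule ccontr)
    assume "\<not> lf j'"
    then have "j \<le> p" using p_max a by blast
    then show False using Sless[OF a(1,2)] by simp
  qed
qed

lemma above_cfg:
  assumes "j \<in> V" "\<not> lf j" "p \<in> S j" shows "\<exists>y z b c d. cfg p j y z b c d"
proof (rule two_leaves[OF above_lev1[OF assms] _ assms(3)])
  show "j \<notin> S x0"
  proof
    assume "j \<in> S x0"
    then show False using root_down[of j p] pV p_root Sless[OF assms(1,3)] by simp
  qed
qed

lemma p_bag: "i \<in> I \<Longrightarrow> p \<in> bag S i \<Longrightarrow> i = p \<or> lf i \<and> p \<in> S i"
  using above_lev1 lev1_not_I IW unfolding bag_def by blast

lemma cfgD:
  assumes "cfg p j y z b c d"
  shows "lev1 j" "lf y" "lf z" "S y = {j, p, b}" "S z = {j, c, d}" "leaves_at V S j = {y, z}" "S j = {p, b, c, d}"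
    "distinct [p, b, c, d]" "y \<noteq> z"
    "j \<in> V" "b \<in> V" "c \<in> V" "d \<in> V" "y \<in> V" "z \<in> V" "y \<in> I" "z \<in> I" "j \<notin> I"
    "\<not> lf j" "\<not> lf b" "\<not> lf c" "\<not> lf d" "b < p" "c < p" "d < p" "p < j" "b \<in> S p" "c \<in> S p" "d \<in> S p"
    "p \<in> S j"
proof -
  show c: "lev1 j" "lf y" "lf z" "S y = {j, p, b}" "S z = {j, c, d}" "leaves_at V S j = {y, z}"
    and Sj: "S j = {p, b, c, d}" and dist: "distinct [p, b, c, d]" and "y \<noteq> z"
    using assms unfolding cfg_def by blast+
  show jV: "j \<in> V" "\<not> lf j" "j \<notin> I" using lev1D c(1) lev1_not_I by blast+
  show pj: "p \<in> S j" using Sj by simp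
  then show "p < j" using Sless jV by blast
  have m: "b \<in> S y" "c \<in> S z" "d \<in> S z" using c by simp_all
  show bV: "b \<in> V" "\<not> lf b" using leaf_S[OF c(2) m(1)] by blast+
  show cV: "c \<in> V" "\<not> lf c" using leaf_S[OF c(3) m(2)] by blast+
  show dV: "d \<in> V" "\<not> lf d" using leaf_S[OF c(3) m(3)] by blast+
  show "y \<in> V" "z \<in> V" "y \<in> I" "z \<in> I" using c(2,3) leafD(1) leaf_in_I by blast+
  have lt: "s < p" if "s \<in> S j" "s \<noteq> p" for s using p_max[OF jV(1,2) that(1)] that(2) by simp
  have ms: "b \<in> S j" "c \<in> S j" "d \<in> S j" "b \<noteq> p" "c \<noteq> p" "d \<noteq> p" using Sj dist by auto
  show l: "b < p" "c < p" "d < p" using lt ms by blast+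
  show "b \<in> S p" "c \<in> S p" "d \<in> S p" using peo[OF jV(1) _ pj pV(1)] ms l by blast+
qed

lemma level_bag: "cfg p j y z b c d \<Longrightarrow> i \<in> I \<Longrightarrow> j \<in> bag S i \<Longrightarrow> i = y \<or> i = z"
  using lev1_bag[OF cfgD(1)] leaves_atD[OF _ _ cfgD(6)] by blast

lemma level_S: "cfg p j y z b c d \<Longrightarrow> i \<in> V \<Longrightarrow> j \<in> S i \<Longrightarrow> i = y \<or> i = z"
  using lev1D(3)[OF cfgD(1)] leaves_atD[OF _ _ cfgD(6)] by blast

lemma distinct_levels:
  assumes "cfg p j y z b c d" "cfg p j' y' z' b' c' d'" "j \<noteq> j'"
  shows "j' \<notin> S y" "j' \<notin> S z"
proof -
  note C = cfgD[OF assms(1)] and C' = cfgD[OF assms(2)]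
  have "j' \<noteq> p" "j' \<noteq> b" "j' \<noteq> c" "j' \<noteq> d" using C(23-25) C'(26) by auto
  then show "j' \<notin> S y" "j' \<notin> S z" using C(4,5) assms(3) by auto
qed

text \<open>Two level-one vertices above \<open>p\<close>: turn \<open>p\<close> into a leaf on \<open>{f, g, b}\<close>.\<close>

lemma no_two_levels_exchange:
  assumes A: "cfg p r y z b c d" and B: "cfg p r' y' z' e f g" and ne: "r \<noteq> r'" and b: "b \<noteq> f" "b \<noteq> g"
    and at: "leaves_at V S p \<subseteq> {y, y'}" and abv: "\<And>j. j \<in> V \<Longrightarrow> \<not> lf j \<Longrightarrow> p \<in> S j \<Longrightarrow> j = r \<or> j = r'"
  shows False
proof -
  note C = cfgD[OF A] and C' = cfgD[OF B]
  note dl = distinct_levels[OF A B ne] distinct_levels[OF B A ne[symmetric]]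
  have r'y: "r' \<in> S y'" "r' \<in> S z'" "r \<in> S y" "r \<in> S z" using C(4,5) C'(4,5) by simp_all
  have nyz: "y' \<noteq> y" "y' \<noteq> z" "z' \<noteq> y" "z' \<noteq> z" using dl r'y by metis+
  have pS: "j = r \<or> j = r' \<or> j = y \<or> j = y'" if "j \<in> V" "p \<in> S j" for j
  proof (cases "lf j")
    case True then show ?thesis using at that by (auto simp: leaves_at_def)
  next
    case False then show ?thesis using abv that by blast
  qed
  define V' where "V' = V - {y, y', z', r'}"
  \<comment> \<open>\<open>r\<close> survives for its leaf \<open>z\<close>, with just the earlier
    neighbours \<open>c\<close> and \<open>d\<close> that this leaf needs. Having lost
    \<open>p\<close>, it no longer keeps \<open>p\<close> from being a leaf.\<close>
  define S' where "S' = S(p := {f, g, b}, r := {c, d})"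
  define I' where "I' = insert p (I - {y, y', z'})"
  have rp: "r \<noteq> p" "r' \<noteq> p" using C(26) C'(26) by auto
  have S'p: "S' p = {f, g, b}" and S'r: "S' r = {c, d}" and S'o: "j \<noteq> p \<Longrightarrow> j \<noteq> r \<Longrightarrow> S' j = S j" for j
    using rp by (simp_all add: S'_def)
  have S'sub: "S' j \<subseteq> S j" for j
  proof (cases "j = p \<or> j = r")
    case True then show ?thesis using S'p S'r C(7,27) C'(28,29) by auto
  next
    case False then show ?thesis using S'o by blast
  qed
  have pV': "p \<in> V'" using pV C(2) C'(2,3) rp unfolding V'_def by auto
  have sub: "V' \<subseteq> V" by (auto simp: V'_def)
  have nV': "y \<notin> V'" "y' \<notin> V'" "z' \<notin> V'" "r' \<notin> V'" by (auto simp: V'_def)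
  have pS': "p \<notin> S' j" if "j \<in> V'" for j
  proof
    assume pj: "p \<in> S' j"
    then have "j = r \<or> j = r' \<or> j = y \<or> j = y'" using pS[of j] that S'sub sub by blast
    then have "j = r" using that nV' by metis
    then show False using pj S'r C(8) by auto
  qed
  have S'V: "S' j \<subseteq> V'" if j: "j \<in> V'" for j
  proof
    fix s assume "s \<in> S' j"
    then have s: "s \<in> S j" using S'sub by blast
    have jV: "j \<in> V" using j sub by blast
    have "s \<in> V" using SV[OF jV] s by blast
    moreover have "s \<noteq> y" "s \<noteq> y'" "s \<noteq> z'" using leafD(2)[OF _ jV] C(2) C'(2,3) s by blast+
    moreover have "s \<noteq> r'" using level_S[OF B jV] s j nV' by metis
    ultimately show "s \<in> V'" by (simp add: V'_def)
  qed
  have bagI: "bag S' v = bag S v" if "v \<in> I" "v \<noteq> p" for v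
    using S'o[of v] that C(18) unfolding bag_def by metis
  have sys: "bsys V' S' I'"
  proof (rule bsys.intro)
    show "peo_sys {} V' S' I'"
    proof (rule peo_sys.intro)
      show "finite V'" using finW by (simp add: V'_def)
      show "S' v \<subseteq> {} \<union> V'" if "v \<in> V'" for v using S'V that by blast
      show "u < v" if "v \<in> V'" "u \<in> S' v" for u v using that S'sub sub Sless by blast
      show "s \<in> S' t" if j: "j \<in> V'" "s \<in> S' j" "t \<in> S' j" "t \<in> V'" "s < t" for j s t
      proof -
        have st: "s \<in> S j" "t \<in> S j" "j \<in> V" "t \<in> V" using j S'sub sub by blast+
        have sSt: "s \<in> S t" using peo st j(5) by blast
        have tp: "t \<noteq> p" using pS' j(1,3) by blast
        show ?thesis
        proof (cases "t = r")
          case True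
          then have "j = y \<or> j = z" using level_S[OF A] st by blast
          then have "j = z" using j(1) nV' by blast
          then have "s = c \<or> s = d" using st(1) C(5) j(5) True by auto
          then show ?thesis using True S'r by blast
        next
          case False then show ?thesis using S'o tp sSt by blast
        qed
      qed
      show "I' \<subseteq> V'" using IW pV' C'(18) by (auto simp: I'_def V'_def)
      show "3 \<le> card (S' v)" if v: "v \<in> I'" for v
      proof (cases "v = p")
        case True
        have "card {f, g, b} = 3" using b C'(8) by (intro set_card3) auto
        then show ?thesis using True S'p by simp
      next
        case False
        then have vI: "v \<in> I" using v by (simp add: I'_def)
        then have "S' v = S v" using S'o[OF False] C(18) by metis
        then show ?thesis using Icard[OF vI] by simp
      qed
    qed auto
    show "bsys_axioms V' S' I'"
    proof (rule bsys_axioms.intro)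
      fix v j assume v: "v \<in> I'" and j: "j \<in> V'"
      show "\<not> bag S' v \<subseteq> S' j"
      proof (cases "v = p")
        case True then show ?thesis using pS'[OF j] by (auto simp: bag_def)
      next
        case False
        then have vI: "v \<in> I" using v by (simp add: I'_def)
        show ?thesis unfolding bagI[OF vI False] using Mx[OF vI] j sub S'sub by blast
      qed
    qed
  qed
  have V'4: "card V = card V' + 4"
  proof -
    have X: "{y, y', z', r'} \<subseteq> V" using C(14) C'(10,14,15) by blast
    have "y \<noteq> r'" "y' \<noteq> r'" "z' \<noteq> r'" using C(2) C'(2,3,19) by metis+
    then have "card {y, y', z', r'} = 4" using nyz C'(9) by simp
    then show ?thesis unfolding V'_def
      using card_Diff_subset[OF _ X] card_mono[OF finW X] by simp
  qed
  have "V' \<noteq> V" using nV'(1) C(14) by blast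
  then have less: "smaller V' S' I' V S I" by (rule smaller_sub[OF sub])
  have mb: "p \<in> bag S y" "b \<in> bag S y" "p \<in> bag S y'" "r' \<in> bag S y'" "r' \<in> bag S z'" "f \<in> bag S z'" "g \<in> bag S z'"
     "p \<in> bag S p" "b \<in> bag S p" "f \<in> bag S p" "g \<in> bag S p"
    using C(4,27) C'(4,5,28,29) by (simp_all add: bag_def)
  show False
  proof (rule no_change[OF sys less, of 1])
    show "ok (card V) (t + 1)" if "ok (card V') t" for t using ok_four[OF that] V'4 by simp
    fix T assume T: "T \<subseteq> V'" "transv S' I' T"
    have finT: "finite T" using T(1) finW sub by (meson finite_subset)
    have "bag S' p \<inter> T \<noteq> {}" using T(2) unfolding transv_def I'_def by blast
    then have hp: "p \<in> T \<or> b \<in> T \<or> f \<in> T \<or> g \<in> T" using S'p by (auto simp: bag_def)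
    have oth: "bag S v \<inter> T \<noteq> {}" if "v \<in> I" "v \<noteq> y" "v \<noteq> y'" "v \<noteq> z'" "v \<noteq> p" for v
    proof -
      have "v \<in> I'" using that by (simp add: I'_def)
      then have "bag S' v \<inter> T \<noteq> {}" using T(2) by (simp add: transv_def)
      then show ?thesis using bagI that by metis
    qed
    have key: "\<exists>T2\<subseteq>V. transv S I T2 \<and> card T2 \<le> card T + 1"
      if s: "s \<in> V" "\<And>v. v \<in> {y, y', z', p} \<Longrightarrow> bag S v \<inter> insert s T \<noteq> {}" for s
    proof (intro exI[of _ "insert s T"] conjI)
      show "insert s T \<subseteq> V" using s(1) T(1) sub by blast
      show "transv S I (insert s T)" unfolding transv_def
      proof
        fix v assume v: "v \<in> I"
        show "bag S v \<inter> insert s T \<noteq> {}"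
        proof (cases "v \<in> {y, y', z', p}")
          case True then show ?thesis by (rule s(2))
        next
          case False
          then have "bag S v \<inter> T \<noteq> {}" using oth[OF v] by simp
          then show ?thesis by blast
        qed
      qed
      show "card (insert s T) \<le> card T + 1" using finT by (simp add: card_insert_if)
    qed
    show "\<exists>T2\<subseteq>V. transv S I T2 \<and> card T2 \<le> card T + 1"
    \<comment> \<open>\<open>p\<close> or \<open>b\<close> already meets the cliques of
      \<open>y\<close> and \<open>p\<close>, so \<open>r'\<close> completes the set at
      \<open>y'\<close> and \<open>z'\<close>. \<open>f\<close> or \<open>g\<close> already meets
      that of \<open>z'\<close>, so \<open>p\<close> completes the set at the others.\<close>
    proof (cases "p \<in> T \<or> b \<in> T")
      case True
      show ?thesis by (rule key[of r']) (use True mb C'(10) in auto)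
    next
      case False
      then have "f \<in> T \<or> g \<in> T" using hp by blast
      then show ?thesis by (intro key[of p]) (use mb pV in auto)
    qed
  qed
qed

text \<open>The exchange fails only if \<open>b\<close> is one of \<open>f\<close>, \<open>g\<close>
  and, by symmetry, \<open>e\<close> is one of \<open>c\<close>, \<open>d\<close>. Then
  \<open>b\<close> and \<open>e\<close> meet every required bag around both configurations, nine
  vertices for two.\<close>

lemma no_two_levels:
  assumes A: "cfg p r y z b c d" and B: "cfg p r' y' z' e f g" and ne: "r \<noteq> r'" shows False
proof -
  note C = cfgD[OF A] and C' = cfgD[OF B]
  note dl = distinct_levels[OF A B ne] distinct_levels[OF B A ne[symmetric]]
  have m: "r' \<in> S y'" "r' \<in> S z'" "r \<in> S y" "r \<in> S z" "p \<in> S y" "p \<in> S y'" using C(4,5) C'(4,5) by simp_all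
  have nyz: "y' \<noteq> y" "y' \<noteq> z" "z' \<noteq> y" "z' \<noteq> z" using dl m by metis+
  have sub: "{y, y'} \<subseteq> leaves_at V S p" using C(2) C'(2) m by (simp add: leaves_at_def)
  have "card (leaves_at V S p) \<le> card {y, y'}" using card_leaves_at[OF pV(1)] nyz by simp
  then have at: "leaves_at V S p = {y, y'}" using card_seteq[OF finite_leaves_at sub] by blast
  \<comment> \<open>Each level-one vertex above \<open>p\<close> brings a leaf at \<open>p\<close>
    of its own, and \<open>y\<close>, \<open>y'\<close> are already all the leaves there.\<close>
  have abv: "j = r \<or> j = r'" if j: "j \<in> V" "\<not> lf j" "p \<in> S j" for j
  proof -
    obtain y1 z1 b1 c1 d1 where D: "cfg p j y1 z1 b1 c1 d1" using above_cfg[OF j] by blast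
    note D' = cfgD[OF D]
    have m1: "j \<in> S y1" "p \<in> S y1" using D'(4) by simp_all
    then have "y1 = y \<or> y1 = y'" using leaves_atD[OF D'(2) _ at] by blast
    then show ?thesis using m1(1) distinct_levels(1)[OF A D] distinct_levels(1)[OF B D] by metis
  qed
  have "b \<in> {f, g}" using no_two_levels_exchange[OF A B ne] at abv by blast
  moreover have "e \<in> {c, d}" using no_two_levels_exchange[OF B A ne[symmetric]] at abv by blast
  ultimately have mb: "b \<in> bag S y" "e \<in> bag S y'" "b \<in> bag S z'" "e \<in> bag S z" "b \<in> bag S p"
    and be: "b \<noteq> e" using C(4,5,27) C'(4,5,8) by (auto simp: bag_def)
  let ?X = "{b, e, y, z, y', z', r, r', p}"
  have X: "?X \<subseteq> V" using C C'(10,11,14,15) pV by blast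
  have n1: "b \<noteq> p" "e \<noteq> p" "b \<noteq> r" "e \<noteq> r" "b \<noteq> r'" "e \<noteq> r'" "r \<noteq> p" "r' \<noteq> p" using C(23,26) C'(23,26) by auto
  have n2: "l \<noteq> b \<and> l \<noteq> e \<and> l \<noteq> r \<and> l \<noteq> r' \<and> l \<noteq> p" if "lf l" for l
    using that C(19,20) C'(19,20) pV(2) by metis
  have "card ?X = 9"
    using n1 be nyz ne C(9) C'(9) n2[OF C(2)] n2[OF C(3)] n2[OF C'(2)] n2[OF C'(3)] by auto
  then have num: "ok (card V) (t + card {b, e})" if "ok (card V - card ?X) t" for t
    by (intro num_split[OF X _ that]) (use ok_nine be in simp)
  show False
  proof (rule no_del[OF X, of "{b, e}"])
    fix v assume v: "v \<in> I" "bag S v \<inter> ?X \<noteq> {}"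
    have "p \<in> bag S v \<Longrightarrow> v = p \<or> v = y \<or> v = y'" using p_bag[OF v(1)] leaves_atD[OF _ _ at] by blast
    then have "b \<in> bag S v \<or> e \<in> bag S v \<or> v = y \<or> v = z \<or> v = y' \<or> v = z' \<or> v = p"
      using v(2) level_bag[OF A v(1)] level_bag[OF B v(1)] leaf_bag_I[OF C(2) v(1)] leaf_bag_I[OF C(3) v(1)]
        leaf_bag_I[OF C'(2) v(1)] leaf_bag_I[OF C'(3) v(1)] by blast
    then show "bag S v \<inter> {b, e} \<noteq> {}" using mb by blast
  qed (use C(11) C'(11) num in auto)
qed

lemma bag_p_clique: "Q \<subseteq> S p \<Longrightarrow> pairwise (sysE S) Q"
  using bag_pairwise[OF pV(1)] by (rule pairwise_subset) (auto simp: bag_def)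

lemma no_lonely:
  assumes A: "cfg p r y z b c d" and at: "leaves_at V S p = {y}" shows False
proof -
  note C = cfgD[OF A]
  have mem: "r \<in> bag S y" "r \<in> bag S z" "p \<in> bag S y" "b \<in> bag S y" "b \<in> bag S p" "c \<in> bag S z" "d \<in> bag S z"
    using C(4,5,27) by (simp_all add: bag_def)
  have pI: "v = p \<or> v = y" if "v \<in> I" "p \<in> bag S v" for v
    using p_bag[OF that] leaves_atD[OF _ _ at] by blast
  show False
  proof (cases "p \<in> I")
    case False
    have "card {y, z, p} \<le> 2"
    proof (rule dominated_card[OF C(10)])
      show "{y, z, p} \<subseteq> V" using C(14,15) pV by blast
      show "r \<notin> {y, z, p}" using C(2,3,19,26) by auto
      fix w i assume w: "w \<in> {y, z, p}" "i \<in> I" "w \<in> bag S i"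
      then have "i = y \<or> i = z" using pI False leaf_bag_I[OF C(2)] leaf_bag_I[OF C(3)] by blast
      then show "r \<in> bag S i" using mem by blast
    qed
    moreover have "card {y, z, p} = 3" using C(2,3,9) pV by (intro set_card3) auto
    ultimately show False by simp
  next
    case True
    have Sp4: "4 \<le> card (S p)" by (rule nonleaf_required_card[OF True pV(2)])
    have "card {b, c, d} = 3" using C(8) by (intro set_card3) auto
    then have "\<not> S p \<subseteq> {b, c, d}" using card_mono[of "{b, c, d}" "S p"] Sp4 by auto
    then obtain f where f: "f \<in> S p" "f \<noteq> b" "f \<noteq> c" "f \<noteq> d" by blast
    have fp: "f < p" "f \<in> V" using Sless SV pV f(1) by blast+
    have fl: "\<not> lf f" using leafD(2) pV f(1) by blast
    \<comment> \<open>The colour classes \<open>{b, c}\<close>, \<open>{d}\<close>,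
      \<open>{f}\<close> of the root are filled up with \<open>p\<close> and \<open>r\<close> to
      three pairs, each of which meets the bags of \<open>y\<close>, \<open>z\<close> and
      \<open>p\<close>.\<close>
    define k where "k q = (if q = b \<or> q = c then 0 else if q = d then 1 else (2::nat))" for q
    define A where "A i = (if i = 0 then {b, c} else if i = 1 then {p, d} else {r, f})" for i :: nat
    let ?P = "{y, z, r, p}" and ?Q = "{b, c, d, f}"
    have neq: "b \<noteq> c" "b \<noteq> d" "c \<noteq> d" using C(8) by auto
    have lo: "u \<noteq> r \<and> u \<noteq> p" if "u \<in> ?Q" for u using that C(23-26) fp by auto
    have ll: "u \<noteq> y \<and> u \<noteq> z" if "\<not> lf u" for u using that C(2,3) by blast
    show False
    proof (rule no_merged_root[of ?P ?Q A k b c])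
      show "?P \<subseteq> V" using C(10,14,15) pV by blast
      show "?Q \<subseteq> V - ?P" using C(11-13,20-22) fp fl lo ll by blast
      show "pairwise (sysE S) ?Q" by (rule bag_p_clique) (use C(27-29) f in blast)
      show "A i \<subseteq> V" for i unfolding A_def using C(10-13) pV fp by auto
      show "k ` ?Q \<subseteq> {..<3}" by (auto simp: k_def)
      show "q \<in> A (k q)" if "q \<in> ?Q" for q using that by (auto simp: A_def k_def)
      show "bag S v \<inter> A i \<noteq> {}" if v: "v \<in> I" "bag S v \<inter> ?P \<noteq> {}" for v i
      proof -
        have "v = y \<or> v = z \<or> v = p"
          using v(2) pI[OF v(1)] level_bag[OF \<open>cfg p r y z b c d\<close> v(1)] leaf_bag_I[OF C(2) v(1)] leaf_bag_I[OF C(3) v(1)] by blast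
        moreover have "f \<in> bag S p" "p \<in> bag S p" using f by (simp_all add: bag_def)
        ultimately show ?thesis using mem unfolding A_def by auto
      qed
      show "inj_on k (?Q - {b})" "inj_on k (?Q - {c})" using neq f by (auto simp: inj_on_def k_def)
      \<comment> \<open>A leaf through \<open>b\<close> that avoided \<open>P\<close> would let
        \<open>b\<close> dominate \<open>y\<close>, \<open>p\<close> and that leaf; so no surviving
        leaf suffers from merging \<open>b\<close> and \<open>c\<close>.\<close>
      show "bag S x \<inter> ?P \<noteq> {}" if x: "lf x" "b \<in> S x" for x
      proof (rule ccontr)
        assume no: "\<not> ?thesis"
        have xy: "x \<noteq> y" using no by (auto simp: bag_def)
        have "card {y, p, x} \<le> 2"
        proof (rule dominated_card[OF C(11)])
          show "{y, p, x} \<subseteq> V" using C(14) pV leafD(1)[OF x(1)] by blast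
          show "b \<notin> {y, p, x}" using C(2,20,23) x(1) by auto
          fix w i assume w: "w \<in> {y, p, x}" "i \<in> I" "w \<in> bag S i"
          then have "i = y \<or> i = p \<or> i = x" using pI leaf_bag_I[OF C(2)] leaf_bag_I[OF x(1)] by blast
          then show "b \<in> bag S i" using mem x(2) by (auto simp: bag_def)
        qed
        moreover have "card {y, p, x} = 3" using xy C(2) x(1) pV by (intro set_card3) auto
        ultimately show False by simp
      qed
      have "card ?P = 4" using C(2,3,9,19,26) pV(2) ll[of r] ll[of p] by auto
      moreover have "card ?Q = 4" using neq f by auto
      ultimately show "card ?P + card ?Q = 8" "card ?Q \<le> 4" by simp_all
      have "card {b, c} \<le> 2" "card {p, d} \<le> 2" "card {r, f} \<le> 2" by (simp_all add: card_insert_if)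
      then show "(\<Sum>i<3. card (A i)) \<le> 6" unfolding sum3 A_def by simp
    qed (use neq C(20,21) in auto)
  qed
qed

end


context last_branch begin

text \<open>The leaf \<open>l\<close> is not a leaf at \<open>r\<close>, so it reaches no vertex
  beyond \<open>p\<close>. Its clique thus lies in \<open>bag S p\<close>, and \<open>p\<close>
  cannot be required.\<close>

lemma second_leaf:
  assumes A: "cfg p r y z b c d" and at: "leaves_at V S p = {y, l}" and ly: "l \<noteq> y"
    and abv: "\<forall>j\<in>V. \<not> lf j \<longrightarrow> p \<in> S j \<longrightarrow> j = r"
  obtains e f where "lf l" "l \<noteq> z" "S l = {p, e, f}" "e \<noteq> f" "e \<in> S p" "f \<in> S p" "r \<notin> S l" "p \<notin> I"
    "\<forall>j\<in>V. p \<in> S j \<longrightarrow> j = r \<or> j = y \<or> j = l"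
proof -
  note C = cfgD[OF A]
  have "l \<in> leaves_at V S p" using at by blast
  then have l: "lf l" "p \<in> S l" by (simp_all add: leaves_at_def)
  have "p \<notin> S z" using C(5,24,25,26) by auto
  then have lz: "l \<noteq> z" using l(2) by blast
  have rl: "r \<notin> S l" using leaves_atD[OF l(1) _ C(6)] ly lz by blast
  have below: "s \<in> S p" if s: "s \<in> S l" "s \<noteq> p" for s
  proof -
    have "\<not> p < s"
    proof
      assume "p < s"
      then have "p \<in> S s" by (rule leaf_clique[OF l(1,2) s(1)])
      then have "s = r" using abv leaf_S[OF l(1) s(1)] by blast
      then show False using s(1) rl by blast
    qed
    then have "s < p" using s(2) by simp
    then show ?thesis by (rule leaf_clique[OF l(1) s(1) l(2)])
  qed
  have "card (S l - {p}) = 2" using leaf_card[OF l(1)] l(2) by simp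
  then obtain e f where ef: "S l - {p} = {e, f}" "e \<noteq> f" by (auto simp: card_2_iff)
  have Sl: "S l = {p, e, f}" using ef l(2) by blast
  have "e \<in> S l - {p}" "f \<in> S l - {p}" using ef by blast+
  then have efp: "e \<in> S p" "f \<in> S p" using below by blast+
  then have "S l \<subseteq> bag S p" using Sl by (simp add: bag_def)
  then have pI: "p \<notin> I" using no_leaf_in_bag[OF _ pV(2) l(1)] by blast
  have "j = r \<or> j = y \<or> j = l" if j: "j \<in> V" "p \<in> S j" for j
  proof (cases "lf j")
    case True then show ?thesis using leaves_atD[OF _ j(2) at] by blast
  next
    case False then show ?thesis using abv j by blast
  qed
  then show ?thesis using that l(1) lz Sl ef(2) efp rl pI by blast
qed

text \<open>\<open>p\<close> becomes a required leaf on \<open>{e, f, w}\<close> in place of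
  \<open>y\<close>, \<open>z\<close>, \<open>l\<close>, \<open>r\<close>. A set hitting
  \<open>w\<close> meets the clique of \<open>z\<close> and is completed by \<open>p\<close>; one
  hitting \<open>p\<close>, \<open>e\<close> or \<open>f\<close> meets that of \<open>l\<close> and
  is completed by \<open>r\<close>.\<close>

lemma no_second_leaf_exchange:
  assumes A: "cfg p r y z b c d" and l: "lf l" "l \<noteq> y" "l \<noteq> z" "S l = {p, e, f}" "e \<noteq> f" "e \<in> S p" "f \<in> S p"
    and pI: "p \<notin> I" and pS: "\<forall>j\<in>V. p \<in> S j \<longrightarrow> j = r \<or> j = y \<or> j = l"
    and w: "w \<in> {c, d}" "w \<noteq> e" "w \<noteq> f"
  shows False
proof -
  note C = cfgD[OF A]
  define V' where "V' = V - {y, z, l, r}"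
  define S' where "S' = S(p := {e, f, w})"
  define I' where "I' = insert p (I - {y, z, l})"
  have rp: "r \<noteq> p" using C(26) by auto
  have S'p: "S' p = {e, f, w}" and S'o: "j \<noteq> p \<Longrightarrow> S' j = S j" for j by (simp_all add: S'_def)
  have lV: "l \<in> V" "l \<in> I" using l(1) leafD(1) leaf_in_I by blast+
  have S'sub: "S' j \<subseteq> S j" for j
  proof (cases "j = p")
    case True then show ?thesis using S'p l(6,7) w C(28,29) by auto
  next
    case False then show ?thesis using S'o by blast
  qed
  have pV': "p \<in> V'" using pV C(2,3) l(1) rp unfolding V'_def by auto
  have sub: "V' \<subseteq> V" by (auto simp: V'_def)
  have nV': "y \<notin> V'" "z \<notin> V'" "l \<notin> V'" "r \<notin> V'" by (auto simp: V'_def)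
  have pS': "p \<notin> S' j" if "j \<in> V'" for j
    using pS that S'sub[of j] sub nV' by blast
  have S'V: "S' j \<subseteq> V'" if j: "j \<in> V'" for j
  proof
    fix s assume "s \<in> S' j"
    then have s: "s \<in> S j" using S'sub by blast
    have jV: "j \<in> V" using j sub by blast
    have "s \<in> V" using SV[OF jV] s by blast
    moreover have "s \<noteq> y" "s \<noteq> z" "s \<noteq> l" using leafD(2)[OF _ jV] C(2,3) l(1) s by blast+
    moreover have "s \<noteq> r" using level_S[OF A jV] s j nV' by metis
    ultimately show "s \<in> V'" by (simp add: V'_def)
  qed
  have bagI: "bag S' v = bag S v" if "v \<in> I" for v
    using S'o[of v] that pI unfolding bag_def by metis
  have sys: "bsys V' S' I'"
  proof (rule bsys.intro)
    show "peo_sys {} V' S' I'"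
    proof (rule peo_sys.intro)
      show "finite V'" using finW by (simp add: V'_def)
      show "S' v \<subseteq> {} \<union> V'" if "v \<in> V'" for v using S'V that by blast
      show "u < v" if "v \<in> V'" "u \<in> S' v" for u v using that S'sub sub Sless by blast
      show "s \<in> S' t" if j: "j \<in> V'" "s \<in> S' j" "t \<in> S' j" "t \<in> V'" "s < t" for j s t
      proof -
        have st: "s \<in> S j" "t \<in> S j" "j \<in> V" "t \<in> V" using j S'sub sub by blast+
        have "s \<in> S t" using peo st j(5) by blast
        moreover have "t \<noteq> p" using pS' j(1,3) by blast
        ultimately show ?thesis using S'o by blast
      qed
      show "I' \<subseteq> V'" using IW pV' C(18) by (auto simp: I'_def V'_def)
      show "3 \<le> card (S' v)" if v: "v \<in> I'" for v
      proof (cases "v = p")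
        case True
        have "card {e, f, w} = 3" using w l(5) by (intro set_card3) auto
        then show ?thesis using True S'p by simp
      next
        case False
        then have "v \<in> I" using v by (simp add: I'_def)
        then show ?thesis using Icard S'o[OF False] by simp
      qed
    qed auto
    show "bsys_axioms V' S' I'"
    proof (rule bsys_axioms.intro)
      fix v j assume v: "v \<in> I'" and j: "j \<in> V'"
      show "\<not> bag S' v \<subseteq> S' j"
      proof (cases "v = p")
        case True then show ?thesis using pS'[OF j] by (auto simp: bag_def)
      next
        case False
        then have vI: "v \<in> I" using v by (simp add: I'_def)
        show ?thesis unfolding bagI[OF vI] using Mx[OF vI] j sub S'sub by blast
      qed
    qed
  qed
  have V'4: "card V = card V' + 4"
  proof -
    have X: "{y, z, l, r} \<subseteq> V" using C(10,14,15) lV by blast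
    have "y \<noteq> r" "z \<noteq> r" "l \<noteq> r" using C(2,3,19) l(1) by metis+
    then have "card {y, z, l, r} = 4" using l(2,3) C(9) by simp
    then show ?thesis unfolding V'_def
      using card_Diff_subset[OF _ X] card_mono[OF finW X] by simp
  qed
  have "V' \<noteq> V" using nV'(1) C(14) by blast
  then have less: "smaller V' S' I' V S I" by (rule smaller_sub[OF sub])
  have mb: "p \<in> bag S y" "r \<in> bag S y" "r \<in> bag S z" "w \<in> bag S z" "p \<in> bag S l" "e \<in> bag S l" "f \<in> bag S l"
    using C(4,5) l(4) w by (auto simp: bag_def)
  show False
  proof (rule no_change[OF sys less, of 1])
    show "ok (card V) (t + 1)" if "ok (card V') t" for t using ok_four[OF that] V'4 by simp
    fix T assume T: "T \<subseteq> V'" "transv S' I' T"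
    have finT: "finite T" using T(1) finW sub by (meson finite_subset)
    have "bag S' p \<inter> T \<noteq> {}" using T(2) unfolding transv_def I'_def by blast
    then have hp: "p \<in> T \<or> e \<in> T \<or> f \<in> T \<or> w \<in> T" using S'p by (auto simp: bag_def)
    have key: "\<exists>T2\<subseteq>V. transv S I T2 \<and> card T2 \<le> card T + 1"
      if s: "s \<in> V" "\<And>v. v \<in> {y, z, l} \<Longrightarrow> bag S v \<inter> insert s T \<noteq> {}" for s
    proof (intro exI[of _ "insert s T"] conjI)
      show "insert s T \<subseteq> V" using s(1) T(1) sub by blast
      show "transv S I (insert s T)" unfolding transv_def
      proof
        fix v assume v: "v \<in> I"
        show "bag S v \<inter> insert s T \<noteq> {}"
        proof (cases "v \<in> {y, z, l}")
          case True then show ?thesis by (rule s(2))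
        next
          case False
          then have "v \<in> I'" using v by (simp add: I'_def)
          then have "bag S' v \<inter> T \<noteq> {}" using T(2) by (simp add: transv_def)
          then show ?thesis using bagI[OF v] by blast
        qed
      qed
      show "card (insert s T) \<le> card T + 1" using finT by (simp add: card_insert_if)
    qed
    show "\<exists>T2\<subseteq>V. transv S I T2 \<and> card T2 \<le> card T + 1"
    proof (cases "w \<in> T")
      case False
      show ?thesis by (rule key[of r]) (use False hp mb C(10) in auto)
    next
      case True
      show ?thesis by (rule key[of p]) (use True mb pV in auto)
    qed
  qed
qed

lemma no_second_leaf:
  assumes A: "cfg p r y z b c d" and at: "leaves_at V S p = {y, l}" and ly: "l \<noteq> y"
    and abv: "\<forall>j\<in>V. \<not> lf j \<longrightarrow> p \<in> S j \<longrightarrow> j = r"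
  shows False
proof -
  note C = cfgD[OF A]
  obtain e f where l: "lf l" "l \<noteq> z" "S l = {p, e, f}" "e \<noteq> f" "e \<in> S p" "f \<in> S p" and rl: "r \<notin> S l" and pI: "p \<notin> I"
    and pS: "\<forall>j\<in>V. p \<in> S j \<longrightarrow> j = r \<or> j = y \<or> j = l"
    by (rule second_leaf[OF A at ly abv])
  have "c = e \<or> c = f" "d = e \<or> d = f"
    using no_second_leaf_exchange[OF A l(1) ly l(2-6) pI pS] by blast+
  then have cd: "c \<in> S l" "d \<in> S l" using l(3) by auto
  \<comment> \<open>After the exchange is ruled out, \<open>S l\<close> is \<open>{p, c, d}\<close>.
    Each of the pairs \<open>{b, c}\<close>, \<open>{r, d}\<close>, \<open>{p, r}\<close> meets the
    bags of \<open>y\<close>, \<open>z\<close> and \<open>l\<close>. Merging \<open>b\<close> and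
    \<open>c\<close> is safe because \<open>z\<close> and \<open>l\<close> already exhaust the
    leaves at \<open>c\<close>.\<close>
  define k where "k q = (if q = b \<or> q = c then 0 else (1::nat))" for q
  define A' where "A' i = (if i = 0 then {b, c} else if i = 1 then {r, d} else {p, r})" for i :: nat
  let ?P = "{y, z, l, r, p}" and ?Q = "{b, c, d}"
  have mem: "r \<in> bag S y" "p \<in> bag S y" "b \<in> bag S y" "r \<in> bag S z" "c \<in> bag S z" "d \<in> bag S z"
    "c \<in> bag S l" "d \<in> bag S l" "p \<in> bag S l"
    using C(4,5) cd l(3) by (simp_all add: bag_def)
  have neq: "b \<noteq> c" "b \<noteq> d" "c \<noteq> d" using C(8) by auto
  have lo: "u \<noteq> r \<and> u \<noteq> p" if "u \<in> ?Q" for u using that C(23-26) by auto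
  have ll: "u \<noteq> y \<and> u \<noteq> z \<and> u \<noteq> l" if "\<not> lf u" for u using that C(2,3) l(1) by blast
  show False
  proof (rule no_merged_root[of ?P ?Q A' k b c])
    show "?P \<subseteq> V" using C(10,14,15) pV leafD(1)[OF l(1)] by blast
    show "?Q \<subseteq> V - ?P" using C(11-13,20-22) lo ll by blast
    show "pairwise (sysE S) ?Q" by (rule bag_p_clique) (use C(27-29) in blast)
    show "A' i \<subseteq> V" for i unfolding A'_def using C(10-13) pV by auto
    show "k ` ?Q \<subseteq> {..<3}" by (auto simp: k_def)
    show "q \<in> A' (k q)" if "q \<in> ?Q" for q using that by (auto simp: A'_def k_def)
    show "bag S v \<inter> A' i \<noteq> {}" if v: "v \<in> I" "bag S v \<inter> ?P \<noteq> {}" for v i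
    proof -
      have "p \<in> bag S v \<Longrightarrow> v = y \<or> v = l" using p_bag[OF v(1)] pI v(1) leaves_atD[OF _ _ at] by blast
      then have "v = y \<or> v = z \<or> v = l"
        using v(2) level_bag[OF A v(1)] leaf_bag_I[OF C(2) v(1)] leaf_bag_I[OF C(3) v(1)] leaf_bag_I[OF l(1) v(1)] by blast
      then show ?thesis using mem unfolding A'_def by auto
    qed
    show "inj_on k (?Q - {b})" "inj_on k (?Q - {c})" using neq by (auto simp: inj_on_def k_def)
    show "bag S x \<inter> ?P \<noteq> {}" if x: "lf x" "c \<in> S x" for x
    proof (rule ccontr)
      assume no: "\<not> ?thesis"
      have "x \<noteq> z" "x \<noteq> l" using no by (auto simp: bag_def)
      moreover have "c \<in> S z" using C(5) by simp
      ultimately show False using three_leaves[OF C(12) x(1) C(3) l(1) x(2) _ cd(1)] l(2) by blast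
    qed
    have "r \<noteq> p" using C(26) by auto
    then have "card ?P = 5" using C(9) ly l(2) ll[OF C(19)] ll[OF pV(2)] by auto
    moreover have "card ?Q = 3" using neq by auto
    ultimately show "card ?P + card ?Q = 8" "card ?Q \<le> 4" by simp_all
    have "card {b, c} \<le> 2" "card {r, d} \<le> 2" "card {p, r} \<le> 2" by (simp_all add: card_insert_if)
    then show "(\<Sum>i<3. card (A' i)) \<le> 6" unfolding sum3 A'_def by simp
  qed (use neq C(20,21) in auto)
qed

lemma last_branch_False: False
proof -
  obtain r where r: "r \<in> V" "\<not> lf r" "p \<in> S r" using p_in by blast
  obtain y z b c d where A: "cfg p r y z b c d" using above_cfg[OF r] by blast
  note C = cfgD[OF A]
  have abv: "j = r" if j: "j \<in> V" "\<not> lf j" "p \<in> S j" for j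
  proof (rule ccontr)
    assume "j \<noteq> r"
    moreover obtain y' z' e f g where "cfg p j y' z' e f g" using above_cfg[OF j] by blast
    ultimately show False using no_two_levels[OF A] by blast
  qed
  have "p \<in> S y" using C(4) by simp
  from leaves_at_cases[OF pV(1) C(2) this] show False
  proof cases
    case 1 then show False by (rule no_lonely[OF A])
  next
    case (2 l) then show False using no_second_leaf[OF A 2(4,1)] abv by blast
  qed
qed

end

lemma (in rooted_min_counterexample) rooted_min_counterexample_False: False
proof -
  define N where "N = {v \<in> V. \<not> lf v}"
  have finN: "finite N" using finW by (simp add: N_def)
  obtain k where k: "k \<in> S x0" using leaf_card[OF x0] by fastforce
  then have "k \<in> N" using leaf_S[OF x0] by (simp add: N_def)
  then have N: "N \<noteq> {}" by blast
  define r where "r = Max N"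
  have rN: "r \<in> N" unfolding r_def by (rule Max_in[OF finN N])
  have rmax: "w \<le> r" if "w \<in> N" for w unfolding r_def by (rule Max_ge[OF finN that])
  have r: "r \<in> V" "\<not> lf r" using rN by (simp_all add: N_def)
  have lev: "lev1 r" unfolding lev1_def
  proof (intro conjI ballI impI r)
    fix j assume j: "j \<in> V" "r \<in> S j"
    have "r < j" by (rule Sless[OF j])
    then have "j \<notin> N" using rmax[of j] by auto
    then show "lf j" using j by (simp add: N_def)
  qed
  \<comment> \<open>Otherwise all non-leaves lie in the root, every required clique is a leaf
    attached to \<open>S x0\<close>, and \<open>r\<close> alone meets all of them.\<close>
  have rK: "r \<notin> S x0"
  proof
    assume rK: "r \<in> S x0"
    have NK: "N \<subseteq> S x0" using rmax root_down[OF rK] by (auto simp: N_def)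
    have "transv S I {r}" unfolding transv_def
    proof
      fix v assume v: "v \<in> I"
      have vV: "v \<in> V" using v IW by blast
      have "v \<notin> S x0" using root_not_I v by blast
      then have lv: "lf v" using NK vV by (auto simp: N_def)
      have "S v \<subseteq> S x0"
      proof
        fix s assume "s \<in> S v"
        then have "s \<in> N" using leaf_S[OF lv] by (simp add: N_def)
        then show "s \<in> S x0" using NK by blast
      qed
      then have "S v = S x0" using leaf_card[OF lv] leaf_card[OF x0] finS x0V(1) by (simp add: card_subset_eq)
      then show "bag S v \<inter> {r} \<noteq> {}" using rK by (simp add: bag_def)
    qed
    moreover have "ok (card V) (card {r})" using large by (simp add: ok_def)
    ultimately show False using nost r(1) unfolding small_transversal_def by blast
  qed
  have "\<exists>s. s \<in> S r"
  proof -
    obtain x where x: "lf x" "r \<in> S x" using lev1_leaf[OF lev] by blast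
    have "card (S x - {r}) = 2" using leaf_card[OF x(1)] x(2) by simp
    then have "S x - {r} \<noteq> {}" by (metis card.empty zero_neq_numeral)
    then obtain s where "s \<in> S x - {r}" by blast
    then show ?thesis using leaf_in_bag[OF lev x] by (auto simp: bag_def)
  qed
  then obtain s where s: "s \<in> S r" by blast
  define P where "P = {q. \<exists>j\<in>V. \<not> lf j \<and> q \<in> S j}"
  have finP: "finite P" using SV by (intro finite_subset[OF _ finW]) (auto simp: P_def)
  have sP: "S r \<subseteq> P" using r by (auto simp: P_def)
  then have P: "P \<noteq> {}" using s by blast
  define p where "p = Max P"
  have pP: "p \<in> P" unfolding p_def by (rule Max_in[OF finP P])
  have pmax: "q \<le> p" if "q \<in> P" for q unfolding p_def by (rule Max_ge[OF finP that])
  \<comment> \<open>If \<open>p\<close> were in the root, so would be all of \<open>S r\<close>,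
    which has four vertices against three.\<close>
  have proot: "p \<notin> S x0"
  proof
    assume pK: "p \<in> S x0"
    have "S r \<subseteq> S x0" using root_down[OF pK] pmax sP SV[OF r(1)] by blast
    then have "card (S r) \<le> card (S x0)" by (rule card_mono[rotated]) (use finS x0V in blast)
    then have c3: "card (S r) \<le> 3" using leaf_card[OF x0] by simp
    obtain y z b c d where "cfg s r y z b c d" using two_leaves[OF lev rK s] by blast
    then have "S r = {s, b, c, d}" "distinct [s, b, c, d]" unfolding cfg_def by blast+
    then show False using c3 by simp
  qed
  have "last_branch V S I x0 p"
    by (rule last_branch.intro[OF rooted_min_counterexample_axioms], rule last_branch_axioms.intro) (use pP pmax proot in \<open>auto simp: P_def\<close>)
  then show False by (rule last_branch.last_branch_False)
qed

theorem small_transversal_exists: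
  assumes "bsys V S I" shows "small_transversal V S I"
proof -
  let ?r = "less_than <*lex*> less_than <*lex*> less_than"
  have wf: "wf ?r" by auto
  show ?thesis using assms
  proof (induction "(card V, (\<Sum>v\<in>V. card (S v)), card I)" arbitrary: V S I rule: wf_induct_rule[OF wf])
    case (1 V S I)
    show ?case
    proof (rule ccontr)
      assume n: "\<not> small_transversal V S I"
      have IH: "small_transversal V' S' I'" if "bsys V' S' I'" "smaller V' S' I' V S I" for V' S' I'
        using 1(1)[OF smaller_measure[OF that(2)] that(1)] .
      have "min_counterexample V S I" by (rule min_counterexample.intro[OF 1(2) min_counterexample_axioms.intro[OF n]]) (rule IH)
      from min_counterexample.rooted_exists[OF this] obtain V' S' I' x where
        b: "min_counterexample V' S' I'" "leaf V' S' x" "\<forall>k\<in>S' x. \<forall>w\<in>V' - S' x. k < w" by blast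
      have "rooted_min_counterexample V' S' I' x"
        by (rule rooted_min_counterexample.intro[OF b(1)], rule rooted_min_counterexample_axioms.intro) (use b(2,3) in auto)
      then show False by (rule rooted_min_counterexample.rooted_min_counterexample_False)
    qed
  qed
qed


section \<open>Maximal triangles\<close>

text \<open>Of the hypothesis on edges only \<open>tri\<close> is kept: the edges of required
  triangles lie in larger cliques. In this form it can be verified again for a part of the
  graph.\<close>

locale triangle_sys = peo_sys "{}" V S "{}" for V S +
  fixes J
  assumes JV: "J \<subseteq> V" and Jcard: "v \<in> J \<Longrightarrow> 2 \<le> card (S v)"
    and Mx: "v \<in> J \<Longrightarrow> j \<in> V \<Longrightarrow> \<not> bag S v \<subseteq> S j"
    and tri: "v \<in> J \<Longrightarrow> card (S v) = 2 \<Longrightarrow> x \<in> bag S v \<Longrightarrow> y \<in> bag S v \<Longrightarrow> x \<noteq> y \<Longrightarrow>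
      \<exists>k\<in>V. 3 \<le> card (S k) \<and> x \<in> bag S k \<and> y \<in> bag S k"

lemma peo_sys_restrict:
  assumes "peo_sys {} V S I" "V0 \<subseteq> V" shows "peo_sys {} V0 (\<lambda>v. S v \<inter> V0) {}"
proof -
  interpret peo_sys "{}" V S I by fact
  show ?thesis
  proof (rule peo_sys.intro)
    show "finite V0" using assms(2) finW by (rule finite_subset)
    show "u < v" if "v \<in> V0" "u \<in> S v \<inter> V0" for u v using that assms(2) Sless by blast
    show "a \<in> S b \<inter> V0" if "v \<in> V0" "a \<in> S v \<inter> V0" "b \<in> S v \<inter> V0" "b \<in> V0" "a < b" for v a b
      using that assms(2) peo by blast
  qed auto
qed

lemma peo_sys_add_leaf:
  assumes "peo_sys {} V S I" "Q \<subseteq> V" "\<And>v. v \<in> V \<Longrightarrow> v < t" "\<And>a b. a \<in> Q \<Longrightarrow> b \<in> Q \<Longrightarrow> a < b \<Longrightarrow> a \<in> S b"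
  shows "peo_sys {} (insert t V) (S(t := Q)) {}"
proof -
  interpret peo_sys "{}" V S I by fact
  have tV: "t \<notin> V" using assms(3) by blast
  show ?thesis
  proof (rule peo_sys.intro)
    show "finite (insert t V)" using finW by simp
    show "(S(t := Q)) v \<subseteq> {} \<union> insert t V" if "v \<in> insert t V" for v
      using that Ssub assms(2) by auto
    show "u < v" if "v \<in> insert t V" "u \<in> (S(t := Q)) v" for u v
      using that Sless assms(2,3) by (auto split: if_splits)
    show "a \<in> (S(t := Q)) b" if h: "v \<in> insert t V" "a \<in> (S(t := Q)) v" "b \<in> (S(t := Q)) v" "a < b" for v a b
    proof (cases "v = t")
      case True
      then have "a \<in> Q" "b \<in> Q" using h by simp_all
      moreover have "b \<noteq> t" using \<open>b \<in> Q\<close> assms(2) tV by blast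
      ultimately show ?thesis using assms(4) h(4) by simp
    next
      case False
      then have v: "v \<in> V" "a \<in> S v" "b \<in> S v" using h by simp_all
      then have "b \<in> V" using Ssub by blast
      then have "b \<noteq> t" using tV by blast
      then show ?thesis using peo[OF v \<open>b \<in> V\<close> h(4)] by simp
    qed
  qed auto
qed

definition within_bound :: "nat set \<Rightarrow> (nat \<Rightarrow> nat set) \<Rightarrow> nat set \<Rightarrow> bool" where
  "within_bound V S J \<longleftrightarrow> (\<exists>T\<subseteq>V. transv S J T \<and> 7 * card T + 2 \<le> 2 * card V)"

lemma (in triangle_sys) no_triangle_small:
  assumes "\<And>v. v \<in> J \<Longrightarrow> card (S v) \<noteq> 2" "5 \<le> card V" shows "within_bound V S J"
proof -
  have c: "3 \<le> card (S v)" if "v \<in> J" for v using Jcard[OF that] assms(1)[OF that] by simp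
  have "bsys V S J"
  proof (rule bsys.intro)
    show "peo_sys {} V S J" by (rule peo_sys.intro[OF finK finW KW Ssub Sless peo JV c])
    show "bsys_axioms V S J" by (rule bsys_axioms.intro) (rule Mx)
  qed
  then have "small_transversal V S J" by (rule small_transversal_exists)
  then show ?thesis using assms(2) unfolding small_transversal_def within_bound_def ok_def by auto
qed

text \<open>Induction on the number of required triangles. Since \<open>w\<close> is the last one,
  all required cliques that reach below it have at least four vertices, so two of the three parts
  are covered by the earlier theorems.\<close>

locale triangle_min_counterexample = triangle_sys +
  fixes w u v
  assumes big: "5 \<le> card V" and notsmall: "\<not> within_bound V S J"
    and IH: "triangle_sys V' S' J' \<Longrightarrow> 5 \<le> card V' \<Longrightarrow> card {v \<in> J'. card (S' v) = 2} < card {v \<in> J. card (S v) = 2} \<Longrightarrow>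
      within_bound V' S' J'"
    and w: "w \<in> J" "S w = {u, v}" "u \<noteq> v"
    and wmax: "k \<in> J \<Longrightarrow> card (S k) = 2 \<Longrightarrow> k \<le> w"
begin

definition "D = bag S w"
definition "Dw = Des V S w"
text \<open>\<open>C\<close> is what hangs on the edge between \<open>u\<close> and
  \<open>w\<close>, \<open>B\<close> the remainder below \<open>w\<close>, and \<open>A\<close>
  everything that does not descend from \<open>w\<close>, apart from the triangle itself.\<close>

definition "C = {x. \<exists>j\<in>V. u \<in> S j \<and> w \<in> S j \<and> (x = j \<or> x \<in> Des V S j)}"
definition "B = Dw - C"
definition "A = V - D - Dw"

lemma D: "D = {u, v, w}" "u \<in> V" "v \<in> V" "w \<in> V" "u < w" "v < w" "u \<noteq> w" "v \<noteq> w" "card (S w) = 2"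
proof -
  show wV: "w \<in> V" using w JV by blast
  show "u \<in> V" "v \<in> V" using Ssub[OF wV] w(2) by auto
  show "u < w" "v < w" using Sless[OF wV] w(2) by auto
  then show "u \<noteq> w" "v \<noteq> w" by auto
  show "D = {u, v, w}" using w(2) by (auto simp: D_def bag_def)
  show "card (S w) = 2" using w(2,3) by simp
qed

lemma DV: "D \<subseteq> V" "finite D" "card D = 3" using D w(3) by auto

lemma D_clique: "a \<in> D \<Longrightarrow> b \<in> D \<Longrightarrow> a < b \<Longrightarrow> a \<in> S b"
proof -
  assume a: "a \<in> D" "b \<in> D" "a < b"
  have "b \<le> w" "b \<in> V" using a(2) D(1-6) by auto
  then have "a \<in> S w" using a(1,3) unfolding D_def bag_def by auto
  show ?thesis
  proof (cases "b = w")
    case False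
    then have "b \<in> S w" using a(2) unfolding D_def bag_def by simp
    then show ?thesis by (rule peo[OF D(4) \<open>a \<in> S w\<close> _ \<open>b \<in> V\<close> a(3)])
  qed (use \<open>a \<in> S w\<close> in simp)
qed

lemma Dw_V: "Dw \<subseteq> V" unfolding Dw_def by (rule Des_sub)

lemma Dw_gt: "x \<in> Dw \<Longrightarrow> w < x" unfolding Dw_def by (rule Des_gt)

lemma Dw_D: "Dw \<inter> D = {}"
proof (rule ccontr)
  assume "Dw \<inter> D \<noteq> {}"
  then obtain x where "x \<in> Dw" "x \<in> D" by blast
  then show False using Dw_gt[of x] D(1,5,6) by auto
qed

lemma Dw_up: "x \<in> Dw \<Longrightarrow> k \<in> V \<Longrightarrow> x \<in> S k \<Longrightarrow> k \<in> Dw"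
  unfolding Dw_def by (rule Des_step)

lemma Dw_base: "k \<in> V \<Longrightarrow> w \<in> S k \<Longrightarrow> k \<in> Dw" unfolding Dw_def by (rule Des_base)

lemma Dw_path: "k \<in> Dw \<Longrightarrow> s \<in> S k \<Longrightarrow> s \<in> Dw \<or> s \<in> D"
  using Des_path[OF D(4), of k s] unfolding Dw_def D_def bag_def by blast

text \<open>Walking back along the descent, a vertex below \<open>w\<close> adjacent to both
  \<open>u\<close> and \<open>v\<close> leads to one adjacent to the whole triangle, which is
  maximal.\<close>

lemma not_both: "k \<in> Dw \<Longrightarrow> u \<in> S k \<Longrightarrow> v \<in> S k \<Longrightarrow> False"
  unfolding Dw_def
proof (induction rule: Des_induct)
  case (base k)
  then have "bag S w \<subseteq> S k" using w(2) by (auto simp: bag_def)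
  then show False using Mx w(1) base(1) by blast
next
  case (step j k)
  have j: "j \<in> V" "w < j" using step(1) Dw_V Dw_gt unfolding Dw_def by blast+
  have "u \<in> S j" "v \<in> S j" using peo[OF step(2) _ step(3) j(1)] step(5,6) j(2) D(5,6) by simp_all
  then show False by (rule step(4))
qed

lemma C_Dw: "C \<subseteq> Dw"
  using Dw_base Des_trans unfolding C_def Dw_def by blast

lemma C_up: "x \<in> C \<Longrightarrow> k \<in> V \<Longrightarrow> x \<in> S k \<Longrightarrow> k \<in> C"
  using Des_base Des_step unfolding C_def by blast

lemma C_down:
  assumes "x \<in> C" "y \<in> S x" "y \<in> Dw" shows "y \<in> C"
proof -
  obtain j where j: "j \<in> V" "u \<in> S j" "w \<in> S j" "x = j \<or> x \<in> Des V S j" using assms(1) unfolding C_def by blast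
  have "y \<in> Des V S j \<or> y = j \<or> y \<in> S j" using j(4) assms(2) Des_path[OF j(1), of x y] by blast
  then show ?thesis
  proof (elim disjE)
    assume y: "y \<in> S j"
    have yV: "y \<in> V" "w < y" using assms(3) Dw_V Dw_gt by blast+
    have "w \<in> S y" "u \<in> S y" using peo[OF j(1) _ y yV(1)] j(2,3) yV(2) D(5) by simp_all
    then show ?thesis using yV(1) unfolding C_def by blast
  qed (use j in \<open>auto simp: C_def\<close>)
qed

lemma parts: "A \<subseteq> V" "B \<subseteq> V" "C \<subseteq> V" "A \<inter> B = {}" "A \<inter> C = {}" "B \<inter> C = {}" "A \<inter> D = {}" "B \<inter> D = {}" "C \<inter> D = {}"
   "V = A \<union> B \<union> C \<union> D" "finite A" "finite B" "finite C"
proof -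
  show "A \<subseteq> V" "A \<inter> D = {}" "B \<inter> C = {}" unfolding A_def B_def by blast+
  show B: "B \<subseteq> V" "C \<subseteq> V" using Dw_V C_Dw unfolding B_def by blast+
  show "A \<inter> B = {}" "A \<inter> C = {}" using C_Dw unfolding A_def B_def by blast+
  show "B \<inter> D = {}" "C \<inter> D = {}" using C_Dw Dw_D unfolding B_def by blast+
  show "V = A \<union> B \<union> C \<union> D" using C_Dw Dw_V DV(1) unfolding A_def B_def by blast
  show "finite A" "finite B" "finite C" using finW \<open>A \<subseteq> V\<close> B by (auto intro: finite_subset)
qed

lemma card_parts: "card V = card A + card B + card C + 3"
proof -
  have "card V = card (A \<union> B \<union> C) + card D"
    by (subst parts(10), rule card_Un_disjoint) (use parts DV in auto)
  also have "card (A \<union> B \<union> C) = card (A \<union> B) + card C" by (rule card_Un_disjoint) (use parts in auto)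
  also have "card (A \<union> B) = card A + card B" by (rule card_Un_disjoint) (use parts in auto)
  finally show ?thesis using DV(3) by simp
qed

definition "detached X \<longleftrightarrow> X \<subseteq> V \<and> X \<inter> D = {} \<and> (\<forall>k\<in>V. bag S k \<inter> X \<noteq> {} \<longrightarrow> bag S k \<subseteq> X \<union> D)"

lemma low_bag: "k \<in> V \<Longrightarrow> k \<notin> Dw \<Longrightarrow> bag S k \<subseteq> A \<union> D"
  using Ssub Dw_up unfolding A_def bag_def by blast

lemma B_bag: "k \<in> B \<Longrightarrow> bag S k \<subseteq> B \<union> D"
proof
  fix s assume k: "k \<in> B" and s: "s \<in> bag S k"
  have kD: "k \<in> Dw" "k \<notin> C" "k \<in> V" using k Dw_V unfolding B_def by blast+
  show "s \<in> B \<union> D"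
  proof (cases "s = k")
    case False
    then have sS: "s \<in> S k" using s by (simp add: bag_def)
    moreover have "s \<notin> C" using C_up[OF _ kD(3) sS] kD(2) by blast
    ultimately show ?thesis using Dw_path[OF kD(1) sS] unfolding B_def by blast
  qed (use k in simp)
qed

lemma C_bag: "k \<in> C \<Longrightarrow> bag S k \<subseteq> C \<union> D"
proof
  fix s assume k: "k \<in> C" and s: "s \<in> bag S k"
  have kD: "k \<in> Dw" using k C_Dw by blast
  show "s \<in> C \<union> D"
  proof (cases "s = k")
    case False
    then have sS: "s \<in> S k" using s by (simp add: bag_def)
    then show ?thesis using Dw_path[OF kD sS] C_down[OF k sS] by blast
  qed (use k in simp)
qed

lemma bag_part: "k \<in> V \<Longrightarrow> bag S k \<subseteq> A \<union> D \<or> bag S k \<subseteq> B \<union> D \<or> bag S k \<subseteq> C \<union> D"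
  using low_bag B_bag C_bag unfolding B_def by blast

lemma detached_parts: "detached A" "detached B" "detached C"
  unfolding detached_def using bag_part parts(1-9) by blast+

text \<open>A larger clique through the edge of \<open>u\<close> and \<open>w\<close> reaches into
  \<open>C\<close>, one through \<open>v\<close> and \<open>w\<close> into \<open>B\<close>, and one
  through \<open>u\<close> and \<open>v\<close> into \<open>A\<close>, where it leaves at least two
  vertices.\<close>

lemma part_nonempty: "2 \<le> card A" "B \<noteq> {}" "C \<noteq> {}"
proof -
  have ex: "\<exists>k\<in>V. 3 \<le> card (S k) \<and> x \<in> bag S k \<and> y \<in> bag S k" if "x \<in> D" "y \<in> D" "x \<noteq> y" for x y
    using tri[OF w(1) D(9)] that unfolding D_def by blast
  have up: "k \<in> Dw \<and> x \<in> S k" if k: "k \<in> V" "3 \<le> card (S k)" "x \<in> bag S k" "w \<in> bag S k" "x < w" for k x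
  proof -
    have "k \<noteq> w" using k(2) D(9) by auto
    then have wk: "w \<in> S k" using k(4) by (auto simp: bag_def)
    then have "w < k" using Sless k(1) by blast
    then have "x \<noteq> k" using k(5) by simp
    then show ?thesis using k(3) wk Dw_base[OF k(1)] by (simp add: bag_def)
  qed
  obtain k1 where k1: "k1 \<in> V" "3 \<le> card (S k1)" "u \<in> bag S k1" "w \<in> bag S k1" using ex[of u w] D by auto
  have k1': "k1 \<in> Dw" "u \<in> S k1" using up[OF k1 D(5)] by auto
  have "w \<in> S k1" using k1(4) Dw_gt[OF k1'(1)] by (auto simp: bag_def)
  then show "C \<noteq> {}" using k1(1) k1'(2) unfolding C_def by blast
  obtain k2 where k2: "k2 \<in> V" "3 \<le> card (S k2)" "v \<in> bag S k2" "w \<in> bag S k2" using ex[of v w] D by auto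
  have k2': "k2 \<in> Dw" "v \<in> S k2" using up[OF k2 D(6)] by auto
  have "k2 \<notin> C"
  proof
    assume "k2 \<in> C"
    then obtain j where j: "j \<in> V" "u \<in> S j" "w \<in> S j" "k2 = j \<or> k2 \<in> Des V S j" unfolding C_def by blast
    have "v < j" using D(6) Sless[OF j(1,3)] by simp
    then have "v \<in> S j" using j(4) k2'(2) Des_path_less[OF j(1), of k2 v] by blast
    then show False using not_both[OF Dw_base[OF j(1,3)] j(2)] by blast
  qed
  then show "B \<noteq> {}" using k2'(1) unfolding B_def by blast
  obtain k where k: "k \<in> V" "3 \<le> card (S k)" "u \<in> bag S k" "v \<in> bag S k" using ex[of u v] D w(3) by auto
  have kD: "k \<notin> Dw"
  proof
    assume a: "k \<in> Dw"
    then have "u \<in> S k" "v \<in> S k" using k(3,4) Dw_gt[OF a] D(5,6) by (auto simp: bag_def)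
    then show False using not_both a by blast
  qed
  have "w \<notin> bag S k"
  proof
    assume "w \<in> bag S k"
    moreover have "k \<noteq> w" using k(2) D(9) by auto
    ultimately have "w \<in> S k" by (auto simp: bag_def)
    then show False using Dw_base k(1) kD by blast
  qed
  then have sub: "bag S k - {u, v} \<subseteq> A" using low_bag[OF k(1) kD] D(1) by blast
  have "card (bag S k) = Suc (card (S k))"
    unfolding bag_def using finS[OF k(1)] Sless[OF k(1)] by (intro card_insert_disjoint) auto
  then have "2 \<le> card (bag S k - {u, v})" using k(2-4) w(3) by (simp add: card_Diff_subset)
  also have "\<dots> \<le> card A" by (rule card_mono[OF parts(11) sub])
  finally show "2 \<le> card A" .
qed

section \<open>Prices of the three parts\<close>

definition "JX X = {k \<in> J - {w}. bag S k \<inter> X \<noteq> {}}"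

definition "hits X P T \<longleftrightarrow> T \<subseteq> X \<and> (\<forall>k\<in>JX X. bag S k \<inter> (T \<union> P) \<noteq> {})"

text \<open>The price of the part \<open>X\<close> when the vertices \<open>P\<close> of the
  triangle are already bought.\<close>

definition "f X P = (LEAST n. \<exists>T. hits X P T \<and> card T = n)"

lemma hits_all: "hits X P X" unfolding hits_def JX_def by blast

lemma f_attained: "\<exists>T. hits X P T \<and> card T = f X P"
  unfolding f_def by (rule LeastI_ex) (use hits_all in blast)

lemma f_le: "hits X P T \<Longrightarrow> f X P \<le> card T"
  unfolding f_def by (rule Least_le) blast

lemma f_mono: "P \<subseteq> P' \<Longrightarrow> f X P' \<le> f X P"
proof -
  assume P: "P \<subseteq> P'"
  obtain T where T: "hits X P T" "card T = f X P" using f_attained by blast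
  have "hits X P' T" using T(1) P unfolding hits_def by blast
  then show ?thesis using f_le T(2) by metis
qed

lemma JX_cover: "k \<in> J \<Longrightarrow> k = w \<or> k \<in> JX A \<or> k \<in> JX B \<or> k \<in> JX C"
proof -
  assume k: "k \<in> J"
  have kV: "k \<in> V" using k JV by blast
  show ?thesis
  proof (rule ccontr)
    assume n: "\<not> ?thesis"
    then have "bag S k \<subseteq> D" using k bag_part[OF kV] unfolding JX_def by blast
    moreover have "card (bag S k) = Suc (card (S k))"
      unfolding bag_def using finS[OF kV] Sless[OF kV] by (intro card_insert_disjoint) auto
    then have "3 \<le> card (bag S k)" using Jcard[OF k] by simp
    ultimately have "bag S k = D" using DV(2,3) by (simp add: card_seteq)
    then have "w \<in> bag S k" "k \<in> D" using D(1) by (auto simp: bag_def)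
    then have "w \<in> S k" "k \<in> D" using n by (auto simp: bag_def)
    then show False using Sless[OF kV] D(1,5,6) by fastforce
  qed
qed

text \<open>A non-empty \<open>P\<close> settles the triangle itself, and the three parts can then
  be treated independently; too low a total would be a transversal within the bound.\<close>

lemma lower: "P \<subseteq> D \<Longrightarrow> P \<noteq> {} \<Longrightarrow> 2 * card V \<le> 7 * (card P + f A P + f B P + f C P) + 1"
proof (rule ccontr)
  assume P: "P \<subseteq> D" "P \<noteq> {}" and n: "\<not> 2 * card V \<le> 7 * (card P + f A P + f B P + f C P) + 1"
  obtain TA where TA: "hits A P TA" "card TA = f A P" using f_attained by blast
  obtain TB where TB: "hits B P TB" "card TB = f B P" using f_attained by blast
  obtain TC where TC: "hits C P TC" "card TC = f C P" using f_attained by blast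
  define T where "T = P \<union> TA \<union> TB \<union> TC"
  have "transv S J T" unfolding transv_def
  proof
    fix k assume "k \<in> J"
    from JX_cover[OF this] show "bag S k \<inter> T \<noteq> {}"
    proof (elim disjE)
      assume "k = w" then show ?thesis using P unfolding T_def D_def by blast
    qed (use TA TB TC in \<open>unfold hits_def T_def, blast+\<close>)
  qed
  moreover have "T \<subseteq> V" using P DV TA TB TC parts(1-3) unfolding T_def hits_def by blast
  moreover have "card T \<le> card P + f A P + f B P + f C P"
  proof -
    have "card T \<le> card (P \<union> TA \<union> TB) + card TC" unfolding T_def by (rule card_Un_le)
    also have "card (P \<union> TA \<union> TB) \<le> card (P \<union> TA) + card TB" by (rule card_Un_le)
    also have "card (P \<union> TA) \<le> card P + card TA" by (rule card_Un_le)
    finally show ?thesis using TA(2) TB(2) TC(2) by simp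
  qed
  then have "7 * card T + 2 \<le> 2 * card V" using n unfolding distrib_left by linarith
  ultimately show False using notsmall unfolding within_bound_def by blast
qed

lemma split_T:
  assumes X: "T \<subseteq> V" "\<And>k. k \<in> JX X \<Longrightarrow> bag S k \<inter> T \<noteq> {}" "detached X"
  shows "hits X (T \<inter> D) (T \<inter> X)"
  unfolding hits_def
proof (intro conjI ballI)
  fix k assume k: "k \<in> JX X"
  have "k \<in> V" "bag S k \<inter> X \<noteq> {}" using k JV unfolding JX_def by blast+
  then have "bag S k \<subseteq> X \<union> D" using X(3) unfolding detached_def by blast
  then show "bag S k \<inter> (T \<inter> X \<union> T \<inter> D) \<noteq> {}" using X(2)[OF k] by blast
qed simp

text \<open>Dropping the requirement at \<open>w\<close> gives a transversal within the bound, and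
  it must miss the triangle. Comparison with \<open>lower\<close> for \<open>{s}\<close> leaves a
  gap of less than 7 between seven times the two price sums, so buying \<open>s\<close> lowers no
  price.\<close>

lemma f_single: "s \<in> D \<Longrightarrow> f A {s} = f A {} \<and> f B {s} = f B {} \<and> f C {s} = f C {}"
proof -
  assume s: "s \<in> D"
  have fin: "finite {k \<in> J. card (S k) = 2}" using JV finW by (auto intro: finite_subset)
  have "within_bound V S (J - {w})"
  proof (rule IH[OF _ big])
    show "triangle_sys V S (J - {w})"
      by (rule triangle_sys.intro[OF peo_sys_axioms], rule triangle_sys_axioms.intro) (use JV Jcard Mx tri in blast)+
    have "{k \<in> J - {w}. card (S k) = 2} = {k \<in> J. card (S k) = 2} - {w}" by blast
    then show "card {k \<in> J - {w}. card (S k) = 2} < card {k \<in> J. card (S k) = 2}"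
      using card_Diff1_less[OF fin, of w] w(1) D(9) by simp
  qed
  then obtain T where T: "T \<subseteq> V" "transv S (J - {w}) T" "7 * card T + 2 \<le> 2 * card V"
    unfolding within_bound_def by blast
  have TD: "T \<inter> D = {}"
  proof (rule ccontr)
    assume "T \<inter> D \<noteq> {}"
    then have "transv S J T" using T(2) unfolding transv_def D_def by blast
    then show False using T notsmall unfolding within_bound_def by blast
  qed
  have h: "hits X {} (T \<inter> X)" if "detached X" for X
    using split_T[OF T(1) _ that] T(2) TD unfolding transv_def JX_def by simp
  have finT: "finite T" using T(1) finW by (rule finite_subset)
  have "card (T \<inter> A) + card (T \<inter> B) + card (T \<inter> C) = card ((T \<inter> A \<union> T \<inter> B) \<union> T \<inter> C)"
    using finT parts(4-6) by (subst card_Un_disjoint, simp, simp, blast, subst card_Un_disjoint, simp, simp, blast, simp)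
  also have "\<dots> \<le> card T" by (rule card_mono[OF finT]) blast
  finally have "f A {} + f B {} + f C {} \<le> card T"
    using f_le[OF h[OF detached_parts(1)]] f_le[OF h[OF detached_parts(2)]] f_le[OF h[OF detached_parts(3)]] unfolding distrib_left by linarith
  then have "7 * (f A {} + f B {} + f C {}) + 2 \<le> 7 * (1 + f A {s} + f B {s} + f C {s}) + 1"
    using T(3) lower[of "{s}"] s by simp
  then have "f A {} + f B {} + f C {} \<le> f A {s} + f B {s} + f C {s}" unfolding distrib_left by linarith
  moreover have "f A {s} \<le> f A {}" "f B {s} \<le> f B {}" "f C {s} \<le> f C {}" using f_mono by blast+
  ultimately show ?thesis unfolding distrib_left by linarith
qed

lemma JX_top: "detached X \<Longrightarrow> k \<in> JX X \<Longrightarrow> k \<in> X \<union> D \<and> S k \<subseteq> X \<union> D \<and> bag S k \<subseteq> X \<union> D \<and> k \<in> V \<and> k \<in> J"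
  unfolding detached_def JX_def bag_def using JV by blast

text \<open>Joining a new vertex \<open>t\<close> to \<open>D\<close> hides the triangle in a clique
  of four vertices. It forces a purchase in \<open>D\<close> or at \<open>t\<close> without adding a
  required triangle.\<close>

lemma extended:
  assumes X: "detached X" and t: "\<forall>k\<in>V. k < t"
  shows "peo_sys {} (insert t (X \<union> D)) ((\<lambda>k. S k \<inter> (X \<union> D))(t := D)) {}"
    and "k \<in> JX X \<Longrightarrow> ((\<lambda>k. S k \<inter> (X \<union> D))(t := D)) k = S k"
    and "bag ((\<lambda>k. S k \<inter> (X \<union> D))(t := D)) t = insert t D"
    and "k \<in> insert t (JX X) \<Longrightarrow> j \<in> insert t (X \<union> D) \<Longrightarrow>
      \<not> bag ((\<lambda>k. S k \<inter> (X \<union> D))(t := D)) k \<subseteq> ((\<lambda>k. S k \<inter> (X \<union> D))(t := D)) j"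
proof -
  let ?S = "(\<lambda>k. S k \<inter> (X \<union> D))(t := D)"
  have XV: "X \<union> D \<subseteq> V" "X \<inter> D = {}" using X DV by (auto simp: detached_def)
  have tV: "t \<notin> V" using t by blast
  show "peo_sys {} (insert t (X \<union> D)) ?S {}"
  proof (rule peo_sys_add_leaf)
    show "peo_sys {} (X \<union> D) (\<lambda>k. S k \<inter> (X \<union> D)) {}" by (rule peo_sys_restrict[OF peo_sys_axioms XV(1)])
    show "k < t" if "k \<in> X \<union> D" for k using that XV t by blast
    show "a \<in> S b \<inter> (X \<union> D)" if "a \<in> D" "b \<in> D" "a < b" for a b using that D_clique by blast
  qed simp
  show same: "?S k = S k" if k: "k \<in> JX X" for k
  proof -
    have "k \<noteq> t" "S k \<subseteq> X \<union> D" using JX_top[OF X k] tV by blast+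
    then show ?thesis by auto
  qed
  show "bag ?S t = insert t D" by (simp add: bag_def)
  show "\<not> bag ?S k \<subseteq> ?S j" if k: "k \<in> insert t (JX X)" and j: "j \<in> insert t (X \<union> D)" for k j
  proof (cases "k = t")
    case True
    have "t \<notin> ?S j" using DV(1) XV tV by auto
    then show ?thesis using True by (auto simp: bag_def)
  next
    case False
    then have k': "k \<in> JX X" using k by blast
    have e: "bag ?S k = bag S k" using same[OF k'] by (simp add: bag_def)
    show ?thesis
    proof (cases "j = t")
      case True
      have "bag S k \<inter> X \<noteq> {}" using k' by (simp add: JX_def)
      then show ?thesis unfolding e using True XV(2) by auto
    next
      case False
      then have "j \<in> V" "?S j \<subseteq> S j" using j XV(1) by auto
      then show ?thesis unfolding e using Mx[of k j] JX_top[OF X k'] by blast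
    qed
  qed
qed

text \<open>A transversal that avoids \<open>D\<close> wastes a vertex on \<open>t\<close>; any
  other one buys a non-empty \<open>P\<close>. The extended part has \<open>card X + 4\<close>
  vertices, which gives 2 * 4 - 2 = 6.\<close>

lemma paid_extended:
  assumes X: "detached X" and t: "\<forall>k\<in>V. k < t"
    and small: "within_bound (insert t (X \<union> D)) ((\<lambda>k. S k \<inter> (X \<union> D))(t := D)) (insert t (JX X))"
    and single: "\<forall>s\<in>D. f X {s} = f X {}"
  shows "7 * f X {} + 1 \<le> 2 * card X \<or> (\<exists>P\<subseteq>D. P \<noteq> {} \<and> 7 * (card P + f X P) \<le> 2 * card X + 6)"
proof -
  let ?S = "(\<lambda>k. S k \<inter> (X \<union> D))(t := D)"
  have XV: "X \<union> D \<subseteq> V" "X \<inter> D = {}" "X \<subseteq> V" using X DV by (auto simp: detached_def)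
  have tV: "t \<notin> V" using t by blast
  have finX: "finite X" using XV finW by (auto intro: finite_subset)
  obtain T where T: "T \<subseteq> insert t (X \<union> D)" "transv ?S (insert t (JX X)) T" "7 * card T + 2 \<le> 2 * card (insert t (X \<union> D))"
    using small unfolding within_bound_def by blast
  have "t \<notin> X \<union> D" using XV tV by blast
  then have cV: "card (insert t (X \<union> D)) = card X + 4"
    using finX DV XV(2) by (simp add: card_Un_disjoint)
  have finT: "finite T" using T(1) finX DV by (auto intro: finite_subset)
  define P where "P = T \<inter> D"
  have h: "hits X P (T \<inter> X)" unfolding hits_def P_def
  proof (intro conjI ballI)
    fix k assume k: "k \<in> JX X"
    have e: "bag ?S k = bag S k" using extended(2)[OF X t k] by (simp add: bag_def)
    have "bag S k \<inter> T \<noteq> {}" using T(2) k unfolding transv_def e[symmetric] by blast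
    then show "bag S k \<inter> (T \<inter> X \<union> T \<inter> D) \<noteq> {}" using JX_top[OF X k] by blast
  qed simp
  have dis: "card (T \<inter> X) + card P = card (T \<inter> X \<union> P)"
    unfolding P_def using finT XV(2) by (intro card_Un_disjoint[symmetric]) auto
  have tT: "insert t D \<inter> T \<noteq> {}" using T(2) extended(3)[OF X t] unfolding transv_def by auto
  show ?thesis
  proof (cases "P = {}")
    case True
    then have "t \<in> T" using tT unfolding P_def by blast
    moreover have "t \<notin> T \<inter> X" using \<open>t \<notin> X \<union> D\<close> by blast
    ultimately have "Suc (card (T \<inter> X)) \<le> card T"
      using finT card_mono[OF finT, of "insert t (T \<inter> X)"] by simp
    moreover have "f X {} \<le> card (T \<inter> X)" using f_le[OF h] True by simp
    ultimately show ?thesis using T(3) cV unfolding distrib_left by linarith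
  next
    case False
    have "card (T \<inter> X \<union> P) \<le> card T" by (rule card_mono[OF finT]) (auto simp: P_def)
    then have "card P + f X P \<le> card T" using f_le[OF h] dis unfolding distrib_left by linarith
    then have "7 * (card P + f X P) \<le> 2 * card X + 6" using T(3) cV unfolding distrib_left by linarith
    moreover have "P \<subseteq> D" by (simp add: P_def)
    ultimately show ?thesis using False by blast
  qed
qed

lemma JX_upper: "X \<subseteq> Dw \<Longrightarrow> detached X \<Longrightarrow> k \<in> JX X \<Longrightarrow> 3 \<le> card (S k)"
proof -
  assume X: "X \<subseteq> Dw" "detached X" and k: "k \<in> JX X"
  have kV: "k \<in> V" "k \<in> J" using JX_top[OF X(2) k] by blast+
  obtain x where x: "x \<in> bag S k" "x \<in> X" using k unfolding JX_def by blast
  have "k \<in> Dw" using x X(1) Dw_up[OF _ kV(1)] by (auto simp: bag_def)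
  then have "w < k" by (rule Dw_gt)
  then have "card (S k) \<noteq> 2" using wmax[OF kV(2)] by auto
  then show ?thesis using Jcard[OF kV(2)] by simp
qed

lemma fresh: "\<exists>t. \<forall>k\<in>V. k < t"
  using finW by (intro exI[of _ "Suc (Max V)"]) (auto simp: less_Suc_eq_le)

lemma upper_extended:
  assumes X: "detached X" "X \<subseteq> Dw" "X \<noteq> {}" and t: "\<forall>k\<in>V. k < t"
  shows "within_bound (insert t (X \<union> D)) ((\<lambda>k. S k \<inter> (X \<union> D))(t := D)) (insert t (JX X))"
proof -
  let ?S = "(\<lambda>k. S k \<inter> (X \<union> D))(t := D)"
  interpret e: peo_sys "{}" "insert t (X \<union> D)" ?S "{}" by (rule extended(1)[OF X(1) t])
  have XV: "X \<union> D \<subseteq> V" "X \<inter> D = {}" "X \<subseteq> V" using X DV by (auto simp: detached_def)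
  have finX: "finite X" using XV finW by (auto intro: finite_subset)
  have c3: "3 \<le> card (?S k)" if k: "k \<in> insert t (JX X)" for k
  proof (cases "k = t")
    case False
    then have k': "k \<in> JX X" using k by blast
    show ?thesis unfolding extended(2)[OF X(1) t k'] by (rule JX_upper[OF X(2,1) k'])
  qed (use DV in simp)
  have Jsub: "insert t (JX X) \<subseteq> insert t (X \<union> D)" using JX_top[OF X(1)] by blast
  have "bsys (insert t (X \<union> D)) ?S (insert t (JX X))"
  proof (rule bsys.intro)
    show "peo_sys {} (insert t (X \<union> D)) ?S (insert t (JX X))"
      by (rule peo_sys.intro[OF e.finK e.finW e.KW e.Ssub e.Sless e.peo Jsub c3])
    show "bsys_axioms (insert t (X \<union> D)) ?S (insert t (JX X))"
      by (rule bsys_axioms.intro) (rule extended(4)[OF X(1) t])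
  qed
  then have st: "small_transversal (insert t (X \<union> D)) ?S (insert t (JX X))" by (rule small_transversal_exists)
  have "t \<notin> X \<union> D" using XV t by blast
  then have "card (insert t (X \<union> D)) = card X + 4" using finX DV XV(2) by (simp add: card_Un_disjoint)
  moreover have "0 < card X" using X(3) finX by (simp add: card_gt_0_iff)
  ultimately show ?thesis using st unfolding small_transversal_def within_bound_def ok_def by auto
qed

text \<open>With the triangle as a root in three colours, each \<open>U i\<close> solves the part
  with one vertex of \<open>D\<close> bought. By \<open>single\<close> it also costs at least
  \<open>f X {}\<close>, which is therefore at most the average.\<close>

lemma upper_rooted:
  assumes X: "detached X" "X \<subseteq> Dw" and single: "\<forall>s\<in>D. f X {s} = f X {}"
  shows "7 * f X {} \<le> 2 * card X"
proof -
  have XV: "X \<union> D \<subseteq> V" "X \<inter> D = {}" "X \<subseteq> V" using X DV by (auto simp: detached_def)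
  have finX: "finite X" using XV finW by (auto intro: finite_subset)
  have c3: "3 \<le> card (S k)" if "k \<in> JX X" for k by (rule JX_upper[OF X(2,1) that])
  have "bsys V S (JX X)"
  proof (rule bsys.intro)
    have JXV: "JX X \<subseteq> V" using JV by (auto simp: JX_def)
    show "peo_sys {} V S (JX X)" by (rule peo_sys.intro[OF finK finW KW Ssub Sless peo JXV c3])
    show "bsys_axioms V S (JX X)" by (rule bsys_axioms.intro, rule Mx) (auto simp: JX_def)
  qed
  then interpret b: bsys V S "JX X" .
  define c where "c q = (if q = u then 0 else if q = v then 1 else (2::nat))" for q
  have injc: "inj_on c D" using D(1,7,8) w(3) by (auto simp: inj_on_def c_def)
  have rng: "c ` D \<subseteq> {..<3}" by (auto simp: c_def)
  have CX: "maxclique (X \<union> D) (sysE S) Q \<and> \<not> Q \<subseteq> D \<and> 4 \<le> card (Q - D) + card (c ` (Q \<inter> D))"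
    if Q: "Q \<in> bag S ` JX X" for Q
  proof -
    obtain k where k: "k \<in> JX X" "Q = bag S k" using Q by blast
    have kV: "k \<in> V" "bag S k \<subseteq> X \<union> D" using JX_top[OF X(1) k(1)] by blast+
    have fin: "finite Q" unfolding k(2) bag_def using finS[OF kV(1)] by simp
    have "card Q = Suc (card (S k))"
      unfolding k(2) bag_def using finS[OF kV(1)] Sless[OF kV(1)] by (intro card_insert_disjoint) auto
    then have "4 \<le> card Q" using c3[OF k(1)] by simp
    moreover have "card Q = card (Q - D) + card (Q \<inter> D)" using fin by (metis Int_commute card_Int_Diff add.commute)
    moreover have "card (c ` (Q \<inter> D)) = card (Q \<inter> D)" by (rule card_image) (use injc in \<open>auto simp: inj_on_def\<close>)
    moreover have "maxclique (X \<union> D) (sysE S) Q" unfolding k(2) by (rule b.bag_maxclique[OF k(1) XV(1) kV(2)])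
    moreover have "\<not> Q \<subseteq> D" using k XV(2) unfolding JX_def by blast
    ultimately show ?thesis by simp
  qed
  have pw: "pairwise (sysE S) D" unfolding D_def by (rule b.bag_pairwise[OF D(4)])
  have fs: "finite (X \<union> D)" "D \<subseteq> X \<union> D" using finX DV by auto
  have "\<exists>U. (\<forall>i<3. U i \<subseteq> X \<union> D - D \<and> (\<forall>Q\<in>bag S ` JX X. Q \<inter> (U i \<union> {q \<in> D. c q = i}) \<noteq> {})) \<and>
     7 * (\<Sum>i<3. card (U i)) \<le> 6 * card (X \<union> D - D)"
    by (rule clique_rooted_transversals[OF fs(1) symp_sysE dismantlable_subset[OF b.dismantlable_sysE XV(1)] pw fs(2) rng CX])
  then obtain U where "(\<forall>i<3. U i \<subseteq> X \<union> D - D \<and> (\<forall>Q\<in>bag S ` JX X. Q \<inter> (U i \<union> {q \<in> D. c q = i}) \<noteq> {})) \<and>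
     7 * (\<Sum>i<3. card (U i)) \<le> 6 * card (X \<union> D - D)" by (rule exE)
  note U = conjunct1[OF this] conjunct2[OF this]
  have XD: "X \<union> D - D = X" using XV(2) by blast
  have "f X {} \<le> card (U i)" if i: "i < 3" for i
  proof -
    obtain q where q: "q \<in> D" "c q = i"
    proof -
      have "i = 0 \<or> i = 1 \<or> i = 2" using i by auto
      moreover have "c u = 0" "c v = 1" "c w = 2" using D(7,8) w(3) by (auto simp: c_def)
      ultimately show thesis using that D(1) by blast
    qed
    have e: "{q \<in> D. c q = i} = {q}" using injc q by (auto simp: inj_on_def)
    have Ui: "U i \<subseteq> X" "\<And>Q. Q \<in> bag S ` JX X \<Longrightarrow> Q \<inter> (U i \<union> {q}) \<noteq> {}"
      using U(1) i unfolding XD e[symmetric] by blast+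
    have "hits X {q} (U i)" unfolding hits_def using Ui(1) Ui(2)[OF imageI] by blast
    then show ?thesis using f_le single q(1) by metis
  qed
  then have "(\<Sum>i<3::nat. f X {}) \<le> (\<Sum>i<3. card (U i))" by (intro sum_mono) auto
  then show ?thesis using U(2) unfolding XD by simp
qed

text \<open>If the larger clique lay below \<open>w\<close>, the edge it shares with the triangle at
  \<open>k\<close> would have to be the one between \<open>u\<close> and \<open>v\<close>, against
  \<open>not_both\<close>.\<close>

lemma A_tri:
  assumes k: "k \<in> JX A" "card (S k) = 2" and xy: "x \<in> bag S k" "y \<in> bag S k" "x \<noteq> y"
  shows "\<exists>j\<in>A \<union> D. 3 \<le> card (S j) \<and> S j \<subseteq> A \<union> D \<and> x \<in> bag S j \<and> y \<in> bag S j"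
proof -
  have kV: "k \<in> V" "k \<in> J" "k \<noteq> w" "bag S k \<subseteq> A \<union> D" using JX_top[OF detached_parts(1) k(1)] k(1) by (auto simp: JX_def)
  obtain j where j: "j \<in> V" "3 \<le> card (S j)" "x \<in> bag S j" "y \<in> bag S j" using tri[OF kV(2) k(2) xy] by blast
  have wk: "w \<notin> bag S k"
  proof
    assume "w \<in> bag S k"
    then have "k \<in> Dw" using kV(3) Dw_base[OF kV(1)] by (auto simp: bag_def)
    moreover have "k \<in> bag S k" by (simp add: bag_def)
    ultimately show False using kV(4) Dw_D unfolding A_def by blast
  qed
  have jD: "j \<notin> Dw"
  proof
    assume a: "j \<in> Dw"
    have lowbag: "s \<in> {u, v} \<and> s \<in> S j" if s: "s \<in> bag S k" "s \<in> bag S j" for s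
    proof -
      have "s \<notin> Dw" using s(1) kV(4) Dw_D unfolding A_def by blast
      then have "s \<in> S j" "s \<in> D" using s(2) a Dw_path[OF a, of s] by (auto simp: bag_def)
      then show ?thesis using D(1) s(1) wk by auto
    qed
    have "x \<in> {u, v}" "y \<in> {u, v}" "x \<in> S j" "y \<in> S j" using lowbag xy(1,2) j(3,4) by blast+
    then have "u \<in> S j" "v \<in> S j" using xy(3) by auto
    then show False by (rule not_both[OF a])
  qed
  have "bag S j \<subseteq> A \<union> D" by (rule low_bag[OF j(1) jD])
  then show ?thesis using j unfolding bag_def by blast
qed

lemma triangles_less:
  assumes "K \<subseteq> J - {w}" "\<And>k. k \<in> K \<Longrightarrow> S' k = S k" "\<And>t. t \<in> J' \<Longrightarrow> card (S' t) = 2 \<Longrightarrow> t \<in> K"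
  shows "card {k \<in> J'. card (S' k) = 2} < card {k \<in> J. card (S k) = 2}"
proof (rule psubset_card_mono)
  show "finite {k \<in> J. card (S k) = 2}" using JV finW by (auto intro: finite_subset)
  have "{k \<in> J'. card (S' k) = 2} \<subseteq> {k \<in> J. card (S k) = 2} - {w}"
  proof
    fix k assume "k \<in> {k \<in> J'. card (S' k) = 2}"
    then have k: "k \<in> K" "card (S' k) = 2" using assms(3) by blast+
    then show "k \<in> {k \<in> J. card (S k) = 2} - {w}" using assms(1) assms(2)[OF k(1)] by auto
  qed
  then show "{k \<in> J'. card (S' k) = 2} \<subset> {k \<in> J. card (S k) = 2}" using w(1) D(9) by blast
qed

text \<open>\<open>A\<close> may contain further required triangles, so here the bound comes from
  the induction hypothesis: the triangle at \<open>w\<close> is gone and none is new.\<close>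

lemma A_extended:
  assumes t: "\<forall>k\<in>V. k < t"
  shows "within_bound (insert t (A \<union> D)) ((\<lambda>k. S k \<inter> (A \<union> D))(t := D)) (insert t (JX A))"
proof (rule IH)
  let ?S = "(\<lambda>k. S k \<inter> (A \<union> D))(t := D)"
  note X = detached_parts(1)
  have tV: "t \<notin> V" using t by blast
  have same: "?S j = S j" if "j \<in> A \<union> D" "S j \<subseteq> A \<union> D" for j
    using that parts(1) DV(1) tV by auto
  show "triangle_sys (insert t (A \<union> D)) ?S (insert t (JX A))"
  proof (rule triangle_sys.intro[OF extended(1)[OF X t]], rule triangle_sys_axioms.intro)
    show "insert t (JX A) \<subseteq> insert t (A \<union> D)" using JX_top[OF X] by blast
    show "2 \<le> card (?S k)" if "k \<in> insert t (JX A)" for k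
    proof (cases "k = t")
      case False
      then have k: "k \<in> JX A" using that by blast
      show ?thesis unfolding extended(2)[OF X t k] using Jcard k by (auto simp: JX_def)
    qed (use DV in simp)
    show "\<not> bag ?S k \<subseteq> ?S j" if "k \<in> insert t (JX A)" "j \<in> insert t (A \<union> D)" for k j
      by (rule extended(4)[OF X t that])
    fix k x y assume k: "k \<in> insert t (JX A)" "card (?S k) = 2" and xy: "x \<in> bag ?S k" "y \<in> bag ?S k" "x \<noteq> y"
    have "k \<noteq> t" using k(2) DV(3) by auto
    then have k': "k \<in> JX A" using k(1) by blast
    note e = extended(2)[OF X t k']
    have "card (S k) = 2" "x \<in> bag S k" "y \<in> bag S k" using k(2) xy e by (simp_all add: bag_def)
    from A_tri[OF k' this xy(3)] obtain j where j: "j \<in> A \<union> D" "3 \<le> card (S j)" "S j \<subseteq> A \<union> D" "x \<in> bag S j" "y \<in> bag S j" by blast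
    have "bag ?S j = bag S j" using same[OF j(1,3)] by (simp add: bag_def)
    then show "\<exists>j\<in>insert t (A \<union> D). 3 \<le> card (?S j) \<and> x \<in> bag ?S j \<and> y \<in> bag ?S j"
      using j same[OF j(1,3)] by (intro bexI[of _ j]) auto
  qed
  have "t \<notin> A \<union> D" using parts(1) DV(1) tV by blast
  then show "5 \<le> card (insert t (A \<union> D))"
    using part_nonempty(1) parts(7,11) DV by (simp add: card_Un_disjoint)
  show "card {k \<in> insert t (JX A). card (?S k) = 2} < card {k \<in> J. card (S k) = 2}"
  proof (rule triangles_less[of "JX A"])
    show "JX A \<subseteq> J - {w}" by (auto simp: JX_def)
    show "?S k = S k" if "k \<in> JX A" for k by (rule extended(2)[OF X t that])
    show "k \<in> JX A" if "k \<in> insert t (JX A)" "card (?S k) = 2" for k using that DV(3) by (auto split: if_splits)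
  qed
qed

text \<open>The same part without \<open>t\<close> has \<open>card A + 3\<close> vertices, at least
  five, and the slack becomes 2 * 3 - 2 = 4.\<close>

lemma A_plain:
  "7 * f A {} \<le> 2 * card A + 4 \<or> (\<exists>P\<subseteq>D. P \<noteq> {} \<and> 7 * (card P + f A P) \<le> 2 * card A + 4)"
proof -
  let ?S = "\<lambda>k. S k \<inter> (A \<union> D)"
  note X = detached_parts(1)
  have AV: "A \<union> D \<subseteq> V" using parts(1) DV(1) by blast
  have same: "?S j = S j" if "S j \<subseteq> A \<union> D" for j using that by blast
  have e: "?S k = S k" if "k \<in> JX A" for k using JX_top[OF X that] by blast
  have c: "card (A \<union> D) = card A + 3" using parts(7,11) DV by (simp add: card_Un_disjoint)
  have "within_bound (A \<union> D) ?S (JX A)"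
  proof (rule IH)
    show "triangle_sys (A \<union> D) ?S (JX A)"
    proof (rule triangle_sys.intro[OF peo_sys_restrict[OF peo_sys_axioms AV]], rule triangle_sys_axioms.intro)
      show "JX A \<subseteq> A \<union> D" using JX_top[OF X] by blast
      show "2 \<le> card (?S k)" if "k \<in> JX A" for k unfolding e[OF that] using Jcard that by (auto simp: JX_def)
      show "\<not> bag ?S k \<subseteq> ?S j" if k: "k \<in> JX A" "j \<in> A \<union> D" for k j
      proof -
        have "bag ?S k = bag S k" using e[OF k(1)] by (simp add: bag_def)
        then show ?thesis using Mx[of k j] JX_top[OF X k(1)] k(2) AV by blast
      qed
      fix k x y assume k: "k \<in> JX A" "card (?S k) = 2" and xy: "x \<in> bag ?S k" "y \<in> bag ?S k" "x \<noteq> y"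
      have "card (S k) = 2" "x \<in> bag S k" "y \<in> bag S k" using k(2) xy e[OF k(1)] by (simp_all add: bag_def)
      from A_tri[OF k(1) this xy(3)] obtain j where j: "j \<in> A \<union> D" "3 \<le> card (S j)" "S j \<subseteq> A \<union> D" "x \<in> bag S j" "y \<in> bag S j" by blast
      have "bag ?S j = bag S j" using same[OF j(3)] by (simp add: bag_def)
      then show "\<exists>j\<in>A \<union> D. 3 \<le> card (?S j) \<and> x \<in> bag ?S j \<and> y \<in> bag ?S j"
        using j same[OF j(3)] by (intro bexI[of _ j]) auto
    qed
    show "5 \<le> card (A \<union> D)" using c part_nonempty(1) by simp
    show "card {k \<in> JX A. card (?S k) = 2} < card {k \<in> J. card (S k) = 2}"
      by (rule triangles_less[of "JX A"]) (use e in \<open>auto simp: JX_def\<close>)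
  qed
  then obtain T where T: "T \<subseteq> A \<union> D" "transv ?S (JX A) T" "7 * card T + 2 \<le> 2 * card (A \<union> D)"
    unfolding within_bound_def by blast
  have finT: "finite T" using T(1) AV finW by (meson finite_subset)
  have h: "hits A (T \<inter> D) (T \<inter> A)"
  proof (rule split_T[OF _ _ X])
    show "T \<subseteq> V" using T(1) AV by blast
    show "bag S k \<inter> T \<noteq> {}" if k: "k \<in> JX A" for k
    proof -
      have "bag ?S k = bag S k" using e[OF k] by (simp add: bag_def)
      then show ?thesis using T(2) k unfolding transv_def by metis
    qed
  qed
  have "card (T \<inter> A) + card (T \<inter> D) = card (T \<inter> A \<union> T \<inter> D)"
    using finT parts(7) by (intro card_Un_disjoint[symmetric]) auto
  also have "\<dots> \<le> card T" by (rule card_mono[OF finT]) auto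
  finally have le: "card (T \<inter> D) + f A (T \<inter> D) \<le> card T" using f_le[OF h] unfolding distrib_left by linarith
  then have "7 * (card (T \<inter> D) + f A (T \<inter> D)) \<le> 2 * card A + 4" using T(3) c unfolding distrib_left by linarith
  then show ?thesis by (cases "T \<inter> D = {}") auto
qed

lemma triangle_min_counterexample_False: False
proof -
  obtain t where t: "\<forall>k\<in>V. k < t" using fresh by blast
  have BD: "B \<subseteq> Dw" by (auto simp: B_def)
  note s = f_single
  have sA: "\<forall>q\<in>D. f A {q} = f A {}" and sB: "\<forall>q\<in>D. f B {q} = f B {}" and sC: "\<forall>q\<in>D. f C {q} = f C {}"
    using s by blast+
  have rB: "7 * f B {} \<le> 2 * card B" by (rule upper_rooted[OF detached_parts(2) BD sB])
  have rC: "7 * f C {} \<le> 2 * card C" by (rule upper_rooted[OF detached_parts(3) C_Dw sC])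
  note zA = paid_extended[OF detached_parts(1) t A_extended[OF t] sA]
  note zB = paid_extended[OF detached_parts(2) t upper_extended[OF detached_parts(2) BD part_nonempty(2) t] sB]
  note zC = paid_extended[OF detached_parts(3) t upper_extended[OF detached_parts(3) C_Dw part_nonempty(3) t] sC]
  have mono: "f X P \<le> f X {}" for X P by (rule f_mono) simp
  \<comment> \<open>A contradiction arises as soon as, for some non-empty \<open>P\<close>, seven
    times the total price exceeds twice the sizes of the parts by at most 4.\<close>
  have low: "2 * (card A + card B + card C) + 5 \<le> 7 * (card P + f A P + f B P + f C P)" if "P \<subseteq> D" "P \<noteq> {}" for P
    using lower[OF that] card_parts unfolding distrib_left by linarith
  have alpha: "7 * f A {} \<le> 2 * card A + 4"
  proof (rule ccontr)
    assume "\<not> ?thesis"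
    then obtain P where P: "P \<subseteq> D" "P \<noteq> {}" "7 * (card P + f A P) \<le> 2 * card A + 4" using A_plain by blast
    show False using low[OF P(1,2)] P(3) mono[of B P] mono[of C P] rB rC unfolding distrib_left by linarith
  qed
  \<comment> \<open>If this failed, some \<open>P\<close> would be fully paid by what it saves in
    \<open>B\<close>, and the total excess would be only the 4 from \<open>alpha\<close>.\<close>
  have b1: "7 * f B {} + 1 \<le> 2 * card B"
  proof (rule ccontr)
    assume n: "\<not> ?thesis"
    then obtain P where P: "P \<subseteq> D" "P \<noteq> {}" "7 * (card P + f B P) \<le> 2 * card B + 6" using zB by blast
    have "7 * (card P + f B P) \<le> 7 * f B {} + 6" using P(3) n rB unfolding distrib_left by linarith
    then have "card P + f B P \<le> f B {}" unfolding distrib_left by linarith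
    then show False using low[OF P(1,2)] mono[of A P] mono[of C P] alpha rB rC unfolding distrib_left by linarith
  qed
  have c1: "7 * f C {} + 1 \<le> 2 * card C"
  proof (rule ccontr)
    assume n: "\<not> ?thesis"
    then obtain P where P: "P \<subseteq> D" "P \<noteq> {}" "7 * (card P + f C P) \<le> 2 * card C + 6" using zC by blast
    have "7 * (card P + f C P) \<le> 7 * f C {} + 6" using P(3) n rC unfolding distrib_left by linarith
    then have "card P + f C P \<le> f C {}" unfolding distrib_left by linarith
    then show False using low[OF P(1,2)] mono[of A P] mono[of B P] alpha rB rC unfolding distrib_left by linarith
  qed
  \<comment> \<open>Both alternatives bring the excess down to 4: buying \<open>w\<close> costs 7
    and the three parts save 1 each; or \<open>P\<close> together with \<open>A\<close> costs 6 and
    the other two parts save 1 each.\<close>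
  from zA show False
  proof
    assume a1: "7 * f A {} + 1 \<le> 2 * card A"
    have "w \<in> D" by (simp add: D(1))
    then show False using low[of "{w}"] sA sB sC a1 b1 c1 by simp
  next
    assume "\<exists>P\<subseteq>D. P \<noteq> {} \<and> 7 * (card P + f A P) \<le> 2 * card A + 6"
    then obtain P where P: "P \<subseteq> D" "P \<noteq> {}" "7 * (card P + f A P) \<le> 2 * card A + 6" by blast
    show False using low[OF P(1,2)] P(3) mono[of B P] mono[of C P] b1 c1 unfolding distrib_left by linarith
  qed
qed

end

theorem within_bound_exists:
  assumes "triangle_sys V S J" "5 \<le> card V" shows "within_bound V S J"
  using assms
proof (induction "card {k \<in> J. card (S k) = 2}" arbitrary: V S J rule: less_induct)
  case less
  interpret triangle_sys V S J by (rule less.prems(1))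
  define Tr where "Tr = {k \<in> J. card (S k) = 2}"
  have finT: "finite Tr" unfolding Tr_def using JV finW by (auto intro: finite_subset)
  show ?case
  proof (cases "Tr = {}")
    case True
    then show ?thesis using no_triangle_small[OF _ less.prems(2)] unfolding Tr_def by blast
  next
    case False
    define w where "w = Max Tr"
    have "w \<in> Tr" unfolding w_def by (rule Max_in[OF finT False])
    then have w: "w \<in> J" "card (S w) = 2" by (simp_all add: Tr_def)
    obtain u v where uv: "S w = {u, v}" "u \<noteq> v" using w(2) by (auto simp: card_2_iff)
    have wmax: "k \<le> w" if "k \<in> J" "card (S k) = 2" for k
      unfolding w_def by (rule Max_ge[OF finT]) (use that in \<open>simp add: Tr_def\<close>)
    show ?thesis
    proof (rule ccontr)
      assume n: "\<not> within_bound V S J"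
      have "triangle_min_counterexample V S J w u v"
        by (rule triangle_min_counterexample.intro[OF less.prems(1)], rule triangle_min_counterexample_axioms.intro[OF less.prems(2) n less.hyps])
          (use w uv wmax in auto)
      then show False by (rule triangle_min_counterexample.triangle_min_counterexample_False)
    qed
  qed
qed

section \<open>Chordal graphs have simplicial vertices\<close>

definition chordless :: "('a \<Rightarrow> 'a \<Rightarrow> bool) \<Rightarrow> 'a list \<Rightarrow> bool" where
  "chordless E ws \<longleftrightarrow> (\<forall>as a bs b cs. ws = as @ a # bs @ b # cs \<longrightarrow> E a b \<longrightarrow> bs = [])"

text \<open>An induced cycle of length at least four, cut open at \<open>v\<close>: the other
  vertices form a chordless path whose ends alone are adjacent to \<open>v\<close>.\<close>

definition hole :: "'a set \<Rightarrow> ('a \<Rightarrow> 'a \<Rightarrow> bool) \<Rightarrow> 'a \<Rightarrow> 'a list \<Rightarrow> bool" where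
  "hole V E v ws \<longleftrightarrow> set (v # ws) \<subseteq> V \<and> distinct (v # ws) \<and> 3 \<le> length ws \<and>
     successively E ws \<and> chordless E ws \<and> E v (hd ws) \<and> E (last ws) v \<and>
     (\<forall>a\<in>set ws. E v a \<longrightarrow> a = hd ws \<or> a = last ws)"

text \<open>In a walk of minimal length between the given ends, a repeated vertex or a chord would
  give a shortcut.\<close>

lemma shortest_walk:
  assumes "successively E ws" "ws \<noteq> []" "hd ws = x" "last ws = y" "set ws \<subseteq> X"
  shows "\<exists>us. successively E us \<and> us \<noteq> [] \<and> hd us = x \<and> last us = y \<and> set us \<subseteq> X \<and> distinct us \<and> chordless E us"
proof -
  let ?P = "\<lambda>us. successively E us \<and> us \<noteq> [] \<and> hd us = x \<and> last us = y \<and> set us \<subseteq> X"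
  obtain us where us: "?P us" and least: "\<And>vs. ?P vs \<Longrightarrow> length us \<le> length vs"
    using ex_has_least_nat[of ?P ws length] assms by blast
  have "distinct us"
  proof (rule ccontr)
    assume "\<not> distinct us"
    then obtain as bs cs a where d: "us = as @ [a] @ bs @ [a] @ cs" using not_distinct_decomp by blast
    have "?P (as @ a # cs)"
      using us unfolding d
      by (cases as; cases cs rule: rev_cases) (auto simp: successively_append_iff successively_Cons hd_append split: if_splits)
    then show False using least[of "as @ a # cs"] d by simp
  qed
  moreover have "chordless E us" unfolding chordless_def
  proof (intro allI impI)
    fix as a bs b cs assume d: "us = as @ a # bs @ b # cs" and e: "E a b"
    have "?P (as @ a # b # cs)"
      using us e unfolding d
      by (cases as; cases cs rule: rev_cases) (auto simp: successively_append_iff successively_Cons hd_append split: if_splits)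
    then show "bs = []" using least[of "as @ a # b # cs"] d by simp
  qed
  ultimately show ?thesis using us by blast
qed

lemma walk_in_component:
  assumes "(x, y) \<in> R\<^sup>*" "\<And>a b. (a, b) \<in> R \<Longrightarrow> E a b" "x \<in> X" "\<And>a b. a \<in> X \<Longrightarrow> (a, b) \<in> R \<Longrightarrow> b \<in> X"
  shows "\<exists>ws. successively E ws \<and> ws \<noteq> [] \<and> hd ws = x \<and> last ws = y \<and> set ws \<subseteq> X"
  using assms(1)
proof (induction rule: rtrancl_induct)
  case base
  then show ?case using assms(3) by (intro exI[of _ "[x]"]) simp
next
  case (step y z)
  then obtain ws where ws: "successively E ws" "ws \<noteq> []" "hd ws = x" "last ws = y" "set ws \<subseteq> X" by blast
  have "y \<in> X" using ws(2,4,5) by (metis last_in_set subsetD)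
  then have "z \<in> X" using assms(4) step(2) by blast
  then show ?case using ws assms(2)[OF step(2)]
    by (intro exI[of _ "ws @ [z]"]) (auto simp: successively_append_iff)
qed

text \<open>Dirac's argument: the neighbourhood of a component of the non-neighbours of a vertex \<open>v\<close> lies
  in the neighbourhood of \<open>v\<close> and is a clique, since otherwise a shortest path through the
  component closes to a hole at \<open>v\<close>.\<close>

lemma simplicial_exists:
  assumes fin: "finite U" and sym: "symp E" and irr: "\<And>a. \<not> E a a"
    and no: "\<And>v ws. \<not> hole U E v ws" and ne: "U \<noteq> {}"
  shows "\<exists>v. simplicial_in U E v"
  using assms
proof (induction "card U" arbitrary: U rule: less_induct)
  case less
  note sym = less.prems(2) and irr = less.prems(3) and no = less.prems(4)
  show ?case
  proof (cases "pairwise E U")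
    case True
    obtain v where "v \<in> U" using less.prems(5) by blast
    then have "simplicial_in U E v" using True by (simp add: simplicial_in_def pairwise_def)
    then show ?thesis by (rule exI)
  next
    case False
    then obtain v a where v: "v \<in> U" "a \<in> U" "v \<noteq> a" "\<not> E v a" unfolding pairwise_def by metis
    define D where "D = {u \<in> U. u \<noteq> v \<and> \<not> E v u}"
    define R where "R = {(x, y). x \<in> D \<and> y \<in> D \<and> E x y}"
    define C where "C = {u. (a, u) \<in> R\<^sup>*}"
    define N where "N = {x \<in> U - C. \<exists>c\<in>C. E x c}"
    have aC: "a \<in> C" by (simp add: C_def)
    have aD: "a \<in> D" using v by (simp add: D_def)
    have CD: "C \<subseteq> D"
    proof
      fix u assume "u \<in> C"
      then have "(a, u) \<in> R\<^sup>*" by (simp add: C_def)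
      then show "u \<in> D" by (induction rule: rtrancl_induct) (use aD in \<open>auto simp: R_def\<close>)
    qed
    have Cstep: "y \<in> C" if "x \<in> C" "(x, y) \<in> R" for x y
      using that unfolding C_def by (simp add: rtrancl.rtrancl_into_rtrancl)
    have symR: "sym R" using sympD[OF sym] by (auto simp: R_def sym_def)
    have Nv: "E v x" if x: "x \<in> N" for x
    proof (rule ccontr)
      assume nE: "\<not> E v x"
      obtain c where c: "c \<in> C" "E x c" "x \<in> U" "x \<notin> C" using x by (auto simp: N_def)
      have "x \<noteq> v" using c CD sympD[OF sym, of x c] nE by (auto simp: D_def)
      then have "(c, x) \<in> R" using c CD nE sympD[OF sym c(2)] by (auto simp: R_def D_def)
      then show False using Cstep c by blast
    qed
    have vC: "v \<notin> C" using CD by (auto simp: D_def)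
    have vN: "v \<notin> N"
    proof
      assume "v \<in> N"
      then show False using CD by (auto simp: N_def D_def)
    qed
    have clN: "pairwise E N"
    proof (rule pairwiseI, rule ccontr)
      fix x y assume xy: "x \<in> N" "y \<in> N" "x \<noteq> y" "\<not> E x y"
      obtain c where c: "c \<in> C" "E x c" using xy(1) by (auto simp: N_def)
      obtain d where d: "d \<in> C" "E y d" using xy(2) by (auto simp: N_def)
      have xyU: "x \<in> U" "y \<in> U" "x \<notin> C" "y \<notin> C" using xy by (auto simp: N_def)
      have "(c, a) \<in> R\<^sup>*" using c(1) sym_rtrancl[OF symR] by (simp add: C_def sym_def)
      then have cd: "(c, d) \<in> R\<^sup>*" using d(1) by (simp add: C_def)
      obtain us where us: "successively E us" "us \<noteq> []" "hd us = c" "last us = d" "set us \<subseteq> C"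
        using walk_in_component[OF cd _ c(1), of E] Cstep by (auto simp: R_def)
      have "successively E (x # us @ [y])"
        using us c(2) sympD[OF sym d(2)] by (auto simp: successively_append_iff successively_Cons)
      moreover have "hd (x # us @ [y]) = x" "last (x # us @ [y]) = y" "set (x # us @ [y]) \<subseteq> insert x (insert y C)"
        using us(5) by auto
      ultimately obtain ws where ws: "successively E ws" "ws \<noteq> []" "hd ws = x" "last ws = y"
        "set ws \<subseteq> insert x (insert y C)" "distinct ws" "chordless E ws"
        using shortest_walk[of E "x # us @ [y]" x y "insert x (insert y C)"] by blast
      have "3 \<le> length ws"
      proof (rule ccontr)
        assume "\<not> ?thesis"
        moreover have "0 < length ws" using ws(2) by simp
        ultimately have "length ws = 1 \<or> length ws = 2" by linarith
        then show False using ws(1,3,4) xy(3,4) by (auto simp: length_Suc_conv numeral_2_eq_2)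
      qed
      moreover have "v \<notin> set ws" using ws(5) vC vN xy(1,2) by blast
      moreover have "\<forall>b\<in>set ws. E v b \<longrightarrow> b = hd ws \<or> b = last ws" using ws(3,4,5) CD by (auto simp: D_def)
      moreover have "set ws \<subseteq> U" using ws(5) xyU CD by (auto simp: D_def)
      ultimately have "hole U E v ws"
        using ws v(1) Nv[OF xy(1)] sympD[OF sym Nv[OF xy(2)]] by (simp add: hole_def)
      then show False using no by blast
    qed
    have sub: "C \<union> N \<subseteq> U - {v}" using CD vC vN by (auto simp: D_def N_def)
    have cl: "card (U - {v}) < card U" using v(1) less.prems(1) by (metis card_Diff1_less)
    have dis: "dismantlable (C \<union> N) E" unfolding dismantlable_def
    proof (intro allI impI)
      fix X assume X: "X \<subseteq> C \<union> N" "X \<noteq> {}"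
      have XU: "X \<subseteq> U - {v}" using X(1) sub by blast
      have "card X \<le> card (U - {v})" by (rule card_mono) (use XU less.prems(1) in auto)
      then have lt: "card X < card U" using cl by simp
      have finX: "finite X" using XU less.prems(1) by (auto intro: finite_subset)
      have "\<not> hole X E y ws" for y ws
      proof
        assume "hole X E y ws"
        then have "hole U E y ws" using XU unfolding hole_def by blast
        then show False using no by blast
      qed
      then show "\<exists>v. simplicial_in X E v" by (rule less.hyps[OF lt finX sym irr _ X(2)])
    qed
    have "N \<noteq> C \<union> N" using aC by (auto simp: N_def)
    \<comment> \<open>\<open>N\<close> is a clique, so a simplicial vertex can be chosen in the
      component \<open>C\<close>. All its neighbours in \<open>U\<close> lie in \<open>C\<close> or
      \<open>N\<close>, hence it is simplicial in \<open>U\<close>.\<close>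
    then obtain s where s: "s \<in> C \<union> N" "s \<notin> N" "simplicial_in (C \<union> N) E s"
      using simplicial_outside_clique[OF _ sym dis clN] sub less.prems(1) finite_subset[OF sub] by blast
    have nb: "b \<in> C \<union> N" if "b \<in> U" "E s b" for b
      using that s(1,2) sympD[OF sym that(2)] by (auto simp: N_def)
    have "simplicial_in U E s" unfolding simplicial_in_def
    proof (intro conjI ballI impI)
      show "s \<in> U" using s(1) sub by blast
      fix b c assume "b \<in> U" "c \<in> U" "E s b" "E s c" "b \<noteq> c"
      then show "E b c" using s(3) nb unfolding simplicial_in_def by metis
    qed
    then show ?thesis by (rule exI)
  qed
qed

section \<open>From holes to induced cycles as lists of arcs\<close>

lemma pcas_zip: "pcas u (zip (u # ws) ws) (last (u # ws))"
  by (induction ws arbitrary: u) auto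

lemma pawalk_verts_zip: "pawalk_verts u (zip (u # ws) ws) = u # ws"
  by (induction ws arbitrary: u) auto

lemma successively_zip: "successively E (u # ws) \<longleftrightarrow> (\<forall>(a, b)\<in>set (zip (u # ws) ws). E a b)"
  by (induction ws arbitrary: u) (auto simp: successively_Cons)

lemma consecutive_in_zip: "u # ws = as @ a # b # cs \<Longrightarrow> (a, b) \<in> set (zip (u # ws) ws)"
proof (induction as arbitrary: u ws)
  case (Cons x as)
  then have ws: "ws = as @ a # b # cs" by simp
  then obtain u' ws' where w: "ws = u' # ws'" by (cases as) auto
  have "(a, b) \<in> set (zip (u' # ws') ws')" by (rule Cons.IH) (use ws w in simp)
  then show ?case unfolding w by simp
qed simp

lemma fst_zip_closed: "fst ` set (zip (v # ws @ [v]) (ws @ [v])) = set (v # ws)"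
proof -
  have "map fst (zip (v # ws @ [v]) (ws @ [v])) = take (length (ws @ [v])) (v # ws @ [v])" by (simp add: map_fst_zip_take)
  also have "\<dots> = v # ws" by simp
  finally have "set (map fst (zip (v # ws @ [v]) (ws @ [v]))) = set (v # ws)" by simp
  then show ?thesis by simp
qed

lemma hole_induced_cycle:
  assumes G: "pair_graph G" and h: "hole (pverts G) (\<lambda>a b. (a, b) \<in> parcs G) v ws"
  shows "\<exists>p. induced_cycle G p \<and> 4 \<le> length p"
proof -
  interpret pair_graph G by fact
  let ?E = "\<lambda>a b. (a, b) \<in> parcs G"
  have sym: "?E b a" if "?E a b" for a b using that pair_sym_arcs by (auto simp: symmetric_def sym_def)
  have irr: "\<not> ?E a a" for a using pair_no_loops by fastforce
  have W: "set (v # ws) \<subseteq> pverts G" "distinct (v # ws)" "3 \<le> length ws" "successively ?E ws"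
    "chordless ?E ws" "?E v (hd ws)" "?E (last ws) v" and vn: "\<And>a. a \<in> set ws \<Longrightarrow> ?E v a \<Longrightarrow> a = hd ws \<or> a = last ws"
    using h unfolding hole_def by blast+
  have ne: "ws \<noteq> []" using W(3) by auto
  \<comment> \<open>Zipping the closed vertex list with its tail yields the consecutive pairs as
    arcs, so that vertex lists and arc walks determine each other.\<close>
  define p where "p = zip (v # ws @ [v]) (ws @ [v])"
  have succ: "successively ?E (v # ws @ [v])"
    using W(4,6,7) ne by (auto simp: successively_append_iff successively_Cons)
  then have pE: "set p \<subseteq> parcs G" unfolding successively_zip p_def by auto
  have pne: "p \<noteq> []" by (simp add: p_def)
  have "pcas v p v" using pcas_zip[of v "ws @ [v]"] by (simp add: p_def)
  moreover have "pawalk_verts v p = v # ws @ [v]" unfolding p_def by (rule pawalk_verts_zip)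
  ultimately have cyc: "pre_digraph.cycle (with_proj G) p"
    unfolding pre_digraph.cycle_def pre_digraph.awalk_def
    using W(1,2) pE pne by (intro exI[of _ v]) auto
  have verts: "fst ` set p = set (v # ws)" unfolding p_def by (rule fst_zip_closed)
  have snds: "snd ` set p \<subseteq> set (v # ws)"
    unfolding p_def by (auto dest: set_zip_rightD)
  have mem: "(a, b) \<in> set p" if "v # ws @ [v] = as @ a # b # cs" for a b as cs
    unfolding p_def by (rule consecutive_in_zip[OF that])
  obtain us where us: "ws = hd ws # us" using ne by (cases ws) auto
  obtain zs where zs: "ws = zs @ [last ws]" using ne by (metis append_butlast_last_id)
  have first: "(v, hd ws) \<in> set p" using mem[of "[]" v "hd ws" "us @ [v]"] us by simp
  have lst: "(last ws, v) \<in> set p" using mem[of "v # zs" "last ws" v "[]"] zs by simp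
  have inner: "(a, b) \<in> set p \<or> (b, a) \<in> set p" if ab: "a \<in> set ws" "b \<in> set ws" "?E a b" for a b
  proof -
    have nab: "a \<noteq> b" using irr ab(3) by blast
    obtain xs ys where x: "ws = xs @ a # ys" using split_list[OF ab(1)] by blast
    consider "b \<in> set xs" | "b \<in> set ys" using ab(2) x nab by auto
    then show ?thesis
    proof cases
      case 1
      then obtain ps qs where "xs = ps @ b # qs" using split_list by metis
      then have w: "ws = ps @ b # qs @ a # ys" using x by simp
      then have "qs = []" using W(5) sym[OF ab(3)] unfolding chordless_def by blast
      then show ?thesis using mem[of "v # ps" b a "ys @ [v]"] w by simp
    next
      case 2
      then obtain ps qs where "ys = ps @ b # qs" using split_list by metis
      then have w: "ws = xs @ a # ps @ b # qs" using x by simp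
      then have "ps = []" using W(5) ab(3) unfolding chordless_def by blast
      then show ?thesis using mem[of "v # xs" a b "qs @ [v]"] w by simp
    qed
  qed
  have atv: "(v, b) \<in> set p \<or> (b, v) \<in> set p" if "b \<in> set ws" "?E v b" for b
    using vn[OF that] first lst by auto
  have "arcs (with_proj G \<restriction> (fst ` set p)) = set p \<union> (set p)\<inverse>"
  proof
    show "arcs (with_proj G \<restriction> (fst ` set p)) \<subseteq> set p \<union> (set p)\<inverse>"
    proof
      fix e assume "e \<in> arcs (with_proj G \<restriction> (fst ` set p))"
      then obtain a b where e: "e = (a, b)" "?E a b" "a \<in> set (v # ws)" "b \<in> set (v # ws)"
        unfolding verts by (cases e) auto
      have "(a, b) \<in> set p \<or> (b, a) \<in> set p"
      proof (cases "a = v")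
        case True
        then have "b \<in> set ws" using e irr by auto
        then show ?thesis using atv e(2) True by blast
      next
        case a: False
        then have aw: "a \<in> set ws" using e(3) by simp
        show ?thesis
        proof (cases "b = v")
          case True then show ?thesis using atv[OF aw] sym[OF e(2)] by blast
        next
          case False then show ?thesis using inner[OF aw _ e(2)] e(4) by simp
        qed
      qed
      then show "e \<in> set p \<union> (set p)\<inverse>" using e(1) by auto
    qed
    show "set p \<union> (set p)\<inverse> \<subseteq> arcs (with_proj G \<restriction> (fst ` set p))"
    proof
      fix e assume "e \<in> set p \<union> (set p)\<inverse>"
      then obtain a b where ab: "(a, b) \<in> set p" "e = (a, b) \<or> e = (b, a)" by (cases e) auto
      have "a \<in> set (v # ws)" "b \<in> set (v # ws)" using ab(1) verts snds by (metis fst_conv image_eqI, metis image_eqI snd_conv subsetD)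
      moreover have "?E a b" using ab(1) pE by blast
      ultimately show "e \<in> arcs (with_proj G \<restriction> (fst ` set p))" using ab(2) sym unfolding verts by auto
    qed
  qed
  then have "induced_cycle G p" using cyc by (simp add: induced_cycle_def)
  moreover have "4 \<le> length p" using W(3) by (simp add: p_def)
  ultimately show ?thesis by blast
qed

lemma chordal_dismantlable:
  assumes G: "pair_graph G" and ch: "chordal G"
  shows "dismantlable (pverts G) (\<lambda>a b. (a, b) \<in> parcs G)"
  unfolding dismantlable_def
proof (intro allI impI)
  interpret pair_graph G by fact
  fix U assume U: "U \<subseteq> pverts G" "U \<noteq> {}"
  show "\<exists>v. simplicial_in U (\<lambda>a b. (a, b) \<in> parcs G) v"
  proof (rule simplicial_exists)
    show "finite U" using U(1) pair_finite_verts by (rule finite_subset)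
    show "symp (\<lambda>a b. (a, b) \<in> parcs G)" using pair_sym_arcs by (auto simp: symmetric_def sym_def symp_def)
    show "(a, a) \<notin> parcs G" for a using pair_no_loops by fastforce
    show "\<not> hole U (\<lambda>a b. (a, b) \<in> parcs G) v ws" for v ws
    proof
      assume "hole U (\<lambda>a b. (a, b) \<in> parcs G) v ws"
      then have "hole (pverts G) (\<lambda>a b. (a, b) \<in> parcs G) v ws" using U(1) unfolding hole_def by blast
      then show False using hole_induced_cycle[OF G] ch unfolding chordal_def by blast
    qed
  qed (rule U(2))
qed

section \<open>From 4-chordal graphs to systems with triangles\<close>

lemma graph_triangle_sys:
  fixes f :: "'a \<Rightarrow> nat"
  assumes fin: "finite V" and sym: "symp E" and inj: "inj_on f V"
    and cl: "\<forall>v\<in>V. pairwise E {u \<in> V. E u v \<and> f u < f v}"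
    and C: "\<And>B. B \<in> C \<Longrightarrow> maxclique V E B \<and> 3 \<le> card B"
    and four: "\<And>a b. a \<in> V \<Longrightarrow> b \<in> V \<Longrightarrow> E a b \<Longrightarrow> \<exists>Q\<subseteq>V. pairwise E Q \<and> 4 \<le> card Q \<and> a \<in> Q \<and> b \<in> Q"
  shows "triangle_sys (f ` V) (ranked V E f) {n \<in> f ` V. \<exists>B\<in>C. bag (ranked V E f) n = f ` B}"
proof -
  let ?S = "ranked V E f" and ?J = "{n \<in> f ` V. \<exists>B\<in>C. bag (ranked V E f) n = f ` B}"
  have sys: "peo_sys {} (f ` V) ?S {}"
    using ranked_sys[OF fin inj _ _ cl, of "{}"] by simp
  interpret peo_sys "{}" "f ` V" ?S "{}" by (rule sys)
  have nS: "n \<notin> ?S n" for n by (auto simp: ranked_def)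
  have cbag: "card (bag ?S n) = Suc (card (?S n))" if "n \<in> f ` V" for n
    using finS[OF that] nS by (simp add: bag_def)
  show ?thesis
  proof (rule triangle_sys.intro[OF sys], rule triangle_sys_axioms.intro)
    show "?J \<subseteq> f ` V" by blast
    fix n assume n: "n \<in> ?J"
    then obtain B where B: "B \<in> C" "bag ?S n = f ` B" "n \<in> f ` V" by blast
    have mB: "maxclique V E B" "3 \<le> card B" "B \<subseteq> V" "pairwise E B"
      using C[OF B(1)] by (auto simp: maxclique_def)
    have "card (f ` B) = card B" using inj mB(3) by (metis card_image inj_on_subset)
    then show "2 \<le> card (?S n)" using cbag[OF B(3)] B(2) mB(2) by simp
    show "\<not> bag ?S n \<subseteq> ?S j" if "j \<in> f ` V" for j
      by (rule ranked_bag_maximal[OF sym inj mB(1) B(2) that])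
    fix x y assume xy: "x \<in> bag ?S n" "y \<in> bag ?S n" "x \<noteq> y"
    obtain a b where ab: "a \<in> B" "b \<in> B" "x = f a" "y = f b" using xy B(2) by auto
    have "E a b" by (rule pairwiseD[OF mB(4) ab(1,2)]) (use ab(3,4) xy(3) in blast)
    then obtain Q where Q: "Q \<subseteq> V" "pairwise E Q" "4 \<le> card Q" "a \<in> Q" "b \<in> Q"
      using four[of a b] ab mB(3) by blast
    obtain t where t: "t \<in> Q" "f ` Q \<subseteq> bag ?S (f t)"
      using ranked_clique[OF fin inj Q(1,2)] Q(4) by blast
    have tV: "f t \<in> f ` V" using t(1) Q(1) by blast
    have "card Q = card (f ` Q)" using inj Q(1) by (metis card_image inj_on_subset)
    also have "\<dots> \<le> card (bag ?S (f t))" by (rule card_mono[OF _ t(2)]) (use finS[OF tV] in \<open>simp add: bag_def\<close>)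
    finally have "3 \<le> card (?S (f t))" using Q(3) cbag[OF tV] by simp
    then show "\<exists>k\<in>f ` V. 3 \<le> card (?S k) \<and> x \<in> bag ?S k \<and> y \<in> bag ?S k"
      using t(2) tV ab(3,4) Q(4,5) by blast
  qed
qed

theorem theorem3:
  fixes G :: "'a pair_pre_digraph"
  assumes "pair_graph G"
    and "four_chordal G"
    and "card (pverts G) \<ge> 5"
  shows "\<exists>U. clique_transversal G U \<and>
    int (card U) \<le> \<lfloor>2 * (real (card (pverts G)) - 1) / 7\<rfloor>"
proof -
  interpret pair_graph G by fact
  define V where "V = pverts G"
  define E where "E = (\<lambda>a b. (a, b) \<in> parcs G)"
  have fin: "finite V" unfolding V_def by (rule pair_finite_verts)
  have sym: "symp E" using pair_sym_arcs by (auto simp: E_def symmetric_def sym_def symp_def)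
  have clq: "k_clique G k Q \<longleftrightarrow> Q \<subseteq> V \<and> card Q = k \<and> pairwise E Q" for k Q
    unfolding k_clique_iff[OF assms(1)] V_def E_def pairwise_def ..
  then have cl: "clique G Q \<longleftrightarrow> Q \<subseteq> V \<and> pairwise E Q" for Q by (simp add: clique_def)
  have four: "\<exists>Q\<subseteq>V. pairwise E Q \<and> 4 \<le> card Q \<and> a \<in> Q \<and> b \<in> Q" if e: "E a b" for a b
  proof -
    have "(a, b) \<in> parcs G" using e by (simp add: E_def)
    then obtain Q where Q: "k_clique G 4 Q" "a \<in> Q" "b \<in> Q"
      using assms(2) unfolding four_chordal_def by auto
    then have "Q \<subseteq> V" "pairwise E Q" "card Q = 4" using clq[of 4 Q] by simp_all
    then show ?thesis using Q(2,3) by auto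
  qed
  have dis: "dismantlable V E"
    using chordal_dismantlable[OF assms(1)] assms(2) unfolding V_def E_def four_chordal_def by blast
  obtain f :: "'a \<Rightarrow> nat" where inj: "inj_on f V" and rank: "\<forall>v\<in>V. pairwise E {u \<in> V. E u v \<and> f u < f v}"
    using ranking_exists[OF fin sym dis, of "{}"] by auto
  let ?S = "ranked V E f"
  define C where "C = {B. maxclique V E B \<and> 3 \<le> card B}"
  define J where "J = {n \<in> f ` V. \<exists>B\<in>C. bag ?S n = f ` B}"
  have "triangle_sys (f ` V) ?S J" unfolding J_def
  proof (rule graph_triangle_sys[OF fin sym inj rank])
    show "maxclique V E B \<and> 3 \<le> card B" if "B \<in> C" for B using that by (simp add: C_def)
  qed (rule four)
  moreover have cV: "card (f ` V) = card V" using inj by (rule card_image)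
  moreover have "5 \<le> card V" using assms(3) by (simp add: V_def)
  ultimately have "within_bound (f ` V) ?S J" using within_bound_exists by metis
  then obtain T where T: "T \<subseteq> f ` V" "transv ?S J T" "7 * card T + 2 \<le> 2 * card V"
    unfolding within_bound_def cV by blast
  obtain U where U: "U \<subseteq> V" "T = f ` U" using T(1) by (meson subset_imageE)
  have cU: "card T = card U" using U inj by (metis card_image inj_on_subset)
  have "B \<inter> U \<noteq> {}" if B: "nontrivial_clique G B" "maximal_clique G B" for B
  proof -
    have BV: "B \<subseteq> V" "pairwise E B" and two: "2 \<le> card B"
      and maxB: "\<And>D. D \<subseteq> V \<Longrightarrow> pairwise E D \<Longrightarrow> B \<subseteq> D \<Longrightarrow> D = B"
      using B cl unfolding nontrivial_clique_def maximal_clique_def by blast+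
    \<comment> \<open>Every edge lies in a clique of four vertices and so is not maximal. Hence each
      non-trivial maximal clique has at least three vertices and belongs to
      \<open>C\<close>.\<close>
    have "card B \<noteq> 2"
    proof
      assume c2: "card B = 2"
      then obtain a b where ab: "B = {a, b}" "a \<noteq> b" by (auto simp: card_2_iff)
      then have "E a b" using BV(2) by (simp add: pairwise_def)
      then obtain Q where Q: "Q \<subseteq> V" "pairwise E Q" "4 \<le> card Q" "a \<in> Q" "b \<in> Q" using four by blast
      then have "Q = B" using maxB[of Q] ab(1) by blast
      then show False using Q(3) c2 by simp
    qed
    then have "3 \<le> card B" using two by simp
    moreover have mB: "maxclique V E B" unfolding maxclique_def using BV maxB by blast
    ultimately have "B \<in> C" "B \<noteq> {}" by (auto simp: C_def)
    obtain t where t: "t \<in> B" "bag ?S (f t) = f ` B"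
      using ranked_maxclique[OF fin sym inj rank mB \<open>B \<noteq> {}\<close>] by blast
    have "f t \<in> J" using t BV(1) \<open>B \<in> C\<close> unfolding J_def by blast
    then have "f ` B \<inter> f ` U \<noteq> {}" using T(2) t(2) U(2) unfolding transv_def by metis
    then obtain b d where bd: "b \<in> B" "d \<in> U" "f b = f d" by auto
    have "b = d" by (rule inj_onD[OF inj bd(3)]) (use bd BV U in blast)+
    then show ?thesis using bd by blast
  qed
  then have "clique_transversal G U" using U(1) by (auto simp: clique_transversal_def V_def)
  moreover have "int (card U) \<le> \<lfloor>2 * (real (card (pverts G)) - 1) / 7\<rfloor>"
  proof -
    have "7 * real (card U) + 2 \<le> 2 * real (card V)" using T(3) cU by linarith
    then show ?thesis by (simp add: le_floor_iff V_def field_simps)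
  qed
  ultimately show ?thesis by blast
qed

end
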